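(* Let $g$ be a loxodromic element of ${\rm Sp}(n,1)$ with $M_g<1$ and with fixed points $u,v\in\partial{\bf H}^n_{\mathbb H}$. Let $h$ be any other element of ${\rm Sp}(n,1)$. If $$\bigl|[h(u),u,v,h(v)]\bigr|^{1/2}\,\bigl|[h(u),v,u,h(v)]\bigr|^{1/2}<\frac{1-M_g}{M_g^2},$$ then the group $\langle g,h\rangle$ is either elementary or not discrete.
   Context: Let $\mathbb H$ be the quaternions, $n$ a positive integer, and $\mathbb H^{n,1}$ the right quaternionic vector space of column vectors with $n+1$ quaternionic entries, with the Hermitian form $\langle {\bf z},{\bf w}\rangle=\overline{w}_1z_1+\cdots+\overline{w}_{n-1}z_{n-1}-(\overline{w}_nz_{n+1}+\overline{w}_{n+1}z_n)$. ${\rm Sp}(n,1)$ is the group of linear automorphisms (matrices acting on the left) preserving this form. Let $V_0=\{{\bf z}\ne 0:\langle {\bf z},{\bf z}\rangle=0\}$, $V_-=\{{\bf z}:\langle {\bf z},{\bf z}\rangle<0\}$, and let $\mathbb P$ be the right projection ${\bf z}\mapsto[{\bf z}]$, where ${\bf z}\sim{\bf z}\lambda$ for $\lambda\in\mathbb H\setminus\{0\}$. Quaternionic hyperbolic space is ${\bf H}^n_{\mathbb H}=\mathbb P(V_-)$, with boundary $\partial{\bf H}^n_{\mathbb H}=\mathbb P(V_0)$; ${\rm Sp}(n,1)$ acts on both. An element $g\in{\rm Sp}(n,1)$ is loxodromic if it has exactly two fixed points in ${\bf H}^n_{\mathbb H}\cup\partial{\bf H}^n_{\mathbb H}$, and both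 lie in $\partial{\bf H}^n_{\mathbb H}$. Such $g$ is conjugate in ${\rm Sp}(n,1)$ to ${\rm diag}(\lambda_1,\ldots,\lambda_{n-1},\lambda_n,\overline{\lambda}_n^{-1})$ with $\lambda_i\in\mathbb H$, $|\lambda_i|=1$ for $1\le i\le n-1$, and $|\lambda_n|>1$. Define the conjugacy invariants $$\delta(g)=\max_{1\le i\le n-1}|\lambda_i-1|,\qquad M_g=2\delta(g)+|\lambda_n-1|+|\overline{\lambda}_n^{-1}-1|$$ (a maximum over an empty index set is $0$). For $z_1,z_2,w_1,w_2\in{\bf H}^n_{\mathbb H}\cup\partial{\bf H}^n_{\mathbb H}$ with lifts ${\bf z}_i\in\mathbb P^{-1}(z_i)$, ${\bf w}_i\in\mathbb P^{-1}(w_i)$, the absolute value of the quaternionic cross-ratio is $$\bigl|[z_1,z_2,w_1,w_2]\bigr|=\frac{|\langle {\bf w}_1,{\bf z}_1\rangle|\,|\langle {\bf w}_2,{\bf z}_2\rangle|}{|\langle {\bf w}_1,{\bf z}_2\rangle|\,|\langle {\bf w}_2,{\bf z}_1\rangle|},$$ which is independent of the lifts. A subgroup of ${\rm Sp}(n,1)$ is elementary if it has a finite orbit in ${\bf H}^n_{\mathbb H}\cup\partial{\bf H}^n_{\mathbb H}$. *)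

theory Defs
  imports Complex_Main "HOL-Algebra.Generated_Groups" "Jordan_Normal_Form.Matrix"
begin

section \<open>Quaternions\<close>

datatype quat = Quat (qre: real) (qi: real) (qj: real) (qk: real)

lemma quat_eq_iff: "x = y \<longleftrightarrow> qre x = qre y \<and> qi x = qi y \<and> qj x = qj y \<and> qk x = qk y"
  by (cases x; cases y) auto

instantiation quat :: ab_group_add
begin

definition "0 = Quat 0 0 0 0"
definition "x + y = Quat (qre x + qre y) (qi x + qi y) (qj x + qj y) (qk x + qk y)"
definition "- x = Quat (- qre x) (- qi x) (- qj x) (- qk x)"
definition "x - y = Quat (qre x - qre y) (qi x - qi y) (qj x - qj y) (qk x - qk y)"

instance
  by standard (auto simp: quat_eq_iff zero_quat_def plus_quat_def uminus_quat_def minus_quat_def)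

end

lemma quat_add_simps [simp]:
  "qre 0 = 0" "qi 0 = 0" "qj 0 = 0" "qk 0 = 0"
  "qre (x + y) = qre x + qre y" "qi (x + y) = qi x + qi y"
  "qj (x + y) = qj x + qj y" "qk (x + y) = qk x + qk y"
  "qre (- x) = - qre x" "qi (- x) = - qi x" "qj (- x) = - qj x" "qk (- x) = - qk x"
  "qre (x - y) = qre x - qre y" "qi (x - y) = qi x - qi y"
  "qj (x - y) = qj x - qj y" "qk (x - y) = qk x - qk y"
  by (simp_all add: zero_quat_def plus_quat_def uminus_quat_def minus_quat_def)

instantiation quat :: real_vector
begin

definition "scaleR r x = Quat (r * qre x) (r * qi x) (r * qj x) (r * qk x)"

instance
  by standard (auto simp: quat_eq_iff scaleR_quat_def algebra_simps)

end

lemma quat_scaleR_simps [simp]: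
  "qre (scaleR r x) = r * qre x" "qi (scaleR r x) = r * qi x"
  "qj (scaleR r x) = r * qj x" "qk (scaleR r x) = r * qk x"
  by (simp_all add: scaleR_quat_def)

instantiation quat :: real_algebra_1
begin

definition "1 = Quat 1 0 0 0"
definition "x * y = Quat
  (qre x * qre y - qi x * qi y - qj x * qj y - qk x * qk y)
  (qre x * qi y + qi x * qre y + qj x * qk y - qk x * qj y)
  (qre x * qj y - qi x * qk y + qj x * qre y + qk x * qi y)
  (qre x * qk y + qi x * qj y - qj x * qi y + qk x * qre y)"

instance
  by standard (auto simp: quat_eq_iff one_quat_def times_quat_def algebra_simps)

end

lemma quat_mult_simps [simp]:
  "qre 1 = 1" "qi 1 = 0" "qj 1 = 0" "qk 1 = 0"
  "qre (x * y) = qre x * qre y - qi x * qi y - qj x * qj y - qk x * qk y"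
  "qi (x * y) = qre x * qi y + qi x * qre y + qj x * qk y - qk x * qj y"
  "qj (x * y) = qre x * qj y - qi x * qk y + qj x * qre y + qk x * qi y"
  "qk (x * y) = qre x * qk y + qi x * qj y - qj x * qi y + qk x * qre y"
  by (simp_all add: one_quat_def times_quat_def)

definition qcnj :: "quat \<Rightarrow> quat" where
  "qcnj x = Quat (qre x) (- qi x) (- qj x) (- qk x)"

lemma qcnj_simps [simp]:
  "qre (qcnj x) = qre x" "qi (qcnj x) = - qi x" "qj (qcnj x) = - qj x" "qk (qcnj x) = - qk x"
  by (simp_all add: qcnj_def)

definition qnormsq :: "quat \<Rightarrow> real" where
  "qnormsq x = (qre x)\<^sup>2 + (qi x)\<^sup>2 + (qj x)\<^sup>2 + (qk x)\<^sup>2"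

lemma qnormsq_eq_0_iff: "qnormsq x = 0 \<longleftrightarrow> x = 0"
  unfolding qnormsq_def quat_eq_iff
  by (simp add: add_nonneg_eq_0_iff)

lemma qnormsq_mult: "qnormsq (x * y) = qnormsq x * qnormsq y"
  unfolding qnormsq_def by (simp add: power2_eq_square algebra_simps)

lemma qcnj_mult_self: "qcnj x * x = of_real (qnormsq x)" "x * qcnj x = of_real (qnormsq x)"
  by (simp_all add: quat_eq_iff of_real_def qnormsq_def power2_eq_square)

instantiation quat :: real_div_algebra
begin

definition inverse_quat :: "quat \<Rightarrow> quat" where
  "inverse x = scaleR (inverse (qnormsq x)) (qcnj x)"
definition "x div y = x * inverse y" for x y :: quat

instance
proof
  fix x y :: quat
  show "x \<noteq> 0 \<Longrightarrow> inverse x * x = 1" "x \<noteq> 0 \<Longrightarrow> x * inverse x = 1"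
    by (simp_all add: inverse_quat_def qcnj_mult_self qnormsq_eq_0_iff of_real_def)
  show "x div y = x * inverse y"
    by (rule divide_quat_def)
  show "inverse (0 :: quat) = 0"
    by (simp add: inverse_quat_def qnormsq_def)
qed

end

instantiation quat :: real_normed_div_algebra
begin

definition norm_quat :: "quat \<Rightarrow> real" where
  "norm x = sqrt (qnormsq x)"
definition "sgn x = scaleR (inverse (norm x)) x" for x :: quat
definition "dist x y = norm (x - y)" for x y :: quat
definition uniformity_quat :: "(quat \<times> quat) filter" where
  "uniformity = (INF e\<in>{0 <..}. principal {(x, y :: quat). dist x y < e})"
definition open_quat :: "quat set \<Rightarrow> bool" where
  "open (U :: quat set) \<longleftrightarrow> (\<forall>x\<in>U. eventually (\<lambda>(x', y). x' = x \<longrightarrow> y \<in> U) uniformity)"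

instance
proof
  fix r :: real and x y :: quat and U :: "quat set"
  show "norm x = 0 \<longleftrightarrow> x = 0"
    by (simp add: norm_quat_def qnormsq_eq_0_iff)
  show "norm (scaleR r x) = \<bar>r\<bar> * norm x"
    by (simp add: norm_quat_def qnormsq_def power_mult_distrib real_sqrt_mult
        flip: distrib_left)
  show "norm (x * y) = norm x * norm y"
    by (simp add: norm_quat_def qnormsq_mult real_sqrt_mult)
  show "norm (x + y) \<le> norm x + norm y"
  proof -
    have eq: "norm z = sqrt ((sqrt ((qre z)\<^sup>2 + (qi z)\<^sup>2))\<^sup>2 + (sqrt ((qj z)\<^sup>2 + (qk z)\<^sup>2))\<^sup>2)"
      for z :: quat
      by (simp add: norm_quat_def qnormsq_def)
    have "norm (x + y) \<le>
      sqrt ((sqrt ((qre x)\<^sup>2 + (qi x)\<^sup>2) + sqrt ((qre y)\<^sup>2 + (qi y)\<^sup>2))\<^sup>2 +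
            (sqrt ((qj x)\<^sup>2 + (qk x)\<^sup>2) + sqrt ((qj y)\<^sup>2 + (qk y)\<^sup>2))\<^sup>2)"
      unfolding eq quat_add_simps
      by (intro real_sqrt_le_mono add_mono power_mono real_sqrt_sum_squares_triangle_ineq) auto
    also have "\<dots> \<le> norm x + norm y"
      unfolding eq by (rule real_sqrt_sum_squares_triangle_ineq)
    finally show ?thesis .
  qed
qed (rule sgn_quat_def dist_quat_def open_quat_def uniformity_quat_def)+

end


section \<open>The Hermitian form and \<open>Sp(n,1)\<close>\<close>

text \<open>Vectors and matrices are indexed from \<open>0\<close>: the coordinate \<open>z\<^sub>k\<close> of the usual
  one-based notation is \<open>z $ (k - 1)\<close>, for \<open>1 \<le> k \<le> n + 1\<close>. The parameter \<open>n\<close> is always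
  assumed to be positive.\<close>

definition hform :: "nat \<Rightarrow> quat vec \<Rightarrow> quat vec \<Rightarrow> quat" where
  "hform n z w = (\<Sum>k<n - 1. qcnj (w $ k) * z $ k)
     - (qcnj (w $ (n - 1)) * z $ n + qcnj (w $ n) * z $ (n - 1))"

definition Sp :: "nat \<Rightarrow> quat mat monoid" where
  "Sp n = \<lparr>carrier = {A \<in> carrier_mat (n + 1) (n + 1). invertible_mat A \<and>
             (\<forall>z \<in> carrier_vec (n + 1). \<forall>w \<in> carrier_vec (n + 1).
                hform n (A *\<^sub>v z) (A *\<^sub>v w) = hform n z w)},
           monoid.mult = (*), one = 1\<^sub>m (n + 1)\<rparr>"

lemma Sp_simps:
  "A \<in> carrier (Sp n) \<longleftrightarrow> A \<in> carrier_mat (n + 1) (n + 1) \<and> invertible_mat A \<and>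
     (\<forall>z \<in> carrier_vec (n + 1). \<forall>w \<in> carrier_vec (n + 1).
        hform n (A *\<^sub>v z) (A *\<^sub>v w) = hform n z w)"
  "A \<otimes>\<^bsub>Sp n\<^esub> B = A * B" "\<one>\<^bsub>Sp n\<^esub> = 1\<^sub>m (n + 1)"
  by (simp_all add: Sp_def)

lemma group_Sp: "group (Sp n)"
proof (rule groupI)
  show "\<one>\<^bsub>Sp n\<^esub> \<in> carrier (Sp n)"
    unfolding Sp_simps by (auto simp: invertible_mat_def inverts_mat_def intro!: exI[of _ "1\<^sub>m (Suc n)"])
next
  fix A B assume "A \<in> carrier (Sp n)" "B \<in> carrier (Sp n)"
  then have A: "A \<in> carrier_mat (n + 1) (n + 1)" and iA: "invertible_mat A"
    and pA: "\<And>z w. \<lbrakk>z \<in> carrier_vec (n + 1); w \<in> carrier_vec (n + 1)\<rbrakk> \<Longrightarrow>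
      hform n (A *\<^sub>v z) (A *\<^sub>v w) = hform n z w"
    and B: "B \<in> carrier_mat (n + 1) (n + 1)" and iB: "invertible_mat B"
    and pB: "\<And>z w. \<lbrakk>z \<in> carrier_vec (n + 1); w \<in> carrier_vec (n + 1)\<rbrakk> \<Longrightarrow>
      hform n (B *\<^sub>v z) (B *\<^sub>v w) = hform n z w"
    unfolding Sp_simps by blast+
  have "invertible_mat (A * B)"
  proof -
    obtain A' where A': "A * A' = 1\<^sub>m (n + 1)" "A' * A = 1\<^sub>m (dim_row A')"
      using iA A unfolding invertible_mat_def inverts_mat_def by auto
    then have cA': "A' \<in> carrier_mat (n + 1) (n + 1)"
      using A by (metis carrier_matD(2) carrier_matI index_mult_mat(3) index_one_mat(3))
    obtain B' where B': "B * B' = 1\<^sub>m (n + 1)" "B' * B = 1\<^sub>m (dim_row B')"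
      using iB B unfolding invertible_mat_def inverts_mat_def by auto
    then have cB': "B' \<in> carrier_mat (n + 1) (n + 1)"
      using B by (metis carrier_matD(2) carrier_matI index_mult_mat(3) index_one_mat(3))
    have "(A * B) * (B' * A') = A * (B * (B' * A'))"
      using A B cA' cB' by (intro assoc_mult_mat) auto
    also have "B * (B' * A') = (B * B') * A'"
      using B cA' cB' by (intro assoc_mult_mat[symmetric]) auto
    finally have 1: "(A * B) * (B' * A') = 1\<^sub>m (n + 1)"
      using A' B' cA' by simp
    have "(B' * A') * (A * B) = B' * (A' * (A * B))"
      using A B cA' cB' by (intro assoc_mult_mat) auto
    also have "A' * (A * B) = (A' * A) * B"
      using A B cA' by (intro assoc_mult_mat[symmetric]) auto
    finally have 2: "(B' * A') * (A * B) = 1\<^sub>m (n + 1)"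
      using A' B' B cA' cB' by simp
    show ?thesis
      using 1 2 A B cA' cB' unfolding invertible_mat_def inverts_mat_def by auto
  qed
  then show "A \<otimes>\<^bsub>Sp n\<^esub> B \<in> carrier (Sp n)"
    using A B pA pB unfolding Sp_simps
    by (auto simp: assoc_mult_mat_vec[of _ "Suc n" "Suc n" _ "Suc n"])
next
  fix A assume "A \<in> carrier (Sp n)"
  then have A: "A \<in> carrier_mat (n + 1) (n + 1)" and iA: "invertible_mat A"
    and pA: "\<And>z w. \<lbrakk>z \<in> carrier_vec (n + 1); w \<in> carrier_vec (n + 1)\<rbrakk> \<Longrightarrow>
      hform n (A *\<^sub>v z) (A *\<^sub>v w) = hform n z w"
    unfolding Sp_simps by blast+
  obtain A' where A': "A * A' = 1\<^sub>m (n + 1)" "A' * A = 1\<^sub>m (dim_row A')"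
    using iA A unfolding invertible_mat_def inverts_mat_def by auto
  then have cA': "A' \<in> carrier_mat (n + 1) (n + 1)"
    using A by (metis carrier_matD(2) carrier_matI index_mult_mat(3) index_one_mat(3))
  have eq: "A *\<^sub>v (A' *\<^sub>v z) = z" if "z \<in> carrier_vec (n + 1)" for z
    using that A cA' A' by (metis assoc_mult_mat_vec one_mult_mat_vec)
  have "hform n (A' *\<^sub>v z) (A' *\<^sub>v w) = hform n z w"
    if "z \<in> carrier_vec (n + 1)" "w \<in> carrier_vec (n + 1)" for z w
    using pA[of "A' *\<^sub>v z" "A' *\<^sub>v w"] that eq cA' by auto
  moreover have "invertible_mat A'"
    using A A' cA' unfolding invertible_mat_def inverts_mat_def by auto
  ultimately have "A' \<in> carrier (Sp n)"
    using cA' unfolding Sp_simps by blast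
  then show "\<exists>B\<in>carrier (Sp n). B \<otimes>\<^bsub>Sp n\<^esub> A = \<one>\<^bsub>Sp n\<^esub>"
    using A' cA' by (intro bexI[of _ A']) (auto simp: Sp_simps(2,3))
qed (auto simp: Sp_simps intro!: assoc_mult_mat[of _ "Suc n" "Suc n" _ "Suc n" _ "Suc n"])


section \<open>Quaternionic hyperbolic space and its boundary\<close>

text \<open>The form is Hermitian, so \<open>hform n z z\<close> is real.\<close>

lemma hform_cnj: "qcnj (hform n z w) = hform n w z"
proof -
  have [simp]: "qcnj (x + y) = qcnj x + qcnj y" "qcnj (x - y) = qcnj x - qcnj y"
    "qcnj (x * y) = qcnj y * qcnj x" "qcnj (qcnj x) = x" "qcnj 0 = 0" for x y
    by (simp_all add: quat_eq_iff algebra_simps)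
  have "qcnj (sum f A) = (\<Sum>x\<in>A. qcnj (f x))" for f :: "nat \<Rightarrow> quat" and A
    by (induction A rule: infinite_finite_induct) auto
  then show ?thesis
    by (simp add: hform_def add.commute)
qed

lemma hform_self_real: "hform n z z = of_real (qre (hform n z z))"
  using hform_cnj[of n z z] by (simp add: quat_eq_iff of_real_def)

definition V_zero :: "nat \<Rightarrow> quat vec set" where
  "V_zero n = {z \<in> carrier_vec (n + 1). z \<noteq> 0\<^sub>v (n + 1) \<and> hform n z z = 0}"

definition V_minus :: "nat \<Rightarrow> quat vec set" where
  "V_minus n = {z \<in> carrier_vec (n + 1). qre (hform n z z) < 0}"

definition rscale :: "quat vec \<Rightarrow> quat \<Rightarrow> quat vec" where
  "rscale z c = map_vec (\<lambda>x. x * c) z"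

text \<open>A point of projective space is the set of all its lifts.\<close>

definition proj_pt :: "quat vec \<Rightarrow> quat vec set" where
  "proj_pt z = {rscale z c | c. c \<noteq> 0}"

definition hyp_space :: "nat \<Rightarrow> quat vec set set" where
  "hyp_space n = proj_pt ` V_minus n"

definition hyp_boundary :: "nat \<Rightarrow> quat vec set set" where
  "hyp_boundary n = proj_pt ` V_zero n"

definition hyp_closure :: "nat \<Rightarrow> quat vec set set" where
  "hyp_closure n = hyp_space n \<union> hyp_boundary n"

definition act :: "quat mat \<Rightarrow> quat vec set \<Rightarrow> quat vec set" where
  "act A p = (\<lambda>z. A *\<^sub>v z) ` p"

lemma act_proj_pt:
  assumes "A \<in> carrier_mat m k" "z \<in> carrier_vec k"
  shows "act A (proj_pt z) = proj_pt (A *\<^sub>v z)"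
proof -
  have "A *\<^sub>v rscale z c = rscale (A *\<^sub>v z) c" for c
    using assms
    by (intro eq_vecI)
      (auto simp: rscale_def scalar_prod_def sum_distrib_right mult.assoc intro!: sum.cong)
  moreover have "act A (proj_pt z) = {A *\<^sub>v rscale z c | c. c \<noteq> 0}"
    unfolding act_def proj_pt_def by auto
  ultimately show ?thesis
    by (simp add: proj_pt_def)
qed

definition loxodromic :: "nat \<Rightarrow> quat mat \<Rightarrow> bool" where
  "loxodromic n g \<longleftrightarrow> g \<in> carrier (Sp n) \<and>
     card {p \<in> hyp_closure n. act g p = p} = 2 \<and>
     {p \<in> hyp_closure n. act g p = p} \<subseteq> hyp_boundary n"


section \<open>The conjugacy invariants of a loxodromic element\<close>

text \<open>\<open>l i\<close> for \<open>i < n\<close> is the quaternion \<open>\<lambda>\<close> with one-based index \<open>i + 1\<close>; the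
  values \<open>l i\<close> for \<open>i \<ge> n\<close> play no role.\<close>

definition loxo_diag :: "nat \<Rightarrow> (nat \<Rightarrow> quat) \<Rightarrow> quat mat" where
  "loxo_diag n l = mat_diag (n + 1) (\<lambda>i. if i < n then l i else inverse (qcnj (l (n - 1))))"

definition loxo_normal_form :: "nat \<Rightarrow> quat mat \<Rightarrow> (nat \<Rightarrow> quat) \<Rightarrow> bool" where
  "loxo_normal_form n g l \<longleftrightarrow>
     (\<forall>i<n - 1. norm (l i) = 1) \<and> norm (l (n - 1)) > 1 \<and>
     (\<exists>f \<in> carrier (Sp n). g = f \<otimes>\<^bsub>Sp n\<^esub> loxo_diag n l \<otimes>\<^bsub>Sp n\<^esub> inv\<^bsub>Sp n\<^esub> f)"

text \<open>The normal form is unique only up to permuting the first \<open>n - 1\<close> entries and replacing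
  each entry by a similar quaternion. The invariants below are unaffected by this, so they
  do not depend on the choice.\<close>

definition loxo_eigs :: "nat \<Rightarrow> quat mat \<Rightarrow> nat \<Rightarrow> quat" where
  "loxo_eigs n g = (SOME l. loxo_normal_form n g l)"

text \<open>Inserting \<open>0\<close> settles the empty maximum (\<open>n = 1\<close>) and changes nothing otherwise.\<close>

definition delta_inv :: "nat \<Rightarrow> quat mat \<Rightarrow> real" where
  "delta_inv n g = Max (insert 0 ((\<lambda>i. norm (loxo_eigs n g i - 1)) ` {..<n - 1}))"

definition M_inv :: "nat \<Rightarrow> quat mat \<Rightarrow> real" where
  "M_inv n g = 2 * delta_inv n g + norm (loxo_eigs n g (n - 1) - 1)
     + norm (inverse (qcnj (loxo_eigs n g (n - 1))) - 1)"


section \<open>Cross-ratio, elementary and discrete groups\<close>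

definition lift :: "quat vec set \<Rightarrow> quat vec" where
  "lift p = (SOME z. z \<in> p)"

definition abs_cross_ratio ::
  "nat \<Rightarrow> quat vec set \<Rightarrow> quat vec set \<Rightarrow> quat vec set \<Rightarrow> quat vec set \<Rightarrow> real" where
  "abs_cross_ratio n z1 z2 w1 w2 =
     norm (hform n (lift w1) (lift z1)) * norm (hform n (lift w2) (lift z2)) /
     (norm (hform n (lift w1) (lift z2)) * norm (hform n (lift w2) (lift z1)))"

text \<open>The absolute cross-ratio can be computed from any choice of lifts.\<close>

lemma abs_cross_ratio_lifts:
  assumes dims: "a \<in> carrier_vec (n + 1)" "b \<in> carrier_vec (n + 1)"
      "c \<in> carrier_vec (n + 1)" "d \<in> carrier_vec (n + 1)" and n: "n \<ge> 1"
  shows "abs_cross_ratio n (proj_pt a) (proj_pt b) (proj_pt c) (proj_pt d) =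
     norm (hform n c a) * norm (hform n d b) / (norm (hform n c b) * norm (hform n d a))"
proof -
  have form: "norm (hform n (rscale z s) (rscale w t)) = norm s * norm t * norm (hform n z w)"
    if "z \<in> carrier_vec (n + 1)" "w \<in> carrier_vec (n + 1)" for z w s t
  proof -
    have cm: "qcnj (x * y) = qcnj y * qcnj x" for x y
      by (simp add: quat_eq_iff algebra_simps)
    have nc: "norm (qcnj x) = norm x" for x
      by (simp add: norm_quat_def qnormsq_def)
    have "hform n (rscale z s) (rscale w t) = qcnj t * hform n z w * s"
      using that n
      by (simp add: hform_def rscale_def cm sum_distrib_left sum_distrib_right
          algebra_simps mult.assoc)
    then show ?thesis
      by (simp add: norm_mult nc)
  qed
  have lift: "\<exists>s. s \<noteq> 0 \<and> lift (proj_pt z) = rscale z s" for z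
  proof -
    have "rscale z 1 \<in> proj_pt z"
      unfolding proj_pt_def by (auto intro!: exI[of _ 1])
    then have "lift (proj_pt z) \<in> proj_pt z"
      unfolding lift_def by (rule someI)
    then show ?thesis
      unfolding proj_pt_def by auto
  qed
  obtain p q r s where
    "p \<noteq> 0" "lift (proj_pt a) = rscale a p" "q \<noteq> 0" "lift (proj_pt b) = rscale b q"
    "r \<noteq> 0" "lift (proj_pt c) = rscale c r" "s \<noteq> 0" "lift (proj_pt d) = rscale d s"
    using lift by metis
  then show ?thesis
    unfolding abs_cross_ratio_def
    by (simp add: form[OF dims(3) dims(1)] form[OF dims(4) dims(2)]
        form[OF dims(3) dims(2)] form[OF dims(4) dims(1)])
qed

definition elementary :: "nat \<Rightarrow> quat mat set \<Rightarrow> bool" where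
  "elementary n G \<longleftrightarrow> (\<exists>p \<in> hyp_closure n. finite ((\<lambda>A. act A p) ` G))"

text \<open>Discreteness in the topology of \<open>Sp(n,1)\<close> as a set of matrices, i.e. that of
  entrywise convergence: every element of \<open>G\<close> is isolated in \<open>G\<close>.\<close>

definition discrete_group :: "quat mat set \<Rightarrow> bool" where
  "discrete_group G \<longleftrightarrow> (\<forall>A\<in>G. \<exists>e>0. \<forall>B\<in>G.
     (\<forall>i<dim_row A. \<forall>j<dim_col A. dist (B $$ (i, j)) (A $$ (i, j)) < e) \<longrightarrow> B = A)"

end

theory Submission
  imports Defs "HOL-Analysis.L2_Norm" "HOL-Computational_Algebra.Fundamental_Theorem_Algebra"
begin

text \<open>Conjugate \<open>g\<close> to its diagonal normal form \<open>D\<close> and let \<open>a, b, c, d\<close> be the entries in the last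
  two rows and columns of the conjugate \<open>H\<^sub>0\<close> of \<open>h\<close>; the two cross-ratios are \<open>|ad|\<close> and \<open>|bc|\<close>.
  Put \<open>H\<^bsub>k+1\<^esub> = H\<^sub>k D H\<^sub>k\<^sup>-\<^sup>1\<close>. Then \<open>|b\<^bsub>k+1\<^esub>| \<le> M |a\<^sub>k b\<^sub>k|\<close> and \<open>|c\<^bsub>k+1\<^esub>| \<le> M |c\<^sub>k d\<^sub>k|\<close>, and Ptolemy's
  inequality gives \<open>|ad|\<^sup>1\<^sup>/\<^sup>2 \<le> 1 + |bc|\<^sup>1\<^sup>/\<^sup>2\<close>, so \<open>t\<^sub>k = |a\<^sub>k b\<^sub>k c\<^sub>k d\<^sub>k|\<^sup>1\<^sup>/\<^sup>2\<close> satisfies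
  \<open>t\<^bsub>k+1\<^esub> \<le> M t\<^sub>k (1 + M t\<^sub>k)\<close>; the hypothesis on the cross-ratios forces \<open>t\<^sub>k \<rightarrow> 0\<close>. Consequently
  \<open>F\<^sub>j = D\<^sup>-\<^sup>j H\<^bsub>2j\<^esub> D\<^sup>j\<close> is bounded with \<open>b, c \<rightarrow> 0\<close>. In a discrete group it takes finitely many values,
  so some \<open>H\<^sub>k\<close> fixes both fixed points of \<open>D\<close>. Since \<open>D\<^sup>2\<close> fixes no other boundary point,
  if \<open>H D H\<^sup>-\<^sup>1\<close> preserves this pair then so does \<open>H\<close>; descending to \<open>H\<^sub>0\<close> shows that
  \<open>\<langle>g, h\<rangle>\<close> preserves the pair \<open>{u, v}\<close>.\<close>

section \<open>Linear systems over a division ring\<close>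

text \<open>The threshold \<open>(1 - M) / M\<^sup>2\<close> is the positive fixed point of
  \<open>t \<mapsto> M t (1 + M t)\<close>: starting below it means
  \<open>M (1 + M t\<^sub>0) < 1\<close>, so \<open>t\<^sub>k\<close> contracts geometrically. The
  single entries need not converge. Up to a factor close to 1, the bound on
  \<open>|b\<^sub>k|\<close> is multiplied by \<open>M |lam|\<close> in each step, which may exceed
  1, and the bound on \<open>|c\<^sub>k|\<close> by \<open>M / |lam|\<close>. Conjugation by powers
  of \<open>D\<close> balances the two; \<open>D\<^sup>j\<close> rescales by \<open>|lam|\<close> to
  the power \<open>2 j\<close>, so it is paired with the iterate of index \<open>2 j\<close>. The
  case in which \<open>h\<close> fixes one of the two points is included, since
  \<open>t\<^sub>0 = 0\<close> is allowed. Two obstacles shape the rest. Over the quaternions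
  eigenvectors are obtained from complex polynomials acting from the right, and inverse matrices
  from elimination. Moreover the invariants refer to an arbitrarily chosen normal form: its
  existence has to be derived from the two fixed points, and its axis has to be matched with
  \<open>u\<close>, \<open>v\<close>, possibly in reverse order.\<close>

lemma homogeneous_system_nontrivial:
  fixes c :: "nat \<Rightarrow> 'b \<Rightarrow> 'a::division_ring"
  assumes "finite J" "m < card J"
  shows "\<exists>x. (\<exists>j\<in>J. x j \<noteq> 0) \<and> (\<forall>i<m. (\<Sum>j\<in>J. c i j * x j) = 0)"
  using assms
proof (induction m arbitrary: J c)
  case 0
  then obtain j where "j \<in> J" by fastforce
  then show ?case by (intro exI[of _ "\<lambda>_. 1"]) auto
next
  case (Suc m)
  show ?case
  proof (cases "\<forall>j\<in>J. c m j = 0")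
    case True
    obtain x where "\<exists>j\<in>J. x j \<noteq> 0" "\<forall>i<m. (\<Sum>j\<in>J. c i j * x j) = 0"
      using Suc.IH[of J c] Suc.prems by auto
    with True show ?thesis
      by (intro exI[of _ x]) (auto simp: less_Suc_eq)
  next
    case False
    then obtain p where p: "p \<in> J" "c m p \<noteq> 0" by blast
    \<comment> \<open>Gaussian elimination of the unknown at the pivot \<open>p\<close>: a left
      multiple of row \<open>m\<close> is subtracted from row \<open>i\<close> so that column
      \<open>p\<close> vanishes. Coefficients stay on the left and unknowns on the right, so nothing
      is commuted.\<close>
    define c' where "c' i j = c i j - c i p * inverse (c m p) * c m j" for i j
    have "m < card (J - {p})"
      using Suc.prems p by simp
    then obtain y where y: "\<exists>j\<in>J - {p}. y j \<noteq> 0" "\<forall>i<m. (\<Sum>j\<in>J - {p}. c' i j * y j) = 0"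
      using Suc.IH[of "J - {p}" c'] Suc.prems by auto
    define s where "s = (\<Sum>j\<in>J - {p}. c m j * y j)"
    define x where "x = y(p := - inverse (c m p) * s)"
    have sum_x: "(\<Sum>j\<in>J. c i j * x j) = (\<Sum>j\<in>J - {p}. c i j * y j) - c i p * inverse (c m p) * s" for i
    proof -
      have "(\<Sum>j\<in>J. c i j * x j) = c i p * x p + (\<Sum>j\<in>J - {p}. c i j * x j)"
        using Suc.prems p by (intro sum.remove) auto
      also have "(\<Sum>j\<in>J - {p}. c i j * x j) = (\<Sum>j\<in>J - {p}. c i j * y j)"
        by (intro sum.cong) (auto simp: x_def)
      finally show ?thesis by (simp add: x_def mult.assoc)
    qed
    have "(\<Sum>j\<in>J - {p}. c' i j * y j) = (\<Sum>j\<in>J - {p}. c i j * y j) - c i p * inverse (c m p) * s" for i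
      by (simp add: c'_def s_def left_diff_distrib sum_subtractf sum_distrib_left mult.assoc)
    moreover have "c m p * (inverse (c m p) * s) = s"
      using p by (simp flip: mult.assoc)
    ultimately have "\<forall>i<Suc m. (\<Sum>j\<in>J. c i j * x j) = 0"
      using y(2) p by (auto simp: sum_x less_Suc_eq s_def)
    moreover have "\<exists>j\<in>J. x j \<noteq> 0"
      using y(1) by (auto simp: x_def)
    ultimately show ?thesis by blast
  qed
qed

section \<open>The Hermitian form\<close>

lemma qcnj_algebra [simp]:
  "qcnj (x + y) = qcnj x + qcnj y" "qcnj (x - y) = qcnj x - qcnj y" "qcnj (- x) = - qcnj x"
  "qcnj (x * y) = qcnj y * qcnj x" "qcnj (qcnj x) = x" "qcnj 0 = 0" "qcnj 1 = 1"
  by (simp_all add: quat_eq_iff algebra_simps)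

lemma qcnj_sum: "qcnj (sum f A) = (\<Sum>x\<in>A. qcnj (f x))"
  by (induction A rule: infinite_finite_induct) auto

lemma norm_qcnj [simp]: "norm (qcnj x) = norm x"
  by (simp add: norm_quat_def qnormsq_def)

lemma qcnj_eq_0_iff [simp]: "qcnj x = 0 \<longleftrightarrow> x = 0"
  by (metis norm_eq_zero norm_qcnj)

lemma qcnj_inverse: "qcnj (inverse x) = inverse (qcnj x)"
  by (simp add: inverse_quat_def quat_eq_iff qnormsq_def)

lemma power2_norm_quat: "(norm (x :: quat))\<^sup>2 = qnormsq x"
  by (simp add: norm_quat_def qnormsq_def)

lemma abs_qre_le_norm: "\<bar>qre x\<bar> \<le> norm x"
proof -
  have "sqrt ((qre x)\<^sup>2) \<le> norm x"
    unfolding norm_quat_def qnormsq_def by (intro real_sqrt_le_mono) auto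
  then show ?thesis by simp
qed

lemma qre_qcnj_mult_self: "qre (qcnj x * x) = (norm x)\<^sup>2"
  unfolding power2_norm_quat qnormsq_def by (simp add: power2_eq_square)

text \<open>Vectors carry right scalars, and in the first slot these leave the form on the right.
  The hypothesis is coordinatewise, so that one statement covers sums, right multiples,
  matrix-vector products and, with \<open>J = {}\<close>, the zero vector.\<close>

lemma hform_lincomb_left:
  assumes "\<And>i. i < n + 1 \<Longrightarrow> y $ i = (\<Sum>j\<in>J. F j $ i * c j)"
  shows "hform n y w = (\<Sum>j\<in>J. hform n (F j) w * c j)"
proof -
  have "(\<Sum>k<n - 1. qcnj (w $ k) * y $ k) = (\<Sum>k<n - 1. \<Sum>j\<in>J. qcnj (w $ k) * F j $ k * c j)"
    using assms by (intro sum.cong) (auto simp: sum_distrib_left mult.assoc)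
  then show ?thesis
    using assms[of n] assms[of "n - 1"]
    by (simp add: hform_def left_diff_distrib distrib_right sum_subtractf sum.distrib
        sum_distrib_left sum_distrib_right mult.assoc sum.swap[of _ _ J])
qed

lemma hform_lincomb_right:
  assumes "\<And>i. i < n + 1 \<Longrightarrow> y $ i = (\<Sum>j\<in>J. F j $ i * c j)"
  shows "hform n w y = (\<Sum>j\<in>J. qcnj (c j) * hform n w (F j))"
proof -
  have "hform n w y = qcnj (hform n y w)" by (simp add: hform_cnj)
  also have "\<dots> = (\<Sum>j\<in>J. qcnj (c j) * hform n w (F j))"
    by (subst hform_lincomb_left[OF assms]) (auto simp: qcnj_sum hform_cnj)
  finally show ?thesis .
qed

lemma rscale_carrier [simp]: "rscale z c \<in> carrier_vec N \<longleftrightarrow> z \<in> carrier_vec N"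
  by (simp add: rscale_def)

lemma index_rscale [simp]: "i < dim_vec z \<Longrightarrow> rscale z c $ i = z $ i * c"
  by (simp add: rscale_def)

lemma dim_rscale [simp]: "dim_vec (rscale z c) = dim_vec z"
  by (simp add: rscale_def)

lemma rscale_rscale: "rscale (rscale z c) d = rscale z (c * d)"
  by (rule eq_vecI) (auto simp: mult.assoc)

lemma rscale_1 [simp]: "rscale z 1 = z"
  by (rule eq_vecI) auto

lemma rscale_0: "z \<in> carrier_vec N \<Longrightarrow> rscale z 0 = 0\<^sub>v N"
  by (rule eq_vecI) auto

lemma hform_rscale_left: "z \<in> carrier_vec (n + 1) \<Longrightarrow> hform n (rscale z s) w = hform n z w * s"
  using hform_lincomb_left[of n "rscale z s" "\<lambda>_. z" "\<lambda>_. s" "{()}" w] by simp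

lemma hform_rscale_right: "w \<in> carrier_vec (n + 1) \<Longrightarrow> hform n z (rscale w t) = qcnj t * hform n z w"
  using hform_lincomb_right[of n "rscale w t" "\<lambda>_. w" "\<lambda>_. t" "{()}" z] by simp

lemma hform_add_left:
  assumes "x \<in> carrier_vec (n + 1)" "y \<in> carrier_vec (n + 1)"
  shows "hform n (x + y) w = hform n x w + hform n y w"
  using hform_lincomb_left[of n "x + y" "\<lambda>b. if b then x else y" "\<lambda>_. 1" UNIV w] assms
  by (simp add: UNIV_bool add.commute)

lemma hform_add_right:
  assumes "x \<in> carrier_vec (n + 1)" "y \<in> carrier_vec (n + 1)"
  shows "hform n w (x + y) = hform n w x + hform n w y"
  using hform_lincomb_right[of n "x + y" "\<lambda>b. if b then x else y" "\<lambda>_. 1" UNIV w] assms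
  by (simp add: UNIV_bool add.commute)

lemma mult_mat_vec_index:
  assumes "A \<in> carrier_mat N N" "z \<in> carrier_vec N" "i < N"
  shows "(A *\<^sub>v z) $ i = (\<Sum>j<N. A $$ (i, j) * z $ j)"
  using assms by (auto simp: scalar_prod_def atLeast0LessThan intro!: sum.cong)

lemma mult_mat_vec_rscale:
  assumes "A \<in> carrier_mat N N" "z \<in> carrier_vec N"
  shows "A *\<^sub>v rscale z c = rscale (A *\<^sub>v z) c"
  using assms
  by (intro eq_vecI)
    (auto simp: rscale_def scalar_prod_def sum_distrib_right mult.assoc intro!: sum.cong)

section \<open>Signature of the form and orthogonality to null vectors\<close>

lemma qre_hform_self:
  "qre (hform n z z) = (\<Sum>k<n - 1. (norm (z $ k))\<^sup>2) - 2 * qre (qcnj (z $ n) * z $ (n - 1))"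
proof -
  have "qre (sum f A) = (\<Sum>x\<in>A. qre (f x))" for f and A :: "nat set"
    by (induction A rule: infinite_finite_induct) auto
  then show ?thesis
    unfolding hform_def quat_add_simps by (simp only: qre_qcnj_mult_self) (simp add: algebra_simps)
qed

text \<open>On the hyperplane where the last two coordinates are opposite, the form is the sum of
  the \<open>|z\<^sub>k|\<^sup>2\<close> over the first \<open>n - 1\<close> coordinates plus
  \<open>2 |z\<^sub>n|\<^sup>2\<close>, hence positive definite. All uses of the signature go back
  to this hyperplane.\<close>

lemma hform_self_pos:
  assumes "n \<ge> 1" "z \<in> carrier_vec (n + 1)" "z $ (n - 1) + z $ n = 0" "qre (hform n z z) \<le> 0"
  shows "z = 0\<^sub>v (n + 1)"
proof -
  have zn: "z $ (n - 1) = - z $ n"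
    using assms(3) by (simp add: add_eq_0_iff2)
  have "(\<Sum>k<n - 1. (norm (z $ k))\<^sup>2) + 2 * (norm (z $ n))\<^sup>2 \<le> 0"
    using assms(4) unfolding qre_hform_self zn power2_norm_quat
    by (simp add: qnormsq_def power2_eq_square algebra_simps)
  moreover have "(\<Sum>k<n - 1. (norm (z $ k))\<^sup>2) \<ge> 0"
    by (intro sum_nonneg) auto
  ultimately have s: "(\<Sum>k<n - 1. (norm (z $ k))\<^sup>2) = 0" and "(norm (z $ n))\<^sup>2 = 0"
    using zero_le_power2[of "norm (z $ n)"] by linarith+
  then have "z $ n = 0" by simp
  from s have "\<forall>k<n - 1. z $ k = 0"
    by (subst (asm) sum_nonneg_eq_0_iff) auto
  with \<open>z $ n = 0\<close> zn assms(1,2) show ?thesis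
    by (intro eq_vecI) (auto, metis Suc_pred less_Suc_eq less_eq_Suc_le One_nat_def neg_0_equal_iff_equal)
qed

lemma V_zeroD:
  assumes "z \<in> V_zero n"
  shows "z \<in> carrier_vec (n + 1)" "z \<noteq> 0\<^sub>v (n + 1)" "hform n z z = 0"
  using assms by (auto simp: V_zero_def)

text \<open>A nonpositive vector orthogonal to a null vector \<open>u\<close> spans together with \<open>u\<close> a nonpositive
  subspace, which by the signature of the form has dimension one.\<close>

lemma nonpos_orthogonal_null:
  assumes n: "n \<ge> 1" and u: "u \<in> V_zero n" and x: "x \<in> carrier_vec (n + 1)"
    and xu: "hform n x u = 0" and xx: "qre (hform n x x) \<le> 0"
  shows "\<exists>c. x = rscale u c"
proof -
  note u' = V_zeroD[OF u]
  define s where "s = u $ (n - 1) + u $ n"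
  have s: "s \<noteq> 0"
    using hform_self_pos[OF n u'(1)] u' by (auto simp: s_def)
  \<comment> \<open>This multiple of \<open>u\<close> moves \<open>x\<close> into the hyperplane of
    \<open>hform_self_pos\<close>. As \<open>u\<close> is null and orthogonal to \<open>x\<close>,
    the value of the form at \<open>y\<close> is still that at \<open>x\<close>.\<close>
  define c where "c = - inverse s * (x $ (n - 1) + x $ n)"
  define y where "y = x + rscale u c"
  have y: "y \<in> carrier_vec (n + 1)" using x u' by (simp add: y_def)
  have "hform n y y = hform n x x"
    using x u' xu hform_cnj[of n x u]
    by (simp add: y_def hform_add_left hform_add_right hform_rscale_left hform_rscale_right)
  moreover have "y $ (n - 1) + y $ n = 0"
  proof -
    have "y $ (n - 1) + y $ n = (x $ (n - 1) + x $ n) + s * c"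
      using x u' n by (simp add: y_def s_def algebra_simps)
    then show ?thesis using s by (simp add: c_def flip: mult.assoc)
  qed
  ultimately have y0: "y = 0\<^sub>v (n + 1)"
    using hform_self_pos[OF n y] xx by simp
  have "x = rscale u (- c)"
  proof (rule eq_vecI)
    fix i assume "i < dim_vec (rscale u (- c))"
    then have i: "i < n + 1" using u' by simp
    then have "y $ i = 0" using y0 by simp
    then show "x $ i = rscale u (- c) $ i"
      using i x u' by (simp add: y_def eq_neg_iff_add_eq_0)
  qed (use x u' in simp)
  then show ?thesis by blast
qed

lemma hform_null_nonzero:
  assumes n: "n \<ge> 1" and u: "u \<in> V_zero n" and v: "v \<in> V_zero n" and uv: "\<And>c. v \<noteq> rscale u c"
  shows "hform n v u \<noteq> 0"
  using nonpos_orthogonal_null[OF n u, of v] uv V_zeroD[OF v] by auto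

text \<open>Otherwise \<open>x\<close> would be a multiple of \<open>u\<close>, and a nonzero
  multiple of \<open>u\<close> is not orthogonal to \<open>v\<close>. Positivity on this complement
  is what later allows eigenvectors to be normalised.\<close>

lemma hform_pos_orthogonal_null_pair:
  assumes n: "n \<ge> 1" and u: "u \<in> V_zero n" and uv: "hform n u v \<noteq> 0"
    and x: "x \<in> carrier_vec (n + 1)" "x \<noteq> 0\<^sub>v (n + 1)"
    and xu: "hform n x u = 0" and xv: "hform n x v = 0"
  shows "qre (hform n x x) > 0"
proof (rule ccontr)
  assume "\<not> ?thesis"
  then obtain c where c: "x = rscale u c"
    using nonpos_orthogonal_null[OF n u x(1) xu] by auto
  then have "c = 0"
    using uv xv V_zeroD[OF u] by (simp add: hform_rscale_left)
  then show False
    using c x V_zeroD[OF u] rscale_0 by auto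
qed

section \<open>Projective action\<close>

lemma self_in_proj_pt: "z \<in> proj_pt z"
  unfolding proj_pt_def by (auto intro!: exI[of _ 1])

lemma proj_pt_rscale: "c \<noteq> 0 \<Longrightarrow> proj_pt (rscale z c) = proj_pt z"
  unfolding proj_pt_def
  by (auto simp: rscale_rscale)
    (metis (no_types, lifting) mult.assoc mult_1 mult_eq_0_iff nonzero_imp_inverse_nonzero right_inverse)

lemma proj_pt_eqD:
  assumes "proj_pt z = proj_pt w"
  obtains c where "c \<noteq> 0" "w = rscale z c"
  using self_in_proj_pt[of w] unfolding assms[symmetric] by (auto simp: proj_pt_def)

section \<open>The group acting on vectors and on boundary points\<close>

lemma SpD:
  assumes "A \<in> carrier (Sp n)"
  shows "A \<in> carrier_mat (n + 1) (n + 1)"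
    "\<And>z w. z \<in> carrier_vec (n + 1) \<Longrightarrow> w \<in> carrier_vec (n + 1) \<Longrightarrow>
      hform n (A *\<^sub>v z) (A *\<^sub>v w) = hform n z w"
  using assms by (auto simp: Sp_simps)

lemma Sp_inv_closed: "A \<in> carrier (Sp n) \<Longrightarrow> inv\<^bsub>Sp n\<^esub> A \<in> carrier (Sp n)"
  by (rule group.inv_closed[OF group_Sp])

lemma Sp_mult_closed: "A \<in> carrier (Sp n) \<Longrightarrow> B \<in> carrier (Sp n) \<Longrightarrow> A * B \<in> carrier (Sp n)"
  using monoid.m_closed[OF group.is_monoid[OF group_Sp], of A n B] by (simp add: Sp_simps)

lemma Sp_mult_inv:
  assumes "A \<in> carrier (Sp n)"
  shows "A * inv\<^bsub>Sp n\<^esub> A = 1\<^sub>m (n + 1)" "inv\<^bsub>Sp n\<^esub> A * A = 1\<^sub>m (n + 1)"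
  using group.r_inv[OF group_Sp assms] group.l_inv[OF group_Sp assms] by (simp_all add: Sp_simps)

lemma Sp_mult_vec:
  assumes "A \<in> carrier (Sp n)" "B \<in> carrier (Sp n)" "z \<in> carrier_vec (n + 1)"
  shows "(A * B) *\<^sub>v z = A *\<^sub>v (B *\<^sub>v z)"
  by (rule assoc_mult_mat_vec[OF SpD(1)[OF assms(1)] SpD(1)[OF assms(2)] assms(3)])

lemma Sp_vec_closed:
  assumes "A \<in> carrier (Sp n)" "z \<in> carrier_vec (n + 1)"
  shows "A *\<^sub>v z \<in> carrier_vec (n + 1)"
  using SpD(1)[OF assms(1)] assms(2) by (rule mult_mat_vec_carrier)

lemma Sp_inv_vec:
  assumes "A \<in> carrier (Sp n)" "z \<in> carrier_vec (n + 1)"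
  shows "A *\<^sub>v (inv\<^bsub>Sp n\<^esub> A *\<^sub>v z) = z" "inv\<^bsub>Sp n\<^esub> A *\<^sub>v (A *\<^sub>v z) = z"
  using assms Sp_mult_vec[OF assms(1) Sp_inv_closed[OF assms(1)] assms(2)]
    Sp_mult_vec[OF Sp_inv_closed[OF assms(1)] assms(1) assms(2)]
  by (simp_all add: Sp_mult_inv)

lemma hform_Sp_adjoint:
  assumes A: "A \<in> carrier (Sp n)" and z: "z \<in> carrier_vec (n + 1)" and w: "w \<in> carrier_vec (n + 1)"
  shows "hform n (A *\<^sub>v z) w = hform n z (inv\<^bsub>Sp n\<^esub> A *\<^sub>v w)"
  using SpD(2)[OF A z Sp_vec_closed[OF Sp_inv_closed[OF A] w]] A w by (simp add: Sp_inv_vec)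

lemma Sp_vec_eq_0:
  assumes "A \<in> carrier (Sp n)" "z \<in> carrier_vec (n + 1)" "A *\<^sub>v z = 0\<^sub>v (n + 1)"
  shows "z = 0\<^sub>v (n + 1)"
proof -
  have "z = inv\<^bsub>Sp n\<^esub> A *\<^sub>v 0\<^sub>v (n + 1)"
    using Sp_inv_vec(2)[OF assms(1,2)] assms(3) by simp
  also have "\<dots> = 0\<^sub>v (n + 1)"
    using SpD(1)[OF Sp_inv_closed[OF assms(1)]] by (intro eq_vecI) auto
  finally show ?thesis .
qed

lemma Sp_V_zero:
  assumes A: "A \<in> carrier (Sp n)" and z: "z \<in> V_zero n"
  shows "A *\<^sub>v z \<in> V_zero n"
proof -
  note z' = V_zeroD[OF z]
  have "A *\<^sub>v z \<noteq> 0\<^sub>v (n + 1)"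
    using Sp_vec_eq_0[OF A z'(1)] z'(2) by blast
  then show ?thesis
    using Sp_vec_closed[OF A z'(1)] SpD(2)[OF A z'(1) z'(1)] z' by (simp add: V_zero_def)
qed

lemma act_null:
  assumes "A \<in> carrier (Sp n)" "z \<in> V_zero n"
  shows "act A (proj_pt z) = proj_pt (A *\<^sub>v z)"
  by (rule act_proj_pt[OF SpD(1)[OF assms(1)] V_zeroD(1)[OF assms(2)]])

lemma act_boundary:
  assumes "A \<in> carrier (Sp n)" "p \<in> hyp_boundary n"
  shows "act A p \<in> hyp_boundary n"
  using assms by (auto simp: hyp_boundary_def act_null intro: Sp_V_zero)

lemma act_mult:
  assumes A: "A \<in> carrier (Sp n)" and B: "B \<in> carrier (Sp n)" and "p \<in> hyp_boundary n"
  shows "act (A * B) p = act A (act B p)"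
proof -
  obtain z where z: "z \<in> V_zero n" "p = proj_pt z"
    using assms(3) by (auto simp: hyp_boundary_def)
  then show ?thesis
    using act_null[OF A Sp_V_zero[OF B z(1)]] act_null[OF B z(1)]
      act_null[OF Sp_mult_closed[OF A B] z(1)] Sp_mult_vec[OF A B V_zeroD(1)[OF z(1)]] by simp
qed

lemma act_one:
  assumes "p \<in> hyp_boundary n"
  shows "act (1\<^sub>m (n + 1)) p = p"
  using assms act_proj_pt[OF one_carrier_mat] V_zeroD(1) one_mult_mat_vec
  by (fastforce simp: hyp_boundary_def)

lemma act_inv:
  assumes A: "A \<in> carrier (Sp n)" and p: "p \<in> hyp_boundary n"
  shows "act A (act (inv\<^bsub>Sp n\<^esub> A) p) = p" "act (inv\<^bsub>Sp n\<^esub> A) (act A p) = p"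
  using act_mult[OF A Sp_inv_closed[OF A] p] act_mult[OF Sp_inv_closed[OF A] A p] act_one[OF p]
    Sp_mult_inv[OF A] by simp_all

section \<open>Eigenvectors of quaternionic matrices\<close>

text \<open>The complex numbers as the subfield spanned by 1 and \<open>i\<close>: commutative
  scalars over which polynomials split, the source of the eigenvalues found in invariant
  subspaces.\<close>

definition quat_of_complex :: "complex \<Rightarrow> quat" where
  "quat_of_complex z = Quat (Re z) (Im z) 0 0"

lemma quat_of_complex_simps [simp]:
  "qre (quat_of_complex z) = Re z" "qi (quat_of_complex z) = Im z"
  "qj (quat_of_complex z) = 0" "qk (quat_of_complex z) = 0"
  by (simp_all add: quat_of_complex_def)

lemma quat_of_complex_hom:
  "quat_of_complex (x - y) = quat_of_complex x - quat_of_complex y"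
  "quat_of_complex (x * y) = quat_of_complex x * quat_of_complex y"
  "quat_of_complex 0 = 0"
  by (simp_all add: quat_eq_iff)

lemma quat_of_complex_eq_0_iff [simp]: "quat_of_complex z = 0 \<longleftrightarrow> z = 0"
  by (simp add: quat_eq_iff complex_eq_iff)

text \<open>\<open>krylov A v K p\<close> is \<open>p(A) v\<close> for a complex polynomial \<open>p\<close> of degree less than \<open>K\<close>.
  The scalars act on the right and so commute with \<open>A\<close>, which makes \<open>p(A)\<close> factor
  like \<open>p\<close> does.\<close>

definition krylov :: "quat mat \<Rightarrow> quat vec \<Rightarrow> nat \<Rightarrow> complex poly \<Rightarrow> quat vec" where
  "krylov A v K p = vec (dim_vec v) (\<lambda>i. \<Sum>k<K. (((*\<^sub>v) A ^^ k) v) $ i * quat_of_complex (coeff p k))"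

lemma funpow_mult_mat_vec_carrier:
  assumes "A \<in> carrier_mat N N" "v \<in> carrier_vec N"
  shows "((*\<^sub>v) A ^^ k) v \<in> carrier_vec N"
  using assms by (induction k) auto

lemma krylov_carrier [simp]: "v \<in> carrier_vec N \<Longrightarrow> krylov A v K p \<in> carrier_vec N"
  by (simp add: krylov_def)

lemma krylov_truncate:
  assumes "degree p < K"
  shows "krylov A v K p = krylov A v (Suc (degree p)) p"
proof -
  have "(\<Sum>k<K. w k * quat_of_complex (coeff p k)) =
      (\<Sum>k<Suc (degree p). w k * quat_of_complex (coeff p k))" for w :: "nat \<Rightarrow> quat"
    using assms by (intro sum.mono_neutral_right) (auto simp: coeff_eq_0 quat_of_complex_hom)
  then show ?thesis
    unfolding krylov_def by simp
qed

text \<open>Multiplying the polynomial by \<open>X - z\<close> applies \<open>A\<close> and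
  subtracts the right multiple by \<open>z\<close>. This uses that \<open>z\<close> commutes with
  the coefficients of \<open>q\<close>. The length grows by one to hold the new leading term, and
  \<open>degree q < K\<close> makes the term of index \<open>K\<close> of \<open>q\<close>
  vanish.\<close>

lemma krylov_linear_factor:
  assumes A: "A \<in> carrier_mat N N" and v: "v \<in> carrier_vec N" and q: "degree q < K" and i: "i < N"
  shows "krylov A v (Suc K) ([:- z, 1:] * q) $ i =
    (A *\<^sub>v krylov A v K q) $ i - krylov A v K q $ i * quat_of_complex z"
proof -
  define w where "w k = ((*\<^sub>v) A ^^ k) v" for k
  have w: "w k \<in> carrier_vec N" for k
    unfolding w_def by (rule funpow_mult_mat_vec_carrier[OF A v])
  have kr: "krylov A v K q $ j = (\<Sum>k<K. w k $ j * quat_of_complex (coeff q k))" if "j < N" for K q j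
    using that v by (simp add: krylov_def w_def)
  have co: "coeff ([:- z, 1:] * q) k = coeff (pCons 0 q) k - coeff q k * z" for k
    by (simp add: mult_pCons_left)
  have "(A *\<^sub>v krylov A v K q) $ i = (\<Sum>j<N. \<Sum>k<K. A $$ (i, j) * (w k $ j * quat_of_complex (coeff q k)))"
    using v i by (simp add: mult_mat_vec_index[OF A] kr sum_distrib_left)
  also have "\<dots> = (\<Sum>k<K. \<Sum>j<N. A $$ (i, j) * (w k $ j * quat_of_complex (coeff q k)))"
    by (rule sum.swap)
  also have "\<dots> = (\<Sum>k<K. w (Suc k) $ i * quat_of_complex (coeff q k))"
  proof (intro sum.cong refl)
    fix k
    have "w (Suc k) = A *\<^sub>v w k" by (simp add: w_def)
    then show "(\<Sum>j<N. A $$ (i, j) * (w k $ j * quat_of_complex (coeff q k))) =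
        w (Suc k) $ i * quat_of_complex (coeff q k)"
      using i by (simp add: mult_mat_vec_index[OF A w] sum_distrib_right mult.assoc)
  qed
  finally have Aw: "(A *\<^sub>v krylov A v K q) $ i = (\<Sum>k<K. w (Suc k) $ i * quat_of_complex (coeff q k))" .
  have "krylov A v (Suc K) ([:- z, 1:] * q) $ i =
      (\<Sum>k<Suc K. w k $ i * quat_of_complex (coeff (pCons 0 q) k)) -
      (\<Sum>k<Suc K. w k $ i * quat_of_complex (coeff q k)) * quat_of_complex z"
    using i unfolding kr[OF i] co quat_of_complex_hom
    by (simp only: right_diff_distrib sum_subtractf sum_distrib_right mult.assoc)
  also have "(\<Sum>k<Suc K. w k $ i * quat_of_complex (coeff (pCons 0 q) k)) =
      (\<Sum>k<K. w (Suc k) $ i * quat_of_complex (coeff q k))"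
    by (simp only: sum.lessThan_Suc_shift) (simp add: quat_of_complex_hom)
  also have "(\<Sum>k<Suc K. w k $ i * quat_of_complex (coeff q k)) =
      (\<Sum>k<K. w k $ i * quat_of_complex (coeff q k))"
    using q by (simp add: coeff_eq_0 quat_of_complex_hom)
  finally show ?thesis
    by (simp only: Aw kr[OF i])
qed

lemma krylov_in_invariant_subspace:
  assumes v: "v \<in> S" "v \<in> carrier_vec N"
    and add: "\<And>x y. x \<in> S \<Longrightarrow> y \<in> S \<Longrightarrow> x + y \<in> S"
    and scale: "\<And>x c. x \<in> S \<Longrightarrow> rscale x c \<in> S"
    and inv: "\<And>x. x \<in> S \<Longrightarrow> A *\<^sub>v x \<in> S" and S: "S \<subseteq> carrier_vec N"
  shows "krylov A v K p \<in> S"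
proof (induction K)
  case 0
  have "krylov A v 0 p = rscale v 0"
    by (intro eq_vecI) (auto simp: krylov_def)
  then show ?case using scale v by simp
next
  case (Suc K)
  have w: "((*\<^sub>v) A ^^ K) v \<in> S"
    using v inv by (induction K) auto
  then have "((*\<^sub>v) A ^^ K) v \<in> carrier_vec N" using S by blast
  then have "krylov A v (Suc K) p =
      krylov A v K p + rscale (((*\<^sub>v) A ^^ K) v) (quat_of_complex (coeff p K))"
    using v by (intro eq_vecI) (auto simp: krylov_def)
  then show ?case using add scale w Suc by simp
qed

text \<open>Quaternionic \<open>N\<close>-space has real dimension \<open>4 N\<close>, so the
  \<open>4 N + 1\<close> vectors \<open>v, A v, ...\<close> satisfy a nontrivial relation with real
  coefficients.\<close>

lemma krylov_annihilator:
  assumes v: "v \<in> carrier_vec N"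
  obtains p where "p \<noteq> 0" "krylov A v (Suc (degree p)) p = 0\<^sub>v N"
proof -
  define w where "w k = ((*\<^sub>v) A ^^ k) v" for k
  \<comment> \<open>Real equation number \<open>i\<close> is component \<open>i mod 4\<close> of
    coordinate \<open>i div 4\<close>.\<close>
  define comp where "comp r = (case r :: nat of 0 \<Rightarrow> qre | Suc 0 \<Rightarrow> qi | Suc (Suc 0) \<Rightarrow> qj | _ \<Rightarrow> qk)" for r
  obtain x where x: "\<exists>j\<in>{..4 * N}. x j \<noteq> 0"
    "\<forall>i<4 * N. (\<Sum>j\<le>4 * N. comp (i mod 4) (w j $ (i div 4)) * x j) = 0"
    using homogeneous_system_nontrivial[of "{..4 * N}" "4 * N" "\<lambda>i j. comp (i mod 4) (w j $ (i div 4))"]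
    by auto
  define p where "p = Poly (map (\<lambda>k. complex_of_real (x k)) [0..<Suc (4 * N)])"
  have co: "coeff p k = (if k \<le> 4 * N then of_real (x k) else 0)" for k
    unfolding p_def by (auto simp: nth_default_def simp del: upt_Suc)
  have "p \<noteq> 0"
    using x(1) co by (metis coeff_0 atMost_iff of_real_eq_0_iff)
  have deg: "degree p < Suc (4 * N)"
    using co by (intro le_imp_less_Suc degree_le) auto
  have "krylov A v (Suc (4 * N)) p = 0\<^sub>v N"
  proof (rule eq_vecI)
    fix i assume "i < dim_vec (0\<^sub>v N :: quat vec)"
    then have i: "i < N" by simp
    have c0: "(\<Sum>j\<le>4 * N. comp r (w j $ i) * x j) = 0" if "r < 4" for r
      using x(2)[rule_format, of "4 * i + r"] that i by simp
    have s: "qre (sum f B) = (\<Sum>x\<in>B. qre (f x))" "qi (sum f B) = (\<Sum>x\<in>B. qi (f x))"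
      "qj (sum f B) = (\<Sum>x\<in>B. qj (f x))" "qk (sum f B) = (\<Sum>x\<in>B. qk (f x))" for f and B :: "nat set"
      by (induction B rule: infinite_finite_induct; simp)+
    have "krylov A v (Suc (4 * N)) p $ i = (\<Sum>j\<le>4 * N. w j $ i * quat_of_complex (of_real (x j)))"
      using i v by (simp add: krylov_def w_def co lessThan_Suc_atMost)
    also have "\<dots> = 0"
      unfolding quat_eq_iff s using c0[of 0] c0[of 1] c0[of 2] c0[of 3]
      by (simp add: comp_def numeral_3_eq_3 numeral_2_eq_2)
    finally show "krylov A v (Suc (4 * N)) p $ i = 0\<^sub>v N $ i" using i by simp
  qed (use v in \<open>simp add: krylov_def\<close>)
  then show thesis
    using that \<open>p \<noteq> 0\<close> krylov_truncate[OF deg] by metis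
qed

text \<open>Linear factors are stripped from an annihilating polynomial of \<open>v\<close> until
  the quotient no longer kills \<open>v\<close>. The vector produced by that quotient is killed by
  the last factor stripped, so it is an eigenvector, and it lies in \<open>S\<close> with the whole
  Krylov sequence. The process stops because a nonzero constant cannot kill
  \<open>v\<close>.\<close>

lemma invariant_subspace_eigenvector:
  assumes A: "A \<in> carrier_mat N N" and S: "S \<subseteq> carrier_vec N"
    and add: "\<And>x y. x \<in> S \<Longrightarrow> y \<in> S \<Longrightarrow> x + y \<in> S"
    and scale: "\<And>x c. x \<in> S \<Longrightarrow> rscale x c \<in> S"
    and inv: "\<And>x. x \<in> S \<Longrightarrow> A *\<^sub>v x \<in> S"
    and v: "v \<in> S" "v \<noteq> 0\<^sub>v N"
  obtains w c where "w \<in> S" "w \<noteq> 0\<^sub>v N" "A *\<^sub>v w = rscale w c"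
proof -
  have vN: "v \<in> carrier_vec N" using v S by blast
  have "\<exists>w c. w \<in> S \<and> w \<noteq> 0\<^sub>v N \<and> A *\<^sub>v w = rscale w c"
    if "p \<noteq> 0" "krylov A v (Suc (degree p)) p = 0\<^sub>v N" for p
    using that
  proof (induction "degree p" arbitrary: p)
    case 0
    then obtain a where a: "p = [:a:]" "a \<noteq> 0"
      by (metis degree_eq_zeroE pCons_0_0)
    have "v $ i = 0" if "i < N" for i
    proof -
      have "krylov A v (Suc (degree p)) p $ i = v $ i * quat_of_complex a"
        using that vN a by (simp add: krylov_def)
      then show ?thesis using 0 a that by simp
    qed
    then have "v = 0\<^sub>v N" using vN by (intro eq_vecI) auto
    then show ?case using v by simp
  next
    case (Suc d)
    then have "\<not> constant (poly p)"
      by (metis constant_degree Zero_not_Suc)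
    then obtain z where "poly p z = 0"
      using fundamental_theorem_of_algebra by blast
    then obtain q where q: "p = [:- z, 1:] * q"
      by (auto simp: poly_eq_0_iff_dvd dvd_def)
    have "q \<noteq> 0" using q Suc.prems by auto
    then have dq: "degree q = d" using Suc.hyps(2) unfolding q by (subst (asm) degree_mult_eq) auto
    define w where "w = krylov A v (Suc d) q"
    have wN: "w \<in> carrier_vec N" using vN by (simp add: w_def)
    show ?case
    proof (cases "w = 0\<^sub>v N")
      case True
      then show ?thesis
        using Suc.hyps(1)[of q] dq \<open>q \<noteq> 0\<close> by (simp add: w_def)
    next
      case False
      have "A *\<^sub>v w = rscale w (quat_of_complex z)"
      proof (rule eq_vecI)
        fix i assume "i < dim_vec (rscale w (quat_of_complex z))"
        then have i: "i < N" using wN by simp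
        have "krylov A v (Suc (Suc d)) p $ i = 0"
          using Suc.prems(2) Suc.hyps(2) i by simp
        then have "(A *\<^sub>v w) $ i - w $ i * quat_of_complex z = 0"
          using krylov_linear_factor[OF A vN _ i, of q "Suc d" z] dq unfolding q w_def by simp
        then show "(A *\<^sub>v w) $ i = rscale w (quat_of_complex z) $ i"
          using i wN by simp
      qed (use A wN in auto)
      moreover have "w \<in> S"
        unfolding w_def by (rule krylov_in_invariant_subspace[OF v(1) vN add scale inv S])
      ultimately show ?thesis using False by blast
    qed
  qed
  then show thesis
    using krylov_annihilator[OF vN, of A] that by metis
qed

section \<open>The normal form of a loxodromic element\<close>

lemma hform_unit_vec:
  assumes "n \<ge> 1"
  shows "k < n - 1 \<Longrightarrow> hform n z (unit_vec (n + 1) k) = z $ k"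
    "hform n z (unit_vec (n + 1) (n - 1)) = - z $ n"
    "hform n z (unit_vec (n + 1) n) = - z $ (n - 1)"
proof -
  have *: "(\<Sum>j<n - 1. qcnj (unit_vec (n + 1) k $ j) * z $ j) = (if k < n - 1 then z $ k else 0)" for k
  proof -
    have "(\<Sum>j<n - 1. qcnj (unit_vec (n + 1) k $ j) * z $ j) =
        (\<Sum>j<n - 1. if j = k then z $ k else 0)"
      by (intro sum.cong) (auto simp: unit_vec_def)
    then show ?thesis by simp
  qed
  have u: "unit_vec (n + 1) k $ j = (if j = k then 1 else 0 :: quat)" if "j \<le> n" for j k
    using that by (simp add: unit_vec_def)
  show "k < n - 1 \<Longrightarrow> hform n z (unit_vec (n + 1) k) = z $ k"
    "hform n z (unit_vec (n + 1) (n - 1)) = - z $ n"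
    "hform n z (unit_vec (n + 1) n) = - z $ (n - 1)"
    using assms by (simp_all only: hform_def * u) (auto simp: u)
qed

lemma hform_nondegenerate:
  assumes "n \<ge> 1" "z \<in> carrier_vec (n + 1)" "\<And>w. w \<in> carrier_vec (n + 1) \<Longrightarrow> hform n z w = 0"
  shows "z = 0\<^sub>v (n + 1)"
proof (rule eq_vecI)
  fix i assume "i < dim_vec (0\<^sub>v (n + 1) :: quat vec)"
  then consider "i < n - 1" | "i = n - 1" | "i = n" by fastforce
  moreover have "hform n z (unit_vec (n + 1) j) = 0" for j
    by (rule assms(3)) simp
  ultimately have "z $ i = 0"
  proof cases
    case 1
    then show ?thesis using hform_unit_vec(1)[OF assms(1) 1, of z] \<open>hform n z (unit_vec (n + 1) i) = 0\<close> by simp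
  next
    case 2
    then show ?thesis using hform_unit_vec(3)[OF assms(1), of z] \<open>hform n z (unit_vec (n + 1) n) = 0\<close> by simp
  next
    case 3
    then show ?thesis using hform_unit_vec(2)[OF assms(1), of z] \<open>hform n z (unit_vec (n + 1) (n - 1)) = 0\<close> by simp
  qed
  then show "z $ i = 0\<^sub>v (n + 1) $ i" using \<open>i < _\<close> by simp
qed (use assms in simp)

section \<open>Matrices in \<open>Sp n\<close> built from a frame of columns\<close>

lemma unit_vec_lincomb:
  fixes z :: "'a::ring_1 vec"
  assumes "i < N"
  shows "z $ i = (\<Sum>j<N. unit_vec N j $ i * z $ j)"
proof -
  have "(\<Sum>j<N. unit_vec N j $ i * z $ j) = (\<Sum>j<N. if j = i then z $ i else 0)"
    using assms by (intro sum.cong) (auto simp: unit_vec_def)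
  then show ?thesis using assms by simp
qed

lemma mat_mult_unit_vec:
  fixes A :: "'a::ring_1 mat"
  assumes "A \<in> carrier_mat nr nc" "j < nc"
  shows "A *\<^sub>v unit_vec nc j = col A j"
  using assms by (intro eq_vecI) auto

text \<open>The columns of \<open>A\<close> together with \<open>b\<close> are \<open>N + 1\<close>
  vectors in \<open>N\<close>-space, so they satisfy a nontrivial relation. Injectivity makes the
  coefficient of \<open>b\<close> nonzero, and dividing by it on the right solves
  \<open>A z = b\<close>; the solutions for the unit vectors are the columns of the inverse.\<close>

lemma injective_imp_right_inverse:
  fixes A :: "'a::division_ring mat"
  assumes A: "A \<in> carrier_mat N N"
    and inj: "\<And>z. z \<in> carrier_vec N \<Longrightarrow> A *\<^sub>v z = 0\<^sub>v N \<Longrightarrow> z = 0\<^sub>v N"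
  shows "\<exists>B \<in> carrier_mat N N. A * B = 1\<^sub>m N"
proof -
  have "\<exists>z. z \<in> carrier_vec N \<and> A *\<^sub>v z = b" if b: "b \<in> carrier_vec N" for b
  proof -
    define c where "c i j = (if j < N then A $$ (i, j) else b $ i)" for i j
    obtain x where x: "\<exists>j\<in>{..N}. x j \<noteq> 0" "\<forall>i<N. (\<Sum>j\<le>N. c i j * x j) = 0"
      using homogeneous_system_nontrivial[of "{..N}" N c] by auto
    have eq: "(\<Sum>j<N. A $$ (i, j) * x j) + b $ i * x N = 0" if "i < N" for i
      using x(2) that by (simp add: c_def flip: lessThan_Suc_atMost)
    have mv: "(A *\<^sub>v vec N f) $ i = (\<Sum>j<N. A $$ (i, j) * f j)" if "i < N" for i f
      using A that by (auto simp: scalar_prod_def atLeast0LessThan intro!: sum.cong)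
    have xN: "x N \<noteq> 0"
    proof
      assume x0: "x N = 0"
      have "A *\<^sub>v vec N x = 0\<^sub>v N"
        using A eq x0 by (intro eq_vecI) (auto simp: mv simp del: index_mult_mat_vec)
      then have *: "vec N x = 0\<^sub>v N"
        using inj by simp
      have "x j = 0" if "j < N" for j
        using arg_cong[OF *, of "\<lambda>w. w $ j"] that by simp
      with x(1) x0 show False by (metis atMost_iff le_neq_implies_less)
    qed
    define z where "z = vec N (\<lambda>j. - x j * inverse (x N))"
    have "A *\<^sub>v z = b"
    proof (rule eq_vecI)
      fix i assume "i < dim_vec b"
      then have i: "i < N" using b by simp
      have "(A *\<^sub>v z) $ i = - (\<Sum>j<N. A $$ (i, j) * x j) * inverse (x N)"
        unfolding z_def mv[OF i] by (simp add: sum_distrib_right sum_negf mult.assoc)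
      also have "- (\<Sum>j<N. A $$ (i, j) * x j) = b $ i * x N"
        using eq[OF i] by (simp add: add_eq_0_iff2)
      finally show "(A *\<^sub>v z) $ i = b $ i"
        using xN by (simp add: mult.assoc)
    qed (use A b in simp)
    then show ?thesis by (intro exI[of _ z]) (auto simp: z_def)
  qed
  then obtain F where F: "\<And>b. b \<in> carrier_vec N \<Longrightarrow> F b \<in> carrier_vec N \<and> A *\<^sub>v F b = b"
    by metis
  define B where "B = mat N N (\<lambda>(i, j). F (unit_vec N j) $ i)"
  have "col B j = F (unit_vec N j)" if "j < N" for j
    using that F[of "unit_vec N j"] by (intro eq_vecI) (auto simp: B_def)
  then have "col (A * B) j = col (1\<^sub>m N) j" if "j < N" for j
    using that A F[of "unit_vec N j"] col_mult2[OF A, of B N j] by (simp add: B_def)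
  then have "A * B = 1\<^sub>m N"
    using A by (intro mat_col_eqI) (auto simp: B_def)
  then show ?thesis by (intro bexI[of _ B]) (auto simp: B_def)
qed

text \<open>The Gram condition on the columns extends to all vectors by sesquilinearity. Preserving
  a nondegenerate form forces injectivity, which first yields a right inverse \<open>B\<close> and
  then, by cancelling \<open>?f\<close> on the left of \<open>?f * B * ?f = ?f\<close>, makes it
  two-sided.\<close>

lemma gram_imp_Sp:
  assumes n: "n \<ge> 1" and F: "\<And>k. k < n + 1 \<Longrightarrow> F k \<in> carrier_vec (n + 1)"
    and gram: "\<And>j k. j < n + 1 \<Longrightarrow> k < n + 1 \<Longrightarrow>
      hform n (F j) (F k) = hform n (unit_vec (n + 1) j) (unit_vec (n + 1) k)"
  shows "mat (n + 1) (n + 1) (\<lambda>(i, j). F j $ i) \<in> carrier (Sp n)" (is "?f \<in> _")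
proof -
  have f: "?f \<in> carrier_mat (n + 1) (n + 1)" by simp
  have lc: "(?f *\<^sub>v z) $ i = (\<Sum>j<n + 1. F j $ i * z $ j)"
    if "z \<in> carrier_vec (n + 1)" "i < n + 1" for z i
    unfolding mult_mat_vec_index[OF f that] using that by (intro sum.cong) auto
  have pres: "hform n (?f *\<^sub>v z) (?f *\<^sub>v w) = hform n z w"
    if z: "z \<in> carrier_vec (n + 1)" and w: "w \<in> carrier_vec (n + 1)" for z w
  proof -
    have expand: "hform n x w =
        (\<Sum>k<n + 1. qcnj (w $ k) * hform n x (unit_vec (n + 1) k))" for x
      by (rule hform_lincomb_right[OF unit_vec_lincomb])
    have "hform n (?f *\<^sub>v z) (?f *\<^sub>v w) = (\<Sum>j<n + 1. hform n (F j) (?f *\<^sub>v w) * z $ j)"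
      by (rule hform_lincomb_left[OF lc[OF z]])
    also have "\<dots> = (\<Sum>j<n + 1. (\<Sum>k<n + 1. qcnj (w $ k) * hform n (F j) (F k)) * z $ j)"
      by (simp only: hform_lincomb_right[OF lc[OF w]])
    also have "\<dots> = (\<Sum>j<n + 1. (\<Sum>k<n + 1. qcnj (w $ k) *
        hform n (unit_vec (n + 1) j) (unit_vec (n + 1) k)) * z $ j)"
      by (intro sum.cong refl arg_cong2[of _ _ _ _ "(*)"] gram) auto
    also have "\<dots> = (\<Sum>j<n + 1. hform n (unit_vec (n + 1) j) w * z $ j)"
      by (simp only: expand)
    also have "\<dots> = hform n z w"
      by (rule hform_lincomb_left[OF unit_vec_lincomb, symmetric])
    finally show ?thesis .
  qed
  have inj: "z = 0\<^sub>v (n + 1)" if z: "z \<in> carrier_vec (n + 1)" and "?f *\<^sub>v z = 0\<^sub>v (n + 1)" for z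
  proof (rule hform_nondegenerate[OF n z])
    fix w :: "quat vec" assume w: "w \<in> carrier_vec (n + 1)"
    have "hform n (0\<^sub>v (n + 1)) (?f *\<^sub>v w) = 0"
      by (subst hform_lincomb_left[of n _ "\<lambda>_. 0\<^sub>v (n + 1)" "\<lambda>_. 0" "{}"]) auto
    then show "hform n z w = 0" using pres[OF z w] that by simp
  qed
  obtain B where B: "B \<in> carrier_mat (n + 1) (n + 1)" "?f * B = 1\<^sub>m (n + 1)"
    using injective_imp_right_inverse[OF f inj] by blast
  have "B * ?f = 1\<^sub>m (n + 1)"
  proof (rule mat_col_eqI)
    fix j assume "j < dim_col (1\<^sub>m (n + 1) :: quat mat)"
    then have j: "j < n + 1" by simp
    let ?e = "unit_vec (n + 1) j :: quat vec"
    define a where "a = B *\<^sub>v (?f *\<^sub>v ?e)"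
    have c: "?f *\<^sub>v ?e \<in> carrier_vec (n + 1)" by (rule mult_mat_vec_carrier[OF f unit_vec_carrier])
    have ac: "a \<in> carrier_vec (n + 1)" unfolding a_def by (rule mult_mat_vec_carrier[OF B(1) c])
    have "?f *\<^sub>v a = ?f *\<^sub>v ?e"
      unfolding a_def using assoc_mult_mat_vec[OF f B(1) c] one_mult_mat_vec[OF c] unfolding B(2) by simp
    then have "?f *\<^sub>v (a - ?e) = 0\<^sub>v (n + 1)"
      using ac by (subst mult_minus_distrib_mat_vec[OF f]) auto
    then have y: "a - ?e = 0\<^sub>v (n + 1)"
      by (rule inj[rotated]) (use ac in auto)
    have "a $ i = ?e $ i" if "i < n + 1" for i
    proof -
      have "(a - ?e) $ i = 0" unfolding y using that by simp
      then show ?thesis using that ac by simp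
    qed
    then have "a = ?e" using ac by (intro eq_vecI) auto
    moreover have "col (B * ?f) j = a"
      unfolding a_def using mat_mult_unit_vec[OF mult_carrier_mat[OF B(1) f] j]
        assoc_mult_mat_vec[OF B(1) f unit_vec_carrier, of j] by simp
    ultimately show "col (B * ?f) j = col (1\<^sub>m (n + 1)) j" using j by simp
  qed (use B in auto)
  then have "invertible_mat ?f"
    using f B unfolding invertible_mat_def inverts_mat_def by auto
  then show ?thesis
    using f pres by (simp add: Sp_simps)
qed

text \<open>The complement of \<open>u\<close>, \<open>v\<close> and the vectors already found is
  invariant, since these are eigenvectors with nonzero eigenvalues. It is nonzero by counting and
  positive definite, so it contains an eigenvector that can be scaled to length one.\<close>

lemma orthonormal_eigenvectors:
  assumes n: "n \<ge> 1" and u: "u \<in> V_zero n" and v: "v \<in> V_zero n" and uv: "hform n u v \<noteq> 0"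
    and g: "g \<in> carrier (Sp n)" and gu: "g *\<^sub>v u = rscale u \<alpha>" and gv: "g *\<^sub>v v = rscale v \<beta>"
    and m: "m \<le> n - 1"
  shows "\<exists>E l. \<forall>k<m. E k \<in> carrier_vec (n + 1) \<and> hform n (E k) u = 0 \<and> hform n (E k) v = 0 \<and>
    g *\<^sub>v E k = rscale (E k) (l k) \<and> (\<forall>j<m. hform n (E j) (E k) = (if j = k then 1 else 0))"
  using m
proof (induction m)
  case 0
  then show ?case by simp
next
  case (Suc m)
  then obtain E l where E: "\<And>k. k < m \<Longrightarrow> E k \<in> carrier_vec (n + 1)"
      "\<And>k. k < m \<Longrightarrow> hform n (E k) u = 0" "\<And>k. k < m \<Longrightarrow> hform n (E k) v = 0"
      "\<And>k. k < m \<Longrightarrow> g *\<^sub>v E k = rscale (E k) (l k)"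
      "\<And>j k. k < m \<Longrightarrow> j < m \<Longrightarrow> hform n (E j) (E k) = (if j = k then 1 else 0)"
    by (auto simp: less_Suc_eq)
  define F where "F i = (if i < m then E i else if i = m then u else v)" for i
  define \<mu> where "\<mu> i = (if i < m then l i else if i = m then \<alpha> else \<beta>)" for i
  have F: "F i \<in> carrier_vec (n + 1)" "g *\<^sub>v F i = rscale (F i) (\<mu> i)" for i
    using E V_zeroD[OF u] V_zeroD[OF v] gu gv by (auto simp: F_def \<mu>_def)
  have F0: "F i \<noteq> 0\<^sub>v (n + 1)" for i
  proof (cases "i < m")
    case True
    have "hform n (0\<^sub>v (n + 1)) (0\<^sub>v (n + 1)) = 0"
      by (subst hform_lincomb_left[of n _ "\<lambda>_. 0\<^sub>v (n + 1)" "\<lambda>_. 0" "{}"]) auto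
    then show ?thesis using E(5)[OF True True] True by (auto simp: F_def)
  qed (use V_zeroD[OF u] V_zeroD[OF v] in \<open>auto simp: F_def\<close>)
  have \<mu>0: "\<mu> i \<noteq> 0" for i
    using Sp_vec_eq_0[OF g F(1)[of i]] F0[of i] F[of i] rscale_0 by metis
  define S where "S = {x \<in> carrier_vec (n + 1). \<forall>i<m + 2. hform n x (F i) = 0}"
  have S: "S \<subseteq> carrier_vec (n + 1)" by (auto simp: S_def)
  have add: "x + y \<in> S" if "x \<in> S" "y \<in> S" for x y
    using that by (simp add: S_def hform_add_left)
  have scale: "rscale x c \<in> S" if "x \<in> S" for x c
    using that by (simp add: S_def hform_rscale_left)
  have inv: "g *\<^sub>v x \<in> S" if "x \<in> S" for x
  proof -
    have x: "x \<in> carrier_vec (n + 1)" using that by (simp add: S_def)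
    have "hform n (g *\<^sub>v x) (F i) = 0" if "i < m + 2" for i
    proof -
      have "qcnj (\<mu> i) * hform n (g *\<^sub>v x) (F i) = hform n (g *\<^sub>v x) (g *\<^sub>v F i)"
        using F by (simp add: hform_rscale_right)
      also have "\<dots> = hform n x (F i)" by (rule SpD(2)[OF g x F(1)])
      also have "\<dots> = 0" using \<open>x \<in> S\<close> that by (simp add: S_def)
      finally show ?thesis using \<mu>0 by simp
    qed
    then show ?thesis using Sp_vec_closed[OF g x] by (simp add: S_def)
  qed
  obtain x0 where x0: "x0 \<in> S" "x0 \<noteq> 0\<^sub>v (n + 1)"
  proof -
    \<comment> \<open>Orthogonality to \<open>m\<close> vectors and to \<open>u\<close> and
      \<open>v\<close> gives \<open>m + 2\<close> equations in \<open>n + 1\<close> unknowns;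
      \<open>Suc m \<le> n - 1\<close> leaves a nontrivial solution.\<close>
    have "m + 2 < n + 1" using Suc.prems by linarith
    then obtain x where x: "\<exists>j\<in>{..<n + 1}. x j \<noteq> 0"
      "\<forall>i<m + 2. (\<Sum>j<n + 1. hform n (unit_vec (n + 1) j) (F i) * x j) = 0"
      using homogeneous_system_nontrivial[of "{..<n + 1}" "m + 2"
          "\<lambda>i j. hform n (unit_vec (n + 1) j) (F i)"] by auto
    have "hform n (vec (n + 1) x) (F i) = (\<Sum>j<n + 1. hform n (unit_vec (n + 1) j) (F i) * x j)" for i
      by (subst hform_lincomb_left[OF unit_vec_lincomb]) (auto intro!: sum.cong)
    then have "vec (n + 1) x \<in> S" using x(2) by (simp add: S_def)
    moreover have "vec (n + 1) x \<noteq> 0\<^sub>v (n + 1)"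
      using x(1) by (metis index_vec index_zero_vec(1) lessThan_iff)
    ultimately show ?thesis using that by blast
  qed
  obtain w c where w: "w \<in> S" "w \<noteq> 0\<^sub>v (n + 1)" "g *\<^sub>v w = rscale w c"
    by (rule invariant_subspace_eigenvector[OF SpD(1)[OF g] S add scale inv x0])
  have wc: "w \<in> carrier_vec (n + 1)" and wF: "\<And>i. i < m + 2 \<Longrightarrow> hform n w (F i) = 0"
    using w(1) by (auto simp: S_def)
  have wE: "hform n w (E k) = 0" "hform n (E k) w = 0" if "k < m" for k
    using wF[of k] that hform_cnj[of n w "E k"] by (auto simp: F_def)
  have wu: "hform n w u = 0" and wv: "hform n w v = 0"
    using wF[of m] wF[of "m + 1"] by (auto simp: F_def)
  define r where "r = qre (hform n w w)"
  have r: "r > 0"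
    unfolding r_def by (rule hform_pos_orthogonal_null_pair[OF n u uv wc w(2) wu wv])
  \<comment> \<open>The factor is real, hence central, so scaling does not conjugate the eigenvalue
    \<open>c\<close>.\<close>
  define s where "s = 1 / sqrt r"
  define e where "e = rscale w (of_real s)"
  have cs: "qcnj (of_real s) = of_real s" "of_real s * c = c * of_real s"
    by (simp_all add: quat_eq_iff of_real_def)
  have ec: "e \<in> carrier_vec (n + 1)" using wc by (simp add: e_def)
  have ww: "hform n w w = of_real r" unfolding r_def by (rule hform_self_real)
  have ssr: "s * (r * s) = 1" using r by (simp add: s_def field_simps)
  have "hform n e e = of_real (s * (r * s))"
    using wc by (simp add: e_def hform_rscale_left hform_rscale_right ww cs)
  then have ee: "hform n e e = 1"
    unfolding ssr by simp
  have ge: "g *\<^sub>v e = rscale e c"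
    unfolding e_def using mult_mat_vec_rscale[OF SpD(1)[OF g] wc] w(3) cs by (simp add: rscale_rscale)
  have eE: "hform n e (E k) = 0" "hform n (E k) e = 0" if "k < m" for k
    using wE[OF that] wc by (auto simp: e_def hform_rscale_left hform_rscale_right)
  have eu: "hform n e u = 0" "hform n e v = 0"
    using wu wv wc by (auto simp: e_def hform_rscale_left)
  show ?case
  proof (intro exI[of _ "E(m := e)"] exI[of _ "l(m := c)"] allI impI)
    fix k assume "k < Suc m"
    then show "(E(m := e)) k \<in> carrier_vec (n + 1) \<and> hform n ((E(m := e)) k) u = 0 \<and>
      hform n ((E(m := e)) k) v = 0 \<and>
      g *\<^sub>v (E(m := e)) k = rscale ((E(m := e)) k) ((l(m := c)) k) \<and>
      (\<forall>j<Suc m. hform n ((E(m := e)) j) ((E(m := e)) k) = (if j = k then 1 else 0))"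
      using E ec ee ge eE eu by (auto simp: less_Suc_eq)
  qed
qed

lemma eigenvalues_null_pair:
  assumes u: "u \<in> V_zero n" and v: "v \<in> V_zero n" and uv: "hform n u v = - 1"
    and g: "g \<in> carrier (Sp n)" and gu: "g *\<^sub>v u = rscale u \<alpha>" and gv: "g *\<^sub>v v = rscale v \<beta>"
  shows "\<beta> = inverse (qcnj \<alpha>)"
proof -
  note uc = V_zeroD[OF u] and vc = V_zeroD[OF v]
  have "qcnj \<beta> * (- 1 * \<alpha>) = hform n (g *\<^sub>v u) (g *\<^sub>v v)"
    using uc vc by (simp add: gu gv hform_rscale_left hform_rscale_right uv)
  also have "\<dots> = - 1" using SpD(2)[OF g uc(1) vc(1)] uv by simp
  finally have "qcnj \<beta> * \<alpha> = 1" by simp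
  then have "inverse (qcnj \<beta>) = \<alpha>" by (rule inverse_unique)
  then show ?thesis by (auto simp: qcnj_inverse)
qed

text \<open>With the normalisation \<open>hform n u v = - 1\<close>, the orthonormal eigenvectors
  followed by \<open>u\<close> and \<open>v\<close> have the Gram matrix of the standard basis.
  Eigenvalues on vectors of length one have norm one because \<open>g\<close> preserves their
  length.\<close>

lemma eigenframe:
  assumes n: "n \<ge> 1" and u: "u \<in> V_zero n" and v: "v \<in> V_zero n" and uv: "hform n u v = - 1"
    and g: "g \<in> carrier (Sp n)" and gu: "g *\<^sub>v u = rscale u \<alpha>" and gv: "g *\<^sub>v v = rscale v \<beta>"
  obtains F l where "mat (n + 1) (n + 1) (\<lambda>(i, j). F j $ i) \<in> carrier (Sp n)"
    "\<forall>k. F k \<in> carrier_vec (n + 1)" "F (n - 1) = u" "F n = v"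
    "\<forall>k<n - 1. g *\<^sub>v F k = rscale (F k) (l k)" "\<forall>k<n - 1. norm (l k) = 1"
proof -
  note uc = V_zeroD[OF u] and vc = V_zeroD[OF v]
  have "hform n u v \<noteq> 0" using uv by simp
  from orthonormal_eigenvectors[OF n u v this g gu gv order.refl]
  obtain E l where E: "\<And>k. k < n - 1 \<Longrightarrow> E k \<in> carrier_vec (n + 1)"
      "\<And>k. k < n - 1 \<Longrightarrow> hform n (E k) u = 0" "\<And>k. k < n - 1 \<Longrightarrow> hform n (E k) v = 0"
      "\<And>k. k < n - 1 \<Longrightarrow> g *\<^sub>v E k = rscale (E k) (l k)"
      "\<And>j k. k < n - 1 \<Longrightarrow> j < n - 1 \<Longrightarrow> hform n (E j) (E k) = (if j = k then 1 else 0)"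
    by auto
  have E': "hform n u (E k) = 0" "hform n v (E k) = 0" if "k < n - 1" for k
    using E(2,3)[OF that] hform_cnj[of n "E k" u] hform_cnj[of n "E k" v] by auto
  have vu: "hform n v u = - 1" using hform_cnj[of n u v] uv by simp
  define F where "F k = (if k < n - 1 then E k else if k = n - 1 then u else v)" for k
  have Fc: "F k \<in> carrier_vec (n + 1)" for k
    using E uc vc by (auto simp: F_def)
  have Fn: "F (n - 1) = u" "F n = v" "\<And>k. k < n - 1 \<Longrightarrow> F k = E k"
    using n by (auto simp: F_def)
  have split: "k < n - 1 \<or> k = n - 1 \<or> k = n" if "k < n + 1" for k
    using that by linarith
  have unit: "unit_vec (n + 1) j $ k = (if k = j then 1 else 0 :: quat)" if "k < n + 1" for j k
    using that by (simp add: unit_vec_def)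
  have f: "mat (n + 1) (n + 1) (\<lambda>(i, j). F j $ i) \<in> carrier (Sp n)"
  proof (rule gram_imp_Sp[OF n Fc])
    fix j k assume jk: "j < n + 1" "k < n + 1"
    consider "k < n - 1" | "k = n - 1" | "k = n" using split[OF jk(2)] by blast
    then show "hform n (F j) (F k) = hform n (unit_vec (n + 1) j) (unit_vec (n + 1) k)"
    proof cases
      case 1
      show ?thesis
        using split[OF jk(1)] 1 n E E'
        unfolding hform_unit_vec(1)[OF n 1] unit[OF jk(2)] Fn(3)[OF 1] by (elim disjE) (auto simp: Fn simp del: One_nat_def)
    next
      case 2
      have "n \<noteq> n - 1" using n by simp
      show ?thesis
        using split[OF jk(1)] n E(2) uc vu \<open>n \<noteq> n - 1\<close>
        unfolding 2 hform_unit_vec(2)[OF n] Fn(1) by (subst unit) (auto simp: Fn simp del: One_nat_def)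
    next
      case 3
      have "n \<noteq> n - 1" using n by simp
      show ?thesis
        using split[OF jk(1)] n E(3) vc uv \<open>n \<noteq> n - 1\<close>
        unfolding 3 hform_unit_vec(3)[OF n] Fn(2) by (subst unit) (auto simp: Fn simp del: One_nat_def)
    qed
  qed
  have nl: "norm (l k) = 1" if k: "k < n - 1" for k
  proof -
    have "qcnj (l k) * l k = hform n (g *\<^sub>v E k) (g *\<^sub>v E k)"
      using E[OF k] k by (simp add: hform_rscale_left hform_rscale_right)
    also have "\<dots> = 1" using SpD(2)[OF g E(1)[OF k] E(1)[OF k]] E(5)[OF k k] by simp
    finally have "norm (qcnj (l k) * l k) = 1" by simp
    then have "(norm (l k))\<^sup>2 = 1\<^sup>2" by (simp add: norm_mult power2_eq_square)
    then show ?thesis by (subst (asm) power2_eq_iff_nonneg) auto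
  qed
  show thesis
    by (rule that[OF f _ Fn(1,2), of l]) (use Fc E(4) Fn(3) nl in auto)
qed

text \<open>Every vector is an eigenvector of the identity, so \<open>eigenframe\<close> completes
  any normalised null pair to a frame.\<close>

lemma null_pair_transitive:
  assumes n: "n \<ge> 1" and u: "u \<in> V_zero n" and v: "v \<in> V_zero n" and uv: "hform n u v = - 1"
  obtains f where "f \<in> carrier (Sp n)" "f *\<^sub>v unit_vec (n + 1) (n - 1) = u" "f *\<^sub>v unit_vec (n + 1) n = v"
proof -
  have 1: "1\<^sub>m (n + 1) \<in> carrier (Sp n)"
    using monoid.one_closed[OF group.is_monoid[OF group_Sp], of n] by (simp add: Sp_simps)
  obtain F l where F: "mat (n + 1) (n + 1) (\<lambda>(i, j). F j $ i) \<in> carrier (Sp n)" (is "?f \<in> _")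
    "\<forall>k. F k \<in> carrier_vec (n + 1)" "F (n - 1) = u" "F n = v"
    using eigenframe[OF n u v uv 1, of 1 1] V_zeroD(1)[OF u] V_zeroD(1)[OF v] by auto
  have "?f *\<^sub>v unit_vec (n + 1) k = F k" if "k < n + 1" for k
  proof -
    have "?f *\<^sub>v unit_vec (n + 1) k = col ?f k"
      by (rule mat_mult_unit_vec) (use that in auto)
    also have "\<dots> = F k" using that F(2)[rule_format, of k] by (intro eq_vecI) auto
    finally show ?thesis .
  qed
  from this[of "n - 1"] this[of n] show thesis
    using that[OF F(1)] F(3,4) n by simp
qed

lemma loxo_normal_form_of_null_pair:
  assumes n: "n \<ge> 1" and u: "u \<in> V_zero n" and v: "v \<in> V_zero n" and uv: "hform n u v = - 1"
    and g: "g \<in> carrier (Sp n)" and gu: "g *\<^sub>v u = rscale u \<alpha>" and gv: "g *\<^sub>v v = rscale v \<beta>"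
    and \<alpha>: "norm \<alpha> > 1"
  shows "\<exists>l. loxo_normal_form n g l"
proof -
  obtain F l where f': "mat (n + 1) (n + 1) (\<lambda>(i, j). F j $ i) \<in> carrier (Sp n)"
    and F: "\<forall>k. F k \<in> carrier_vec (n + 1)" "F (n - 1) = u" "F n = v"
      "\<forall>k<n - 1. g *\<^sub>v F k = rscale (F k) (l k)"
    and l: "\<forall>k<n - 1. norm (l k) = 1"
    by (rule eigenframe[OF n u v uv g gu gv])
  define f where "f = mat (n + 1) (n + 1) (\<lambda>(i, j). F j $ i)"
  have f: "f \<in> carrier (Sp n)" using f' by (simp only: f_def)
  define L where "L k = (if k < n - 1 then l k else \<alpha>)" for k
  define d where "d j = (if j < n then L j else inverse (qcnj (L (n - 1))))" for j
  have fc: "f \<in> carrier_mat (n + 1) (n + 1)" by (rule SpD(1)[OF f])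
  have gF: "g *\<^sub>v F j = rscale (F j) (d j)" if "j < n + 1" for j
  proof -
    consider "j < n - 1" | "j = n - 1" | "j = n" using \<open>j < n + 1\<close> by linarith
    then show ?thesis
      using F gu gv n eigenvalues_null_pair[OF u v uv g gu gv]
      by cases (auto simp: d_def L_def)
  qed
  have "g * f = mat (n + 1) (n + 1) (\<lambda>(i, j). f $$ (i, j) * d j)" (is "_ = ?R")
  proof (rule eq_matI)
    fix i j assume "i < dim_row ?R" "j < dim_col ?R"
    then have ij: "i < n + 1" "j < n + 1" by simp_all
    have "col f j = F j"
      using ij F(1)[rule_format, of j] by (intro eq_vecI) (auto simp: f_def)
    then have "(g * f) $$ (i, j) = (g *\<^sub>v F j) $ i"
      using ij SpD(1)[OF g] fc by simp
    then show "(g * f) $$ (i, j) = ?R $$ (i, j)"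
      using ij F(1)[rule_format, of j] gF[of j] by (simp add: f_def)
  qed (use SpD(1)[OF g] fc in auto)
  also have "\<dots> = f * loxo_diag n L"
    unfolding loxo_diag_def mat_diag_mult_right[OF fc] d_def ..
  finally have "g * f = f * loxo_diag n L" .
  moreover have "g = (g * f) * inv\<^bsub>Sp n\<^esub> f"
    using assoc_mult_mat[OF SpD(1)[OF g] fc SpD(1)[OF Sp_inv_closed[OF f]]] Sp_mult_inv[OF f] SpD(1)[OF g]
    by simp
  ultimately have "g = f \<otimes>\<^bsub>Sp n\<^esub> loxo_diag n L \<otimes>\<^bsub>Sp n\<^esub> inv\<^bsub>Sp n\<^esub> f"
    by (simp add: Sp_simps)
  then show ?thesis
    using \<alpha> f l unfolding loxo_normal_form_def
    by (intro exI[of _ L]) (auto simp: L_def)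
qed

lemma fixed_boundary_point_eigenvector:
  assumes "A \<in> carrier (Sp n)" "z \<in> V_zero n" "act A (proj_pt z) = proj_pt z"
  obtains \<alpha> where "A *\<^sub>v z = rscale z \<alpha>"
  using proj_pt_eqD[of z "A *\<^sub>v z"] assms act_null[OF assms(1,2)] by metis

lemma loxo_normal_form_exists:
  assumes n: "n \<ge> 1" and lox: "loxodromic n g"
    and u: "u \<in> hyp_boundary n" "act g u = u" and v: "v \<in> hyp_boundary n" "act g v = v" and "u \<noteq> v"
  shows "\<exists>l. loxo_normal_form n g l"
proof -
  have g: "g \<in> carrier (Sp n)" using lox by (simp add: loxodromic_def)
  obtain U V' where U: "U \<in> V_zero n" "u = proj_pt U" and V': "V' \<in> V_zero n" "v = proj_pt V'"
    using u v by (auto simp: hyp_boundary_def)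
  have "V' \<noteq> rscale U c" for c
  proof
    assume c: "V' = rscale U c"
    then have "c \<noteq> 0" using rscale_0[OF V_zeroD(1)[OF U(1)]] V_zeroD[OF V'(1)] by auto
    then show False using c U V' \<open>u \<noteq> v\<close> by (simp add: proj_pt_rscale)
  qed
  then have nz: "hform n V' U \<noteq> 0"
    by (rule hform_null_nonzero[OF n U(1) V'(1)])
  \<comment> \<open>Distinct null points are not orthogonal, so a lift of \<open>v\<close> can be
    rescaled to pair with \<open>U\<close> to \<open>- 1\<close>. This value is real, so the pairing
    is \<open>- 1\<close> in either order.\<close>
  define V where "V = rscale V' (- inverse (hform n V' U))"
  have V: "V \<in> V_zero n" "v = proj_pt V" "hform n V U = - 1"
  proof -
    note V'c = V_zeroD[OF V'(1)]
    show "v = proj_pt V" using nz by (simp add: V_def V' proj_pt_rscale)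
    show "hform n V U = - 1" using nz V'c by (simp add: V_def hform_rscale_left)
    then have "V \<noteq> 0\<^sub>v (n + 1)"
      by (metis hform_rscale_left mult_zero_right neg_equal_0_iff_equal rscale_0 zero_carrier_vec zero_neq_one)
    then show "V \<in> V_zero n"
      using V'c by (simp add: V_zero_def V_def hform_rscale_left hform_rscale_right)
  qed
  have UV: "hform n U V = - 1" using hform_cnj[of n V U] V by simp
  note Uc = V_zeroD[OF U(1)] and Vc = V_zeroD[OF V(1)]
  obtain \<alpha> where \<alpha>: "g *\<^sub>v U = rscale U \<alpha>"
    using fixed_boundary_point_eigenvector[OF g U(1)] u U by auto
  obtain \<beta> where \<beta>: "g *\<^sub>v V = rscale V \<beta>"
    using fixed_boundary_point_eigenvector[OF g V(1)] v V by auto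
  have \<beta>\<alpha>: "\<beta> = inverse (qcnj \<alpha>)"
    by (rule eigenvalues_null_pair[OF U(1) V(1) UV g \<alpha> \<beta>])
  have "\<alpha> \<noteq> 0"
    using Sp_vec_eq_0[OF g Uc(1)] Uc \<alpha> rscale_0 by metis
  then have nn: "norm \<beta> * norm \<alpha> = 1" by (simp add: \<beta>\<alpha> norm_inverse)
  \<comment> \<open>The two eigenvalues have reciprocal norms. The normal form wants the expanding
    one first, and the hypotheses are symmetric in \<open>U\<close> and \<open>V\<close>, so either
    may take that place.\<close>
  consider "norm \<alpha> > 1" | "norm \<beta> > 1" | "norm \<alpha> = 1"
  proof (cases "norm \<alpha> < 1")
    case True
    then have "norm \<beta> > 1"
      using nn \<open>\<alpha> \<noteq> 0\<close> by (simp add: \<beta>\<alpha> norm_inverse one_less_inverse_iff)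
    then show ?thesis using that by blast
  qed (use that in linarith)
  then show ?thesis
  proof cases
    case 1
    then show ?thesis
      by (rule loxo_normal_form_of_null_pair[OF n U(1) V(1) UV g \<alpha> \<beta>])
  next
    case 2
    then show ?thesis
      by (rule loxo_normal_form_of_null_pair[OF n V(1) U(1) V(3) g \<beta> \<alpha>])
  next
    text \<open>An eigenvalue of norm 1 would give a third fixed point, on the geodesic joining
      \<open>u\<close> and \<open>v\<close>.\<close>
    case 3
    then have "qcnj \<alpha> * \<alpha> = 1" by (simp add: qcnj_mult_self power2_norm_quat[symmetric])
    then have "\<beta> = \<alpha>" unfolding \<beta>\<alpha> by (rule inverse_unique)
    define z where "z = U + V"
    have zc: "z \<in> carrier_vec (n + 1)" using Uc Vc by (simp add: z_def)
    have "hform n z z = - 1 + - 1"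
      using Uc Vc UV V(3) by (simp add: z_def hform_add_left hform_add_right)
    then have zz: "qre (hform n z z) = - 2"
      by (simp only: quat_add_simps quat_mult_simps)
    have "g *\<^sub>v z = rscale z \<alpha>"
    proof -
      have "g *\<^sub>v z = rscale U \<alpha> + rscale V \<alpha>"
        unfolding z_def mult_add_distrib_mat_vec[OF SpD(1)[OF g] Uc(1) Vc(1)] \<alpha> \<beta> \<open>\<beta> = \<alpha>\<close> ..
      also have "\<dots> = rscale z \<alpha>"
        using Uc Vc by (intro eq_vecI) (auto simp: z_def distrib_right)
      finally show ?thesis .
    qed
    then have "act g (proj_pt z) = proj_pt z"
      using act_proj_pt[OF SpD(1)[OF g] zc] \<open>\<alpha> \<noteq> 0\<close> by (simp add: proj_pt_rscale)
    moreover have "proj_pt z \<in> hyp_closure n"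
    proof -
      have "z \<in> V_minus n" using zc zz by (simp add: V_minus_def)
      then show ?thesis by (auto simp: hyp_closure_def hyp_space_def)
    qed
    ultimately have "proj_pt z \<in> hyp_boundary n"
      using lox by (auto simp: loxodromic_def)
    then obtain w where w: "w \<in> V_zero n" "proj_pt z = proj_pt w"
      by (auto simp: hyp_boundary_def)
    then obtain c where "c \<noteq> 0" "w = rscale z c" using proj_pt_eqD by metis
    moreover have "hform n z z \<noteq> 0" using zz by auto
    ultimately have "hform n w w \<noteq> 0"
      using zc by (simp add: hform_rscale_left hform_rscale_right)
    then show ?thesis using V_zeroD(3)[OF w(1)] by simp
  qed
qed

section \<open>Ptolemy's inequality and matrix entries\<close>

lemma norm_hform_commute: "norm (hform n z w) = norm (hform n w z)"
  by (metis hform_cnj norm_qcnj)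

text \<open>The Gram matrix of the standard basis is, up to signs, the permutation matrix of this
  involution: pairing with the unit vector of index \<open>swap_last n i\<close> reads off
  coordinate \<open>i\<close>.\<close>

definition swap_last :: "nat \<Rightarrow> nat \<Rightarrow> nat" where
  "swap_last n i = (if i < n - 1 then i else if i = n - 1 then n else n - 1)"

lemma swap_last_simps:
  "n \<ge> 1 \<Longrightarrow> swap_last n n = n - 1" "n \<ge> 1 \<Longrightarrow> swap_last n (n - 1) = n"
  "k < n - 1 \<Longrightarrow> swap_last n k = k" "n \<ge> 1 \<Longrightarrow> swap_last n i < n + 1"
  by (auto simp: swap_last_def)

lemma norm_coordinate:
  assumes "n \<ge> 1" "i < n + 1"
  shows "norm (z $ i) = norm (hform n z (unit_vec (n + 1) (swap_last n i)))"
proof -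
  consider "i < n - 1" | "i = n - 1" | "i = n" using assms by linarith
  then show ?thesis
    using assms(1) by cases (simp_all add: swap_last_simps hform_unit_vec del: One_nat_def add_Suc_right)
qed

lemma norm_entry:
  assumes "n \<ge> 1" "A \<in> carrier_mat (n + 1) (n + 1)" "i < n + 1" "j < n + 1"
  shows "norm (A $$ (i, j)) = norm (hform n (A *\<^sub>v unit_vec (n + 1) j) (unit_vec (n + 1) (swap_last n i)))"
proof -
  have "(A *\<^sub>v unit_vec (n + 1) j) $ i = A $$ (i, j)"
    using mat_mult_unit_vec[OF assms(2,4)] assms by simp
  then show ?thesis using norm_coordinate[OF assms(1,3)] by metis
qed

lemma swap_last_swap_last: "n \<ge> 1 \<Longrightarrow> i < n + 1 \<Longrightarrow> swap_last n (swap_last n i) = i"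
  by (auto simp: swap_last_def)

text \<open>The inverse is the adjoint for the form, hence the conjugate transpose with indices
  exchanged by duality. In the corner block it exchanges the norms of \<open>a\<close> and
  \<open>d\<close> and keeps those of \<open>b\<close> and \<open>c\<close>.\<close>

lemma norm_inv_entry:
  assumes n: "n \<ge> 1" and A: "A \<in> carrier (Sp n)" and ij: "i < n + 1" "j < n + 1"
  shows "norm ((inv\<^bsub>Sp n\<^esub> A) $$ (i, j)) = norm (A $$ (swap_last n j, swap_last n i))"
proof -
  let ?e = "unit_vec (n + 1) :: nat \<Rightarrow> quat vec"
  have s: "swap_last n i < n + 1" "swap_last n j < n + 1" using swap_last_simps(4)[OF n] by auto
  have "norm ((inv\<^bsub>Sp n\<^esub> A) $$ (i, j)) = norm (hform n (inv\<^bsub>Sp n\<^esub> A *\<^sub>v ?e j) (?e (swap_last n i)))"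
    by (rule norm_entry[OF n SpD(1)[OF Sp_inv_closed[OF A]] ij])
  also have "\<dots> = norm (hform n (A *\<^sub>v ?e (swap_last n i)) (?e j))"
    by (subst norm_hform_commute, subst hform_Sp_adjoint[OF A]) simp_all
  also have "\<dots> = norm (A $$ (swap_last n j, swap_last n i))"
    using norm_entry[OF n SpD(1)[OF A] s(2,1)] swap_last_swap_last[OF n ij(2)] by simp
  finally show ?thesis .
qed

section \<open>Cauchy-Schwarz estimates and Ptolemy's inequality\<close>

definition norm_head :: "nat \<Rightarrow> quat vec \<Rightarrow> real" where
  "norm_head n z = L2_set (\<lambda>k. norm (z $ k)) {..<n - 1}"

lemma norm_head_nonneg: "norm_head n z \<ge> 0"
  by (simp add: norm_head_def L2_set_nonneg)

lemma norm_head_power2: "(norm_head n z)\<^sup>2 = (\<Sum>k<n - 1. (norm (z $ k))\<^sup>2)"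
  unfolding norm_head_def L2_set_def by (intro real_sqrt_pow2 sum_nonneg) auto

lemma norm_head_power2_le:
  "(norm_head n z)\<^sup>2 \<le> qre (hform n z z) + 2 * (norm (z $ (n - 1)) * norm (z $ n))"
proof -
  have "qre (qcnj (z $ n) * z $ (n - 1)) \<le> norm (qcnj (z $ n) * z $ (n - 1))"
    using abs_qre_le_norm abs_le_D1 by blast
  then show ?thesis
    unfolding norm_head_power2 qre_hform_self norm_mult norm_qcnj by (simp add: mult.commute)
qed

text \<open>Cauchy-Schwarz on the first \<open>n - 1\<close> coordinates. The comparison vector
  \<open>z\<close> is separate from \<open>y\<close> because \<open>y\<close> will be
  \<open>D z\<close> or \<open>D z - z\<close>, with \<open>C = 1\<close> or
  \<open>C = dlt\<close>.\<close>

lemma norm_hform_le: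
  assumes "C \<ge> 0" and "\<And>k. k < n - 1 \<Longrightarrow> norm (y $ k) \<le> C * norm (z $ k)"
  shows "norm (hform n y w) \<le> C * (norm_head n z * norm_head n w) +
    norm (y $ (n - 1)) * norm (w $ n) + norm (y $ n) * norm (w $ (n - 1))"
proof -
  have "norm (\<Sum>k<n - 1. qcnj (w $ k) * y $ k) \<le> (\<Sum>k<n - 1. norm (qcnj (w $ k) * y $ k))"
    by (rule norm_sum)
  also have "\<dots> \<le> (\<Sum>k<n - 1. C * (\<bar>norm (z $ k)\<bar> * \<bar>norm (w $ k)\<bar>))"
  proof (rule sum_mono)
    fix k assume "k \<in> {..<n - 1}"
    then have "norm (y $ k) * norm (w $ k) \<le> (C * norm (z $ k)) * norm (w $ k)"
      using assms(2) by (intro mult_right_mono) auto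
    then show "norm (qcnj (w $ k) * y $ k) \<le> C * (\<bar>norm (z $ k)\<bar> * \<bar>norm (w $ k)\<bar>)"
      by (simp add: norm_mult mult_ac)
  qed
  also have "\<dots> = C * (\<Sum>k<n - 1. \<bar>norm (z $ k)\<bar> * \<bar>norm (w $ k)\<bar>)"
    by (simp add: sum_distrib_left)
  also have "\<dots> \<le> C * (norm_head n z * norm_head n w)"
    unfolding norm_head_def using assms(1) by (intro mult_left_mono L2_set_mult_ineq)
  finally have 1: "norm (\<Sum>k<n - 1. qcnj (w $ k) * y $ k) \<le> C * (norm_head n z * norm_head n w)" .
  have 2: "norm (hform n y w) \<le> norm (\<Sum>k<n - 1. qcnj (w $ k) * y $ k) +
      (norm (qcnj (w $ (n - 1)) * y $ n) + norm (qcnj (w $ n) * y $ (n - 1)))"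
    unfolding hform_def by (rule order.trans[OF norm_triangle_ineq4 add_left_mono[OF norm_triangle_ineq]])
  show ?thesis
    using add_right_mono[OF 1] 2 by (simp add: norm_mult mult.commute)
qed

lemma norm_head_mult_le:
  assumes "hform n z z = 0" "hform n w w = 0"
  shows "norm_head n z * norm_head n w \<le>
    2 * sqrt ((norm (z $ (n - 1)) * norm (z $ n)) * (norm (w $ (n - 1)) * norm (w $ n)))"
proof -
  have "norm_head n x \<le> sqrt (2 * (norm (x $ (n - 1)) * norm (x $ n)))" if "hform n x x = 0" for x
    using norm_head_power2_le[of n x] that by (intro real_le_rsqrt) simp
  then have "norm_head n z * norm_head n w \<le>
      sqrt (2 * (norm (z $ (n - 1)) * norm (z $ n))) * sqrt (2 * (norm (w $ (n - 1)) * norm (w $ n)))"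
    using assms norm_head_nonneg by (intro mult_mono) auto
  also have "\<dots> = 2 * sqrt ((norm (z $ (n - 1)) * norm (z $ n)) * (norm (w $ (n - 1)) * norm (w $ n)))"
    by (simp add: real_sqrt_mult)
  finally show ?thesis .
qed

text \<open>For null vectors the Cauchy-Schwarz term is at most twice the geometric mean of the two
  remaining terms, so the bound is a perfect square. This is Ptolemy's inequality when two of the
  four points are the standard null points.\<close>

lemma sqrt_norm_hform_null_le:
  assumes "hform n z z = 0" "hform n w w = 0"
  shows "sqrt (norm (hform n z w)) \<le>
    sqrt (norm (z $ (n - 1)) * norm (w $ n)) + sqrt (norm (z $ n) * norm (w $ (n - 1)))"
    (is "_ \<le> sqrt ?a + sqrt ?b")
proof -
  have ab: "?a \<ge> 0" "?b \<ge> 0" by auto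
  have "norm (hform n z w) \<le> 1 * (norm_head n z * norm_head n w) + ?a + ?b"
    by (rule norm_hform_le) simp_all
  also have "\<dots> \<le> 2 * sqrt (?a * ?b) + ?a + ?b"
    using norm_head_mult_le[OF assms] by (simp add: mult_ac)
  also have "\<dots> = (sqrt ?a + sqrt ?b)\<^sup>2"
    by (simp only: power2_sum real_sqrt_pow2[OF ab(1)] real_sqrt_pow2[OF ab(2)] real_sqrt_mult[of ?a ?b])
  finally show ?thesis by (intro real_le_lsqrt) auto
qed

text \<open>The inequality is homogeneous in each vector and invariant under the group, so
  \<open>p\<close> and \<open>q\<close> may be moved to the standard null vectors; the scaling
  factor \<open>s\<close> cancels. If \<open>p\<close> and \<open>q\<close> are orthogonal, the left
  side is zero.\<close>

lemma ptolemy_null: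
  assumes n: "n \<ge> 1" and x: "x \<in> V_zero n" and y: "y \<in> V_zero n" and p: "p \<in> V_zero n" and q: "q \<in> V_zero n"
  shows "sqrt (norm (hform n x y) * norm (hform n p q)) \<le>
    sqrt (norm (hform n x p) * norm (hform n y q)) + sqrt (norm (hform n x q) * norm (hform n y p))"
proof (cases "hform n p q = 0")
  case False
  note pc = V_zeroD[OF p] and qc = V_zeroD[OF q]
  define s where "s = - inverse (hform n p q)"
  define p' where "p' = rscale p s"
  have s: "s \<noteq> 0" using False by (simp add: s_def)
  have p'c: "p' \<in> carrier_vec (n + 1)" using pc by (simp add: p'_def)
  have p'q: "hform n p' q = - 1" using False pc by (simp add: p'_def s_def hform_rscale_left)
  have "p' \<noteq> 0\<^sub>v (n + 1)"
    using p'q rscale_0[OF zero_carrier_vec, of "n + 1"] hform_rscale_left[of "0\<^sub>v (n + 1)" n 0 q] by auto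
  then have p': "p' \<in> V_zero n"
    using pc by (simp add: V_zero_def p'_def hform_rscale_left hform_rscale_right)
  obtain f where f: "f \<in> carrier (Sp n)"
      "f *\<^sub>v unit_vec (n + 1) (n - 1) = p'" "f *\<^sub>v unit_vec (n + 1) n = q"
    using null_pair_transitive[OF n p' q p'q] by blast
  let ?g = "inv\<^bsub>Sp n\<^esub> f"
  have g: "?g \<in> carrier (Sp n)" by (rule Sp_inv_closed[OF f(1)])
  have co: "norm ((?g *\<^sub>v z) $ (n - 1)) = norm (hform n z q)"
      "norm ((?g *\<^sub>v z) $ n) = norm (hform n z p) * norm s" if z: "z \<in> carrier_vec (n + 1)" for z
  proof -
    have gz: "?g *\<^sub>v z \<in> carrier_vec (n + 1)" by (rule Sp_vec_closed[OF g z])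
    have "norm ((?g *\<^sub>v z) $ n) = norm (hform n z p')"
      using norm_coordinate[OF n, of n "?g *\<^sub>v z"] n SpD(2)[OF f(1) gz unit_vec_carrier, of "n - 1"]
      by (simp add: swap_last_simps f Sp_inv_vec(1)[OF f(1) z] del: One_nat_def)
    then show "norm ((?g *\<^sub>v z) $ n) = norm (hform n z p) * norm s"
      using pc by (simp add: p'_def hform_rscale_right norm_mult mult.commute)
    show "norm ((?g *\<^sub>v z) $ (n - 1)) = norm (hform n z q)"
      using norm_coordinate[OF n, of "n - 1" "?g *\<^sub>v z"] n SpD(2)[OF f(1) gz unit_vec_carrier, of n]
      by (simp add: swap_last_simps f Sp_inv_vec(1)[OF f(1) z] del: One_nat_def)
  qed
  note xc = V_zeroD[OF x] and yc = V_zeroD[OF y]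
  have "sqrt (norm (hform n (?g *\<^sub>v x) (?g *\<^sub>v y))) \<le>
      sqrt (norm ((?g *\<^sub>v x) $ (n - 1)) * norm ((?g *\<^sub>v y) $ n)) +
      sqrt (norm ((?g *\<^sub>v x) $ n) * norm ((?g *\<^sub>v y) $ (n - 1)))"
    using xc yc by (intro sqrt_norm_hform_null_le) (simp_all add: SpD(2)[OF g])
  then have "sqrt (norm (hform n x y)) \<le>
      sqrt (norm (hform n x q) * norm (hform n y p)) * sqrt (norm s) +
      sqrt (norm (hform n x p) * norm (hform n y q)) * sqrt (norm s)"
    using SpD(2)[OF g xc(1) yc(1)] co[OF xc(1)] co[OF yc(1)]
    by (simp add: real_sqrt_mult mult_ac)
  from mult_right_mono[OF this, of "sqrt (norm (hform n p q))"]
  have "sqrt (norm (hform n x y)) * sqrt (norm (hform n p q)) \<le>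
      (sqrt (norm (hform n x q) * norm (hform n y p)) +
      sqrt (norm (hform n x p) * norm (hform n y q))) * (sqrt (norm s) * sqrt (norm (hform n p q)))"
    by (simp add: distrib_right mult.assoc)
  moreover have "sqrt (norm s) * sqrt (norm (hform n p q)) = 1"
    using False by (simp add: s_def norm_inverse flip: real_sqrt_mult)
  ultimately show ?thesis
    by (simp add: real_sqrt_mult add.commute)
qed simp

lemma unit_vec_null:
  assumes "n \<ge> 1" "i = n - 1 \<or> i = n"
  shows "unit_vec (n + 1) i \<in> V_zero n"
  using assms hform_unit_vec(2,3)[OF assms(1), of "unit_vec (n + 1) i"]
  by (auto simp: V_zero_def simp del: One_nat_def)

lemma norm_entry_corner:
  assumes n: "n \<ge> 1" and A: "A \<in> carrier_mat (n + 1) (n + 1)" and j: "j < n + 1"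
  shows "norm (A $$ (n - 1, j)) = norm (hform n (A *\<^sub>v unit_vec (n + 1) j) (unit_vec (n + 1) n))"
    "norm (A $$ (n, j)) = norm (hform n (A *\<^sub>v unit_vec (n + 1) j) (unit_vec (n + 1) (n - 1)))"
  using norm_entry[OF n A _ j] n by (auto simp: swap_last_simps simp del: One_nat_def)

text \<open>Ptolemy's inequality for \<open>H u\<close>, \<open>v\<close>, \<open>H v\<close>,
  \<open>u\<close>: the pairs \<open>H u\<close>, \<open>H v\<close> and \<open>v\<close>,
  \<open>u\<close> both have form of norm 1, which gives the summand 1.\<close>

lemma sqrt_diagonal_le:
  assumes n: "n \<ge> 1" and H: "H \<in> carrier (Sp n)"
  shows "sqrt (norm (H $$ (n - 1, n - 1)) * norm (H $$ (n, n))) \<le>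
    1 + sqrt (norm (H $$ (n - 1, n)) * norm (H $$ (n, n - 1)))"
proof -
  let ?u = "unit_vec (n + 1) (n - 1) :: quat vec" and ?v = "unit_vec (n + 1) n :: quat vec"
  have u: "?u \<in> V_zero n" and v: "?v \<in> V_zero n" using unit_vec_null[OF n] by auto
  have uv: "norm (hform n ?v ?u) = 1" using hform_unit_vec(2)[OF n, of ?v] n by simp
  then have "norm (hform n (H *\<^sub>v ?u) (H *\<^sub>v ?v)) = 1"
    using SpD(2)[OF H] norm_hform_commute by (metis unit_vec_carrier)
  moreover have "n - 1 < n + 1" "n < n + 1" using n by auto
  ultimately show ?thesis
    using ptolemy_null[OF n Sp_V_zero[OF H u] v Sp_V_zero[OF H v] u] uv
    unfolding norm_entry_corner[OF n SpD(1)[OF H] \<open>n - 1 < n + 1\<close>]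
      norm_entry_corner[OF n SpD(1)[OF H] \<open>n < n + 1\<close>]
      norm_hform_commute[of n ?v "H *\<^sub>v ?v"]
    by (simp add: mult.commute)
qed

text \<open>The last two columns are null, so the corner entries bound them; passing to the inverse
  bounds the last two rows. Every other column has length one, so its head is bounded by its last
  two entries. The constant is generous: squared norms stay below \<open>1 + 8 * Q\<^sup>2\<close>,
  and so do the norms, this number being at least 1.\<close>

lemma entries_bounded:
  assumes n: "n \<ge> 1" and H: "H \<in> carrier (Sp n)"
    and Q: "\<And>i j. i \<in> {n - 1, n} \<Longrightarrow> j \<in> {n - 1, n} \<Longrightarrow> norm (H $$ (i, j)) \<le> Q"
    and ij: "i < n + 1" "j < n + 1"
  shows "norm (H $$ (i, j)) \<le> 1 + 8 * Q\<^sup>2"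
proof -
  have Q0: "Q \<ge> 0" using Q[of n n] norm_ge_zero order.trans by blast
  let ?e = "unit_vec (n + 1) :: nat \<Rightarrow> quat vec"
  have col: "(A *\<^sub>v ?e j) $ i = A $$ (i, j)"
    if "A \<in> carrier (Sp n)" "i < n + 1" "j < n + 1" for A :: "quat mat" and i j
    using mat_mult_unit_vec[OF SpD(1)[OF that(1)] that(3)] SpD(1)[OF that(1)] that by simp
  have head: "(norm (z $ k))\<^sup>2 \<le> (norm_head n z)\<^sup>2" if "k < n - 1" for z k
    unfolding norm_head_power2 using that by (intro member_le_sum) auto
  have null: "(norm (A $$ (k, j)))\<^sup>2 \<le> 2 * (norm (A $$ (n - 1, j)) * norm (A $$ (n, j)))"
    if "A \<in> carrier (Sp n)" "k < n - 1" "j = n - 1 \<or> j = n" for A k j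
  proof -
    have z: "A *\<^sub>v ?e j \<in> V_zero n" by (rule Sp_V_zero[OF that(1) unit_vec_null[OF n that(3)]])
    have "j < n + 1" "k < n + 1" "n - 1 < n + 1" using that n by auto
    then show ?thesis
      using order.trans[OF head[OF that(2), of "A *\<^sub>v ?e j"] norm_head_power2_le] V_zeroD(3)[OF z]
        col[OF that(1)] by simp
  qed
  have sq: "x \<le> 1 + 8 * Q\<^sup>2" if "x\<^sup>2 \<le> 1 + 8 * Q\<^sup>2" for x :: real
  proof (rule power2_le_imp_le)
    have "1 + 8 * Q\<^sup>2 \<le> (1 + 8 * Q\<^sup>2)\<^sup>2" by (rule self_le_power) auto
    then show "x\<^sup>2 \<le> (1 + 8 * Q\<^sup>2)\<^sup>2" using that by linarith
  qed auto
  have QQ: "norm a \<le> Q \<Longrightarrow> norm b \<le> Q \<Longrightarrow> norm a * norm b \<le> Q\<^sup>2" for a b :: quat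
    unfolding power2_eq_square using Q0 by (intro mult_mono) auto
  have corner: "norm (H $$ (i, j)) \<le> 1 + 8 * Q\<^sup>2" if "i \<in> {n - 1, n}" "j \<in> {n - 1, n}" for i j
  proof (rule sq)
    have "(norm (H $$ (i, j)))\<^sup>2 \<le> Q\<^sup>2" by (rule power_mono[OF Q[OF that]]) simp
    then show "(norm (H $$ (i, j)))\<^sup>2 \<le> 1 + 8 * Q\<^sup>2" using zero_le_power2[of Q] by linarith
  qed
  have rows: "(norm (H $$ (i, j)))\<^sup>2 \<le> 2 * Q\<^sup>2" if "i \<in> {n - 1, n}" "j < n - 1" for i j
  proof -
    let ?A = "inv\<^bsub>Sp n\<^esub> H"
    have i: "i < n + 1" "swap_last n i = n - 1 \<or> swap_last n i = n" using that n by (auto simp: swap_last_def)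
    let ?s = "swap_last n i"
    have s: "?s < n + 1" "j < n + 1" "n - 1 < n + 1" "swap_last n ?s = i" "swap_last n j = j"
      using that n i by (auto simp: swap_last_simps swap_last_swap_last)
    have A: "norm (?A $$ (n - 1, ?s)) \<le> Q" "norm (?A $$ (n, ?s)) \<le> Q" "norm (?A $$ (j, ?s)) = norm (H $$ (i, j))"
      using norm_inv_entry[OF n H s(3,1)] norm_inv_entry[OF n H _ s(1), of n] norm_inv_entry[OF n H s(2,1)]
        Q[OF that(1), of n] Q[OF that(1), of "n - 1"] s(4,5) swap_last_simps(1,2)[OF n] by auto
    show ?thesis
      using null[OF Sp_inv_closed[OF H] that(2) i(2)] QQ[OF A(1,2)] unfolding A(3) by linarith
  qed
  consider "i \<in> {n - 1, n}" "j \<in> {n - 1, n}" | "i \<in> {n - 1, n}" "j < n - 1"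
    | "i < n - 1" "j = n - 1 \<or> j = n" | "i < n - 1" "j < n - 1"
    using ij by fastforce
  then show ?thesis
  proof cases
    case 1
    then show ?thesis by (rule corner)
  next
    case 2
    have "(norm (H $$ (i, j)))\<^sup>2 \<le> 1 + 8 * Q\<^sup>2"
      using rows[OF 2] zero_le_power2[of Q] by linarith
    then show ?thesis by (rule sq)
  next
    case 3
    then have "norm (H $$ (n - 1, j)) * norm (H $$ (n, j)) \<le> Q\<^sup>2"
      using Q by (intro QQ) auto
    then have "(norm (H $$ (i, j)))\<^sup>2 \<le> 1 + 8 * Q\<^sup>2"
      using null[OF H 3] zero_le_power2[of Q] by linarith
    then show ?thesis by (rule sq)
  next
    case 4
    have "hform n (H *\<^sub>v ?e j) (H *\<^sub>v ?e j) = 1"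
      using SpD(2)[OF H, of "?e j" "?e j"] hform_unit_vec(1)[OF n 4(2), of "?e j"] ij by simp
    then have "(norm (H $$ (i, j)))\<^sup>2 \<le> 1 + 2 * (norm (H $$ (n - 1, j)) * norm (H $$ (n, j)))"
      using order.trans[OF head[OF 4(1), of "H *\<^sub>v ?e j"] norm_head_power2_le] ij n
        col[OF H _ ij(2)] by simp
    also have "norm (H $$ (n - 1, j)) * norm (H $$ (n, j)) \<le> 2 * Q\<^sup>2"
    proof -
      have "norm (H $$ (n - 1, j)) * norm (H $$ (n, j)) \<le> sqrt (2 * Q\<^sup>2) * sqrt (2 * Q\<^sup>2)"
        using rows[OF _ 4(2)] by (intro mult_mono real_le_rsqrt) auto
      then show ?thesis by simp
    qed
    finally have "(norm (H $$ (i, j)))\<^sup>2 \<le> 1 + 8 * Q\<^sup>2"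
      using zero_le_power2[of Q] by linarith
    then show ?thesis by (rule sq)
  qed
qed

section \<open>The iteration\<close>

lemma ratio_decay:
  fixes f :: "nat \<Rightarrow> real"
  assumes "\<And>k. f k \<ge> 0" "r < 1" "\<And>k. k \<ge> K \<Longrightarrow> f (Suc k) \<le> r * f k"
  shows "f \<longlonglongrightarrow> 0"
proof -
  have "summable f"
    by (rule summable_ratio_test[of r K]) (use assms in auto)
  then show ?thesis by (rule summable_LIMSEQ_zero)
qed

text \<open>Once \<open>t\<close> and hence \<open>sqrt (B C)\<close> tend to 0, Ptolemy makes
  \<open>A E\<close> asymptotically at most 1, and the next \<open>A\<close> and \<open>E\<close>
  are eventually at most \<open>R s\<close> and \<open>s / R\<close> for an \<open>s\<close>
  slightly above 1. Then \<open>B\<close> and \<open>C\<close> change by factors at most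
  \<open>M R s\<close> and \<open>M s / R\<close>, so after division by \<open>R ^ k\<close>,
  respectively multiplication by it, both contract with ratio \<open>M s\<close>.\<close>

lemma jorgensen_decay:
  fixes A B C E :: "nat \<Rightarrow> real"
  assumes nonneg: "\<And>k. A k \<ge> 0" "\<And>k. B k \<ge> 0" "\<And>k. C k \<ge> 0" "\<And>k. E k \<ge> 0"
    and M: "0 < M" "M < 1" and R: "R > 1"
    and B: "\<And>k. B (Suc k) \<le> M * (A k * B k)" and C: "\<And>k. C (Suc k) \<le> M * (C k * E k)"
    and A: "\<And>k. A (Suc k) \<le> 2 * sqrt ((A k * E k) * (B k * C k)) + R * (A k * E k) + (B k * C k) / R"
    and E: "\<And>k. E (Suc k) \<le> 2 * sqrt ((A k * E k) * (B k * C k)) + (A k * E k) / R + R * (B k * C k)"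
    and ptolemy: "\<And>k. sqrt (A k * E k) \<le> 1 + sqrt (B k * C k)"
    and start: "sqrt (A 0 * E 0) * sqrt (B 0 * C 0) < (1 - M) / M\<^sup>2"
  shows "(\<lambda>k. B k / R ^ k) \<longlonglongrightarrow> 0" "(\<lambda>k. R ^ k * C k) \<longlonglongrightarrow> 0"
    "\<exists>Q. \<forall>\<^sub>F k in sequentially. A k \<le> Q \<and> E k \<le> Q"
proof -
  define x where "x k = sqrt (A k * E k)" for k
  define y where "y k = sqrt (B k * C k)" for k
  define t where "t k = x k * y k" for k
  have x0: "x k \<ge> 0" and y0: "y k \<ge> 0" and x2: "A k * E k = (x k)\<^sup>2" and y2: "B k * C k = (y k)\<^sup>2" for k
    using nonneg by (auto simp: x_def y_def)
  have t0: "t k \<ge> 0" and t: "sqrt ((A k * E k) * (B k * C k)) = t k" for k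
    using x0 y0 by (auto simp: t_def x_def y_def real_sqrt_mult)
  have x_le: "x k \<le> 1 + y k" for k using ptolemy by (simp add: x_def y_def)
  have y_Suc: "y (Suc k) \<le> M * t k" for k
    unfolding y_def
  proof (rule real_le_lsqrt)
    have "B (Suc k) * C (Suc k) \<le> (M * (A k * B k)) * (M * (C k * E k))"
      using B C nonneg M by (intro mult_mono) auto
    also have "\<dots> = M\<^sup>2 * ((A k * E k) * (B k * C k))" by (simp add: power2_eq_square)
    also have "\<dots> = (M * t k)\<^sup>2" unfolding x2 y2 t_def by (simp add: power_mult_distrib)
    finally show "B (Suc k) * C (Suc k) \<le> (M * t k)\<^sup>2" .
  qed (use M t0 in auto)
  have t_Suc: "t (Suc k) \<le> (1 + M * t k) * (M * t k)" for k
    unfolding t_def[of "Suc k"] using x_le[of "Suc k"] y_Suc[of k] x0 y0 M t0[of k] by (intro mult_mono) auto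
  \<comment> \<open>The contraction factor at the start; \<open>start\<close> is equivalent to
    \<open>\<rho> < 1\<close>. It serves at every step because \<open>t\<close> never exceeds
    \<open>t 0\<close>.\<close>
  define \<rho> where "\<rho> = M * (1 + M * t 0)"
  have "t 0 * M\<^sup>2 < 1 - M"
    using start M by (simp add: t_def x_def y_def pos_less_divide_eq)
  then have \<rho>: "\<rho> < 1" by (simp add: \<rho>_def power2_eq_square algebra_simps)
  have t_decr: "t (Suc k) \<le> \<rho> * t k" if "t k \<le> t 0" for k
  proof -
    have "(1 + M * t k) * (M * t k) \<le> (1 + M * t 0) * (M * t k)"
      using that M t0 by (intro mult_right_mono) auto
    then show ?thesis using t_Suc[of k] by (simp add: \<rho>_def mult_ac)
  qed
  have t_le: "t k \<le> t 0" for k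
  proof (induction k)
    case (Suc k)
    have "\<rho> * t k \<le> 1 * t k" using \<rho> t0 by (intro mult_right_mono) auto
    then show ?case using t_decr[OF Suc] Suc by simp
  qed simp
  have t_lim: "t \<longlonglongrightarrow> 0"
    by (rule ratio_decay[OF t0 \<rho>]) (rule t_decr[OF t_le])
  have y_lim: "y \<longlonglongrightarrow> 0"
  proof (rule LIMSEQ_imp_Suc, rule tendsto_sandwich[of "\<lambda>_. 0" _ _ "\<lambda>k. M * t k"])
    show "(\<lambda>k. M * t k) \<longlonglongrightarrow> 0" using tendsto_mult_left[OF t_lim, of M] by simp
  qed (use y0 y_Suc in auto)
  \<comment> \<open>The midpoint of 1 and \<open>1 / M\<close>: room above the limit 1 of
    \<open>f\<close> and \<open>g\<close>, while \<open>M * s\<close> stays below 1.\<close>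
  define s where "s = (1 + 1 / M) / 2"
  have s: "s > 1" "M * s < 1" using M by (auto simp: s_def field_simps)
  \<comment> \<open>\<open>f\<close> and \<open>g\<close> bound the next \<open>A / R\<close> and
    \<open>R * E\<close>, with \<open>x\<close> replaced by \<open>1 + y\<close> through Ptolemy;
    both tend to 1.\<close>
  define f where "f k = (2 * t k + (y k)\<^sup>2 / R) / R + (1 + y k)\<^sup>2" for k
  define g where "g k = R * (2 * t k + R * (y k)\<^sup>2) + (1 + y k)\<^sup>2" for k
  have "f \<longlonglongrightarrow> (2 * 0 + 0\<^sup>2 / R) / R + (1 + 0)\<^sup>2"
    unfolding f_def by (intro tendsto_intros t_lim y_lim) (use R in auto)
  then have "\<forall>\<^sub>F k in sequentially. f k < s" using s by (intro order_tendstoD(2)[of f 1]) auto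
  moreover have "g \<longlonglongrightarrow> R * (2 * 0 + R * 0\<^sup>2) + (1 + 0)\<^sup>2"
    unfolding g_def by (intro tendsto_intros t_lim y_lim)
  then have "\<forall>\<^sub>F k in sequentially. g k < s" using s by (intro order_tendstoD(2)[of g 1]) auto
  ultimately have "\<forall>\<^sub>F k in sequentially. f k < s \<and> g k < s" by (rule eventually_conj)
  then obtain K where K: "\<And>k. k \<ge> K \<Longrightarrow> f k < s \<and> g k < s"
    by (auto simp: eventually_sequentially)
  have xy: "(x k)\<^sup>2 \<le> (1 + y k)\<^sup>2" for k using x_le x0 by (intro power_mono)
  have "A (Suc k) \<le> R * f k" for k
  proof -
    have "A (Suc k) \<le> 2 * t k + R * (x k)\<^sup>2 + (y k)\<^sup>2 / R" using A[of k] unfolding t unfolding x2 y2 .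
    also have "R * (x k)\<^sup>2 \<le> R * (1 + y k)\<^sup>2" using xy R by (intro mult_left_mono) auto
    also have "2 * t k + R * (1 + y k)\<^sup>2 + (y k)\<^sup>2 / R = R * f k" using R by (simp add: f_def field_simps)
    finally show ?thesis by simp
  qed
  moreover have "R * f k \<le> R * s" if "k \<ge> K" for k using K[OF that] R by (intro mult_left_mono) auto
  ultimately have "A (Suc k) \<le> R * s" if "k \<ge> K" for k using that order.trans by blast
  then have A_le: "A k \<le> R * s" if "k \<ge> Suc K" for k using that by (cases k) auto
  have "E (Suc k) \<le> g k / R" for k
  proof -
    have "E (Suc k) \<le> 2 * t k + (x k)\<^sup>2 / R + R * (y k)\<^sup>2" using E[of k] unfolding t unfolding x2 y2 .
    also have "(x k)\<^sup>2 / R \<le> (1 + y k)\<^sup>2 / R" using xy R by (intro divide_right_mono) auto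
    also have "2 * t k + (1 + y k)\<^sup>2 / R + R * (y k)\<^sup>2 = g k / R" using R by (simp add: g_def field_simps)
    finally show ?thesis by simp
  qed
  moreover have "g k / R \<le> s / R" if "k \<ge> K" for k using K[OF that] R by (intro divide_right_mono) auto
  ultimately have "E (Suc k) \<le> s / R" if "k \<ge> K" for k using that order.trans by blast
  then have E_le: "E k \<le> s / R" if "k \<ge> Suc K" for k using that by (cases k) auto
  show "(\<lambda>k. B k / R ^ k) \<longlonglongrightarrow> 0"
  proof (rule ratio_decay[OF _ s(2), of _ "Suc K"])
    fix k assume "k \<ge> Suc K"
    then have "B (Suc k) \<le> M * ((R * s) * B k)"
      using B[of k] A_le[of k] nonneg M
      by (meson mult_left_mono mult_right_mono order.strict_implies_order order.trans)
    then have "B (Suc k) / R ^ Suc k \<le> (M * ((R * s) * B k)) / R ^ Suc k"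
      using R by (intro divide_right_mono) auto
    also have "\<dots> = M * s * (B k / R ^ k)" using R by (simp add: field_simps)
    finally show "B (Suc k) / R ^ Suc k \<le> M * s * (B k / R ^ k)" .
  qed (use nonneg R in auto)
  show "(\<lambda>k. R ^ k * C k) \<longlonglongrightarrow> 0"
  proof (rule ratio_decay[OF _ s(2), of _ "Suc K"])
    fix k assume "k \<ge> Suc K"
    then have "C (Suc k) \<le> M * (C k * (s / R))"
      using C[of k] E_le[of k] nonneg M
      by (meson mult_left_mono order.strict_implies_order order.trans)
    then have "R ^ Suc k * C (Suc k) \<le> R ^ Suc k * (M * (C k * (s / R)))"
      using R by (intro mult_left_mono) auto
    also have "\<dots> = M * s * (R ^ k * C k)" using R by (simp add: field_simps)
    finally show "R ^ Suc k * C (Suc k) \<le> M * s * (R ^ k * C k)" .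
  qed (use nonneg R in auto)
  show "\<exists>Q. \<forall>\<^sub>F k in sequentially. A k \<le> Q \<and> E k \<le> Q"
    using A_le E_le unfolding eventually_sequentially
    by (intro exI[of _ "max (R * s) (s / R)"] exI[of _ "Suc K"]) (auto simp: le_max_iff_disj)
qed

section \<open>The diagonal normal form and the entries of its conjugates\<close>

locale loxo_diagonal =
  fixes n :: nat and l :: "nat \<Rightarrow> quat"
  assumes n: "n \<ge> 1" and norm_l: "\<And>i. i < n - 1 \<Longrightarrow> norm (l i) = 1" and norm_l_last: "norm (l (n - 1)) > 1"
begin

abbreviation "D \<equiv> loxo_diag n l"
abbreviation "lam \<equiv> l (n - 1)"
abbreviation "mu \<equiv> inverse (qcnj (l (n - 1)))"

lemma norm_mu: "norm mu = inverse (norm lam)"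
  by (simp add: norm_inverse)

lemma lam_nonzero: "lam \<noteq> 0"
  using norm_l_last by auto

lemma D_carrier: "D \<in> carrier_mat (n + 1) (n + 1)"
  by (simp add: loxo_diag_def)

lemma D_index:
  assumes "z \<in> carrier_vec (n + 1)" "i < n + 1"
  shows "(D *\<^sub>v z) $ i = (if i < n then l i else mu) * z $ i"
proof -
  have "(D *\<^sub>v z) $ i = (\<Sum>j<n + 1. D $$ (i, j) * z $ j)"
    by (rule mult_mat_vec_index[OF D_carrier assms])
  also have "\<dots> = (\<Sum>j<n + 1. if j = i then (if i < n then l i else mu) * z $ i else 0)"
    using assms(2) by (intro sum.cong) (auto simp: loxo_diag_def mat_diag_def)
  also have "\<dots> = (if i < n then l i else mu) * z $ i"
    using assms(2) by (subst sum.delta) auto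
  finally show ?thesis .
qed

lemma D_index_simps:
  assumes "z \<in> carrier_vec (n + 1)"
  shows "(D *\<^sub>v z) $ (n - 1) = lam * z $ (n - 1)" "(D *\<^sub>v z) $ n = mu * z $ n"
    "k < n - 1 \<Longrightarrow> (D *\<^sub>v z) $ k = l k * z $ k"
  using D_index[OF assms, of n] D_index[OF assms, of "n - 1"] D_index[OF assms, of k] n by auto

lemma D_Sp: "D \<in> carrier (Sp n)"
proof -
  have nz: "(if i < n then l i else mu) \<noteq> 0" if "i < n + 1" for i
  proof -
    consider "i < n - 1" | "i = n - 1" | "i = n" using \<open>i < n + 1\<close> by linarith
    then show ?thesis using lam_nonzero norm_l[of i] n by cases auto
  qed
  let ?D' = "mat_diag (n + 1) (\<lambda>i. inverse (if i < n then l i else mu))"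
  have one: "mat_diag (n + 1) f = 1\<^sub>m (n + 1)" if "\<And>i. i < n + 1 \<Longrightarrow> f i = 1" for f :: "nat \<Rightarrow> quat"
    using that by (intro eq_matI) (auto simp: mat_diag_def)
  have "D * ?D' = 1\<^sub>m (n + 1)" "?D' * D = 1\<^sub>m (n + 1)"
    unfolding loxo_diag_def mat_diag_diag by (rule one; use nz in \<open>simp split del: if_split\<close>)+
  then have "invertible_mat D"
    using D_carrier unfolding invertible_mat_def inverts_mat_def
    by (intro conjI exI[of _ ?D']) (auto simp: carrier_matD(1)[OF mat_diag_dim])
  moreover have "hform n (D *\<^sub>v z) (D *\<^sub>v w) = hform n z w"
    if z: "z \<in> carrier_vec (n + 1)" and w: "w \<in> carrier_vec (n + 1)" for z w
  proof -
    have "(\<Sum>k<n - 1. qcnj ((D *\<^sub>v w) $ k) * (D *\<^sub>v z) $ k) = (\<Sum>k<n - 1. qcnj (w $ k) * z $ k)"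
    proof (intro sum.cong refl)
      fix k assume "k \<in> {..<n - 1}"
      then have k: "k < n - 1" by simp
      have "qcnj (l k) * l k = 1"
        using norm_l[OF k] by (simp add: qcnj_mult_self power2_norm_quat[symmetric])
      then have "qcnj (l k) * (l k * z $ k) = z $ k" by (simp flip: mult.assoc)
      then show "qcnj ((D *\<^sub>v w) $ k) * (D *\<^sub>v z) $ k = qcnj (w $ k) * z $ k"
        by (simp only: D_index_simps(3)[OF z k] D_index_simps(3)[OF w k] qcnj_algebra mult.assoc)
    qed
    moreover have "qcnj lam * (mu * a) = a" "inverse lam * (lam * a) = a" for a
      using lam_nonzero by (simp_all flip: mult.assoc)
    ultimately show ?thesis
      unfolding hform_def D_index_simps(1,2)[OF z] D_index_simps(1,2)[OF w]
      by (simp add: qcnj_inverse mult.assoc)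
  qed
  ultimately show ?thesis
    using D_carrier by (simp add: Sp_simps)
qed

definition dlt :: real where
  "dlt = Max (insert 0 ((\<lambda>i. norm (l i - 1)) ` {..<n - 1}))"

text \<open>The expression in \<open>M_inv\<close> for a given tuple \<open>l\<close>. Substituting
  the chosen tuple \<open>loxo_eigs\<close> gives back \<open>M_inv\<close> by unfolding.\<close>

definition M :: real where
  "M = 2 * dlt + norm (lam - 1) + norm (mu - 1)"

lemma dlt: "dlt \<ge> 0" "k < n - 1 \<Longrightarrow> norm (l k - 1) \<le> dlt"
  unfolding dlt_def by (auto intro!: Max_ge)

lemma M_pos: "M > 0"
proof -
  have "norm (lam - 1) > 0" using norm_l_last by auto
  then show ?thesis unfolding M_def using dlt norm_ge_zero[of "mu - 1"] by linarith
qed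

text \<open>Here \<open>M\<close> arises. As \<open>z\<close> is null, \<open>D z\<close> may be
  replaced by \<open>D z - z\<close>. Its head is scaled by at most \<open>dlt\<close>, and the
  squared head of a null vector is at most twice
  \<open>|z\<^sub>n\<^sub>-\<^sub>1| |z\<^sub>n|\<close>; the last two coordinates contribute
  \<open>|lam - 1|\<close> and \<open>|mu - 1|\<close>.\<close>

lemma D_self_bound:
  assumes z: "z \<in> V_zero n"
  shows "norm (hform n (D *\<^sub>v z) z) \<le> M * (norm (z $ (n - 1)) * norm (z $ n))"
proof -
  note zc = V_zeroD[OF z]
  have Dz: "D *\<^sub>v z \<in> carrier_vec (n + 1)" by (rule mult_mat_vec_carrier[OF D_carrier zc(1)])
  define y where "y = D *\<^sub>v z + rscale z (- 1)"
  have yi: "y $ k = (D *\<^sub>v z) $ k - z $ k" if "k < n + 1" for k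
    unfolding y_def using that zc Dz by simp
  have "hform n y z = hform n (D *\<^sub>v z) z"
    unfolding y_def using zc Dz by (simp add: hform_add_left hform_rscale_left)
  moreover have "norm (hform n y z) \<le> dlt * (norm_head n z * norm_head n z) +
      norm (y $ (n - 1)) * norm (z $ n) + norm (y $ n) * norm (z $ (n - 1))"
  proof (rule norm_hform_le[OF dlt(1)])
    fix k assume k: "k < n - 1"
    then have "y $ k = (l k - 1) * z $ k"
      using yi[of k] D_index_simps(3)[OF zc(1) k] by (simp add: left_diff_distrib)
    then show "norm (y $ k) \<le> dlt * norm (z $ k)"
      using dlt(2)[OF k] by (simp add: norm_mult mult_right_mono)
  qed
  moreover have "norm (y $ (n - 1)) = norm (lam - 1) * norm (z $ (n - 1))"
    using yi[of "n - 1"] D_index_simps(1)[OF zc(1)] by (simp add: left_diff_distrib flip: norm_mult)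
  moreover have "norm (y $ n) = norm (mu - 1) * norm (z $ n)"
    using yi[of n] D_index_simps(2)[OF zc(1)] by (simp add: left_diff_distrib flip: norm_mult)
  moreover have "dlt * (norm_head n z * norm_head n z) \<le> dlt * (2 * (norm (z $ (n - 1)) * norm (z $ n)))"
    using norm_head_power2_le[of n z] zc(3) dlt(1) by (intro mult_left_mono) (auto simp: power2_eq_square)
  ultimately show ?thesis
    unfolding M_def by (simp add: algebra_simps)
qed

lemma D_bound:
  assumes z: "z \<in> V_zero n" and w: "w \<in> V_zero n"
  shows "norm (hform n (D *\<^sub>v z) w) \<le>
    2 * sqrt ((norm (z $ (n - 1)) * norm (z $ n)) * (norm (w $ (n - 1)) * norm (w $ n))) +
    norm lam * (norm (z $ (n - 1)) * norm (w $ n)) + (norm (z $ n) * norm (w $ (n - 1))) / norm lam"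
proof -
  note zc = V_zeroD[OF z] and wc = V_zeroD[OF w]
  have "norm (hform n (D *\<^sub>v z) w) \<le> 1 * (norm_head n z * norm_head n w) +
      norm ((D *\<^sub>v z) $ (n - 1)) * norm (w $ n) + norm ((D *\<^sub>v z) $ n) * norm (w $ (n - 1))"
    by (rule norm_hform_le) (simp_all add: D_index_simps(3)[OF zc(1)] norm_mult norm_l)
  then show ?thesis
    using norm_head_mult_le[OF zc(3) wc(3)]
    unfolding D_index_simps(1,2)[OF zc(1)] norm_mult norm_mu
    by (simp add: divide_inverse mult_ac)
qed

text \<open>Each corner entry of \<open>H D H\<^sup>-\<^sup>1\<close> is a pairing of
  \<open>D z\<close> with \<open>w\<close>, where \<open>z\<close> and \<open>w\<close> are images
  of standard null vectors under the inverse of \<open>H\<close> and have last coordinates of norms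
  \<open>d, c\<close> or \<open>b, a\<close>. Off the diagonal \<open>z = w\<close>, so
  \<open>D_self_bound\<close> applies; on it only \<open>D_bound\<close> does.\<close>

lemma conj_entry_bounds:
  assumes H: "H \<in> carrier (Sp n)"
  defines "H' \<equiv> H * D * inv\<^bsub>Sp n\<^esub> H"
  defines "a \<equiv> norm (H $$ (n - 1, n - 1))" and "b \<equiv> norm (H $$ (n - 1, n))"
    and "c \<equiv> norm (H $$ (n, n - 1))" and "d \<equiv> norm (H $$ (n, n))"
  shows "norm (H' $$ (n - 1, n)) \<le> M * (a * b)" "norm (H' $$ (n, n - 1)) \<le> M * (c * d)"
    "norm (H' $$ (n - 1, n - 1)) \<le> 2 * sqrt ((a * d) * (b * c)) + norm lam * (a * d) + (b * c) / norm lam"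
    "norm (H' $$ (n, n)) \<le> 2 * sqrt ((a * d) * (b * c)) + (a * d) / norm lam + norm lam * (b * c)"
proof -
  let ?i = "inv\<^bsub>Sp n\<^esub> H" and ?u = "unit_vec (n + 1) (n - 1) :: quat vec" and ?v = "unit_vec (n + 1) n :: quat vec"
  have i: "?i \<in> carrier (Sp n)" by (rule Sp_inv_closed[OF H])
  have H': "H' \<in> carrier (Sp n)"
    unfolding H'_def by (intro Sp_mult_closed H D_Sp i)
  have idx: "n - 1 < n + 1" "n < n + 1" using n by auto
  have form: "hform n (H' *\<^sub>v z) w = hform n (D *\<^sub>v (?i *\<^sub>v z)) (?i *\<^sub>v w)"
    if "z \<in> carrier_vec (n + 1)" "w \<in> carrier_vec (n + 1)" for z w
  proof -
    note iz = Sp_vec_closed[OF i that(1)]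
    have "H' *\<^sub>v z = H *\<^sub>v (D *\<^sub>v (?i *\<^sub>v z))"
      unfolding H'_def using Sp_mult_vec[OF Sp_mult_closed[OF H D_Sp] i that(1)] Sp_mult_vec[OF H D_Sp iz] by simp
    then show ?thesis using hform_Sp_adjoint[OF H Sp_vec_closed[OF D_Sp iz] that(2)] by simp
  qed
  have p: "?i *\<^sub>v ?u \<in> V_zero n" and q: "?i *\<^sub>v ?v \<in> V_zero n"
    using Sp_V_zero[OF i] unit_vec_null[OF n] by auto
  have "(?i *\<^sub>v unit_vec (n + 1) j) $ k = ?i $$ (k, j)" if "j < n + 1" "k < n + 1" for j k
    using mat_mult_unit_vec[OF SpD(1)[OF i] that(1)] SpD(1)[OF i] that by simp
  then have co: "norm ((?i *\<^sub>v ?u) $ (n - 1)) = d" "norm ((?i *\<^sub>v ?u) $ n) = c"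
      "norm ((?i *\<^sub>v ?v) $ (n - 1)) = b" "norm ((?i *\<^sub>v ?v) $ n) = a"
    unfolding a_def b_def c_def d_def using idx norm_inv_entry[OF n H] swap_last_simps(1,2)[OF n] by metis+
  note entry = norm_entry_corner[OF n SpD(1)[OF H']]
  have "norm (H' $$ (n - 1, n)) = norm (hform n (D *\<^sub>v (?i *\<^sub>v ?v)) (?i *\<^sub>v ?v))"
    by (simp only: entry(1)[OF idx(2)] form unit_vec_carrier)
  then show "norm (H' $$ (n - 1, n)) \<le> M * (a * b)"
    using D_self_bound[OF q] unfolding co by (simp add: mult.commute)
  have "norm (H' $$ (n, n - 1)) = norm (hform n (D *\<^sub>v (?i *\<^sub>v ?u)) (?i *\<^sub>v ?u))"
    by (simp only: entry(2)[OF idx(1)] form unit_vec_carrier)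
  then show "norm (H' $$ (n, n - 1)) \<le> M * (c * d)"
    using D_self_bound[OF p] unfolding co by (simp add: mult.commute)
  have "norm (H' $$ (n - 1, n - 1)) = norm (hform n (D *\<^sub>v (?i *\<^sub>v ?u)) (?i *\<^sub>v ?v))"
    by (simp only: entry(1)[OF idx(1)] form unit_vec_carrier)
  then show "norm (H' $$ (n - 1, n - 1)) \<le> 2 * sqrt ((a * d) * (b * c)) + norm lam * (a * d) + (b * c) / norm lam"
    using D_bound[OF p q] unfolding co by (simp add: mult_ac)
  have "norm (H' $$ (n, n)) = norm (hform n (D *\<^sub>v (?i *\<^sub>v ?v)) (?i *\<^sub>v ?u))"
    by (simp only: entry(2)[OF idx(2)] form unit_vec_carrier)
  then show "norm (H' $$ (n, n)) \<le> 2 * sqrt ((a * d) * (b * c)) + (a * d) / norm lam + norm lam * (b * c)"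
    using D_bound[OF q p] unfolding co by (simp add: mult_ac)
qed

end

section \<open>Discreteness\<close>

lemma norm_quat_le_sum_abs: "norm x \<le> \<bar>qre x\<bar> + \<bar>qi x\<bar> + \<bar>qj x\<bar> + \<bar>qk x\<bar>"
proof -
  have "norm x = sqrt ((sqrt ((qre x)\<^sup>2 + (qi x)\<^sup>2))\<^sup>2 + (sqrt ((qj x)\<^sup>2 + (qk x)\<^sup>2))\<^sup>2)"
    by (simp add: norm_quat_def qnormsq_def)
  also have "\<dots> \<le> \<bar>sqrt ((qre x)\<^sup>2 + (qi x)\<^sup>2)\<bar> + \<bar>sqrt ((qj x)\<^sup>2 + (qk x)\<^sup>2)\<bar>"
    by (rule sqrt_sum_squares_le_sum_abs)
  also have "\<dots> \<le> (\<bar>qre x\<bar> + \<bar>qi x\<bar>) + (\<bar>qj x\<bar> + \<bar>qk x\<bar>)"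
    by (intro add_mono) (simp_all add: sqrt_sum_squares_le_sum_abs)
  finally show ?thesis by simp
qed

lemma abs_component_le_norm:
  "\<bar>qre x\<bar> \<le> norm x" "\<bar>qi x\<bar> \<le> norm x" "\<bar>qj x\<bar> \<le> norm x" "\<bar>qk x\<bar> \<le> norm x"
  unfolding norm_quat_def qnormsq_def by (rule real_le_rsqrt; simp)+

lemma floor_divide_eq_imp_close:
  assumes "\<lfloor>x / d\<rfloor> = \<lfloor>y / d\<rfloor>" "d > (0 :: real)"
  shows "\<bar>x - y\<bar> < d"
proof -
  have "\<bar>x / d - y / d\<bar> < 1" using assms(1) by linarith
  then show ?thesis using assms(2) by (simp add: abs_less_iff field_simps)
qed

lemma mult_mat_index:
  assumes "A \<in> carrier_mat N N" "B \<in> carrier_mat N N" "i < N" "j < N"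
  shows "(A * B) $$ (i, j) = (\<Sum>k<N. A $$ (i, k) * B $$ (k, j))"
  using assms by (auto simp: scalar_prod_def atLeast0LessThan intro!: sum.cong)

lemma mult_entries_bounded:
  fixes A B :: "quat mat"
  assumes "A \<in> carrier_mat N N" "B \<in> carrier_mat N N"
    and a: "\<And>i j. i < N \<Longrightarrow> j < N \<Longrightarrow> norm (A $$ (i, j)) \<le> a"
    and b: "\<And>i j. i < N \<Longrightarrow> j < N \<Longrightarrow> norm (B $$ (i, j)) \<le> b"
    and ij: "i < N" "j < N"
  shows "norm ((A * B) $$ (i, j)) \<le> real N * (a * b)"
proof -
  have "0 \<le> a" using a[OF ij] norm_ge_zero order.trans by blast
  have "norm ((A * B) $$ (i, j)) \<le> (\<Sum>k<N. norm (A $$ (i, k) * B $$ (k, j)))"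
    unfolding mult_mat_index[OF assms(1,2) ij] by (rule norm_sum)
  also have "\<dots> \<le> (\<Sum>k<N. a * b)"
    unfolding norm_mult using a b ij \<open>0 \<le> a\<close> by (intro sum_mono mult_mono) auto
  finally show ?thesis by simp
qed

text \<open>A pigeonhole argument: the bounded region is cut into finitely many cells. If
  \<open>A\<close> and \<open>B\<close> share a cell, \<open>A\<^sup>-\<^sup>1 B\<close> is so close
  to the identity that isolation of the identity gives \<open>A = B\<close>. Entries of the inverse
  obey the same bound by \<open>norm_inv_entry\<close>.\<close>

lemma discrete_bounded_finite:
  assumes n: "n \<ge> 1" and G: "subgroup G (Sp n)" and disc: "discrete_group G" and X: "X \<subseteq> G"
    and bnd: "\<And>A i j. A \<in> X \<Longrightarrow> i < n + 1 \<Longrightarrow> j < n + 1 \<Longrightarrow> norm (A $$ (i, j)) \<le> Q"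
  shows "finite X"
proof -
  have GS: "A \<in> carrier (Sp n)" if "A \<in> G" for A using subgroup.mem_carrier[OF G that] .
  have one: "1\<^sub>m (n + 1) \<in> G" using subgroup.one_closed[OF G] by (simp add: Sp_simps)
  obtain e where e: "e > 0" "\<And>B. B \<in> G \<Longrightarrow>
      (\<forall>i<n + 1. \<forall>j<n + 1. dist (B $$ (i, j)) (1\<^sub>m (n + 1) $$ (i, j)) < e) \<Longrightarrow> B = 1\<^sub>m (n + 1)"
    using bspec[OF disc[unfolded discrete_group_def] one] unfolding index_one_mat(2,3) by blast
  define q where "q = max Q 1"
  have q: "q > 0" "\<And>A i j. A \<in> X \<Longrightarrow> i < n + 1 \<Longrightarrow> j < n + 1 \<Longrightarrow> norm (A $$ (i, j)) \<le> q"
    using bnd by (auto simp: q_def le_max_iff_disj)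
  \<comment> \<open>Matrices in one cell differ by at most \<open>4 * d\<close> per entry;
    multiplication by the inverse costs a factor \<open>(n + 1) * q\<close>, so the product differs
    from the identity by at most \<open>e / 2\<close>.\<close>
  define d where "d = e / (8 * (real (n + 1) * q))"
  have d: "d > 0" using e q by (simp add: d_def)
  define fl where "fl z = (\<lfloor>qre z / d\<rfloor>, \<lfloor>qi z / d\<rfloor>, \<lfloor>qj z / d\<rfloor>, \<lfloor>qk z / d\<rfloor>)" for z
  define cell where "cell A = restrict (\<lambda>ij. fl (A $$ ij)) ({..<n + 1} \<times> {..<n + 1})" for A :: "quat mat"
  have "inj_on cell X"
  proof (rule inj_onI)
    fix A B assume AB: "A \<in> X" "B \<in> X" and cell: "cell A = cell B"
    have AS: "A \<in> carrier (Sp n)" and BS: "B \<in> carrier (Sp n)" using AB X GS by auto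
    let ?i = "inv\<^bsub>Sp n\<^esub> A"
    note Am = SpD(1)[OF AS] and Bm = SpD(1)[OF BS] and im = SpD(1)[OF Sp_inv_closed[OF AS]]
    have near: "norm (B $$ (i, j) - A $$ (i, j)) \<le> 4 * d" if "i < n + 1" "j < n + 1" for i j
    proof -
      have "fl (B $$ (i, j)) = fl (A $$ (i, j))"
        using fun_cong[OF cell, of "(i, j)"] that by (simp add: cell_def)
      then have "\<bar>qre (B $$ (i, j)) - qre (A $$ (i, j))\<bar> < d" "\<bar>qi (B $$ (i, j)) - qi (A $$ (i, j))\<bar> < d"
        "\<bar>qj (B $$ (i, j)) - qj (A $$ (i, j))\<bar> < d" "\<bar>qk (B $$ (i, j)) - qk (A $$ (i, j))\<bar> < d"
        using d by (auto simp: fl_def intro: floor_divide_eq_imp_close)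
      then show ?thesis
        using norm_quat_le_sum_abs[of "B $$ (i, j) - A $$ (i, j)"] by simp
    qed
    have "?i * B = 1\<^sub>m (n + 1)"
    proof (rule e(2))
      have "?i \<in> G" using subgroup.m_inv_closed[OF G] AB X by auto
      then show "?i * B \<in> G"
        using subgroup.m_closed[OF G, of ?i B] AB X by (auto simp: Sp_simps)
      show "\<forall>i<n + 1. \<forall>j<n + 1. dist ((?i * B) $$ (i, j)) (1\<^sub>m (n + 1) $$ (i, j)) < e"
      proof (intro allI impI)
        fix i j assume ij: "i < n + 1" "j < n + 1"
        have "(?i * B) $$ (i, j) - (?i * A) $$ (i, j) =
            (\<Sum>k<n + 1. ?i $$ (i, k) * (B $$ (k, j) - A $$ (k, j)))"
          unfolding mult_mat_index[OF im Bm ij] mult_mat_index[OF im Am ij]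
          by (simp only: right_diff_distrib sum_subtractf)
        then have "dist ((?i * B) $$ (i, j)) (1\<^sub>m (n + 1) $$ (i, j)) \<le>
            (\<Sum>k<n + 1. norm (?i $$ (i, k) * (B $$ (k, j) - A $$ (k, j))))"
          unfolding dist_norm Sp_mult_inv(2)[OF AS] by (simp only: norm_sum)
        also have "\<dots> \<le> (\<Sum>k<n + 1. q * (4 * d))"
        proof (rule sum_mono)
          fix k assume "k \<in> {..<n + 1}"
          then have k: "k < n + 1" by simp
          have "norm (?i $$ (i, k)) \<le> q"
            unfolding norm_inv_entry[OF n AS ij(1) k] by (rule q(2)[OF AB(1)]) (rule swap_last_simps(4)[OF n])+
          then show "norm (?i $$ (i, k) * (B $$ (k, j) - A $$ (k, j))) \<le> q * (4 * d)"
            unfolding norm_mult using near[OF k ij(2)] q(1) by (intro mult_mono) auto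
        qed
        also have "\<dots> = 4 * d * (real (n + 1) * q)" by simp
        also have "\<dots> = e / 2"
        proof -
          have "4 * (e / (8 * c)) * c = e / 2" if "c \<noteq> 0" for c :: real using that by simp
          moreover have "real (n + 1) * q \<noteq> 0" using q(1) by simp
          ultimately show ?thesis unfolding d_def by blast
        qed
        also have "\<dots> < e" using e(1) by simp
        finally show "dist ((?i * B) $$ (i, j)) (1\<^sub>m (n + 1) $$ (i, j)) < e" .
      qed
    qed
    then have "A * (?i * B) = A" using Am by simp
    moreover have "A * (?i * B) = B"
      using assoc_mult_mat[OF Am im Bm] Sp_mult_inv(1)[OF AS] Bm by simp
    ultimately show "A = B" by simp
  qed
  moreover have "finite (cell ` X)"
  proof (rule finite_subset)
    define N where "N = \<lceil>q / d\<rceil> + 1"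
    let ?T = "{- N..N} \<times> {- N..N} \<times> {- N..N} \<times> {- N..N}"
    have fl: "\<lfloor>t / d\<rfloor> \<in> {- N..N}" if "\<bar>t\<bar> \<le> q" for t
    proof -
      have "\<bar>t / d\<bar> \<le> q / d" using that d by (simp add: divide_right_mono)
      then show ?thesis unfolding N_def by (simp; linarith)
    qed
    show "cell ` X \<subseteq> PiE ({..<n + 1} \<times> {..<n + 1}) (\<lambda>_. ?T)"
    proof (rule image_subsetI, rule PiE_I)
      fix A ij assume A: "A \<in> X" and ij: "ij \<in> {..<n + 1} \<times> {..<n + 1}"
      then have "norm (A $$ ij) \<le> q" using q(2)[of A "fst ij" "snd ij"] by auto
      then have "fl (A $$ ij) \<in> ?T"
        using abs_component_le_norm[of "A $$ ij"] unfolding fl_def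
        by (intro SigmaI fl) (auto intro: order.trans)
      then show "cell A ij \<in> ?T" using ij by (simp add: cell_def)
    qed (auto simp: cell_def)
    show "finite (PiE ({..<n + 1} \<times> {..<n + 1}) (\<lambda>_. ?T))"
      by (intro finite_PiE) auto
  qed
  ultimately show ?thesis using finite_imageD by blast
qed

section \<open>Fixed points of the iterates\<close>

text \<open>Orthogonal null vectors are proportional, so a vanishing off-diagonal corner entry is a
  fixed point.\<close>

lemma fixes_unit_point:
  assumes n: "n \<ge> 1" and H: "H \<in> carrier (Sp n)" and i: "i = n - 1 \<or> i = n"
    and zero: "hform n (H *\<^sub>v unit_vec (n + 1) i) (unit_vec (n + 1) i) = 0"
  shows "act H (proj_pt (unit_vec (n + 1) i)) = proj_pt (unit_vec (n + 1) i)"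
proof -
  have e: "unit_vec (n + 1) i \<in> V_zero n" by (rule unit_vec_null[OF n i])
  note He = V_zeroD[OF Sp_V_zero[OF H e]]
  obtain c where c: "H *\<^sub>v unit_vec (n + 1) i = rscale (unit_vec (n + 1) i) c"
    using nonpos_orthogonal_null[OF n e He(1) zero] He(3) by auto
  then have "c \<noteq> 0" using He(2) rscale_0[OF V_zeroD(1)[OF e]] by auto
  then show ?thesis
    using act_null[OF H e] c proj_pt_rscale by metis
qed

context loxo_diagonal
begin

abbreviation "S \<equiv> {proj_pt (unit_vec (n + 1) (n - 1)), proj_pt (unit_vec (n + 1) n)}"

lemma S_boundary: "S \<subseteq> hyp_boundary n"
  using unit_vec_null[OF n] by (auto simp: hyp_boundary_def)

lemma D_unit: "D *\<^sub>v unit_vec (n + 1) (n - 1) = rscale (unit_vec (n + 1) (n - 1)) lam"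
    "D *\<^sub>v unit_vec (n + 1) n = rscale (unit_vec (n + 1) n) mu"
proof -
  have "D *\<^sub>v unit_vec (n + 1) j = rscale (unit_vec (n + 1) j) (if j < n then l j else mu)" if "j < n + 1" for j
  proof (rule eq_vecI)
    fix i assume "i < dim_vec (rscale (unit_vec (n + 1) j) (if j < n then l j else mu))"
    then have "i < n + 1" by simp
    then show "(D *\<^sub>v unit_vec (n + 1) j) $ i = rscale (unit_vec (n + 1) j) (if j < n then l j else mu) $ i"
      using D_index[OF unit_vec_carrier, of i j] that by (simp add: unit_vec_def)
  qed (use D_carrier in simp)
  from this[of "n - 1"] this[of n] n
  show "D *\<^sub>v unit_vec (n + 1) (n - 1) = rscale (unit_vec (n + 1) (n - 1)) lam"
    "D *\<^sub>v unit_vec (n + 1) n = rscale (unit_vec (n + 1) n) mu" by auto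
qed

lemma D_fixes_S:
  assumes "p \<in> S"
  shows "act D p = p"
proof -
  have "mu \<noteq> 0" using lam_nonzero by simp
  then show ?thesis
    using assms act_null[OF D_Sp unit_vec_null[OF n]] D_unit lam_nonzero proj_pt_rscale by auto
qed

text \<open>If \<open>z\<close> is a lift of a fixed point, the last two coordinates are scaled in
  norm by \<open>|lam|\<^sup>2\<close> and its reciprocal but must share one factor
  \<open>|c|\<close>. So one of them vanishes, and \<open>z\<close> is orthogonal, hence
  proportional, to a standard null vector.\<close>

lemma D_square_fixed:
  assumes p: "p \<in> hyp_boundary n" and fixed: "act D (act D p) = p"
  shows "p \<in> S"
proof -
  obtain z where z: "z \<in> V_zero n" "p = proj_pt z" using p by (auto simp: hyp_boundary_def)
  note zc = V_zeroD[OF z(1)]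
  have Dz: "D *\<^sub>v z \<in> V_zero n" by (rule Sp_V_zero[OF D_Sp z(1)])
  have "proj_pt z = proj_pt (D *\<^sub>v (D *\<^sub>v z))"
    using fixed act_null[OF D_Sp z(1)] act_null[OF D_Sp Dz] z(2) by simp
  then obtain c where c: "D *\<^sub>v (D *\<^sub>v z) = rscale z c"
    using proj_pt_eqD by metis
  have "lam * (lam * z $ (n - 1)) = z $ (n - 1) * c" "mu * (mu * z $ n) = z $ n * c"
    using c D_index_simps(1,2)[OF V_zeroD(1)[OF Dz]] D_index_simps(1,2)[OF zc(1)] zc(1) n by auto
  then have "norm lam * (norm lam * norm (z $ (n - 1))) = norm (z $ (n - 1)) * norm c"
    "norm mu * (norm mu * norm (z $ n)) = norm (z $ n) * norm c"
    by (simp_all only: norm_mult[symmetric])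
  then have c1: "z $ (n - 1) = 0 \<or> norm lam * norm lam = norm c"
    and c2: "z $ n = 0 \<or> inverse (norm lam) * inverse (norm lam) = norm c"
    unfolding norm_mu by (auto simp: mult.assoc[symmetric] mult.commute[of _ "norm c"])
  have "norm lam * norm lam > 1" "inverse (norm lam) * inverse (norm lam) < 1"
    using norm_l_last by (simp_all add: less_1_mult inverse_less_1_iff mult_le_one flip: inverse_mult_distrib)
  then have "z $ (n - 1) = 0 \<or> z $ n = 0" using c1 c2 by linarith
  then have "\<exists>j. (j = n - 1 \<or> j = n) \<and> hform n z (unit_vec (n + 1) j) = 0"
    using hform_unit_vec(2,3)[OF n, of z] by (metis neg_0_equal_iff_equal)
  then obtain j where j: "j = n - 1 \<or> j = n" "hform n z (unit_vec (n + 1) j) = 0" by blast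
  then obtain t where t: "z = rscale (unit_vec (n + 1) j) t"
    using nonpos_orthogonal_null[OF n unit_vec_null[OF n j(1)] zc(1)] zc(3) by auto
  then have "t \<noteq> 0" using zc(2) rscale_0[OF unit_vec_carrier, of "n + 1" j] by auto
  then show ?thesis using z(2) t j(1) by (auto simp: proj_pt_rscale)
qed

text \<open>The conjugate may exchange the two points of \<open>S\<close>, but its square fixes
  both. Hence \<open>D\<^sup>2\<close> fixes their images under the inverse of \<open>H\<close>, and
  these lie in \<open>S\<close> by \<open>D_square_fixed\<close>.\<close>

lemma stabilizer_descent:
  assumes H: "H \<in> carrier (Sp n)" and stab: "act (H * D * inv\<^bsub>Sp n\<^esub> H) ` S \<subseteq> S"
  shows "act H ` S \<subseteq> S"
proof -
  let ?i = "inv\<^bsub>Sp n\<^esub> H" and ?H = "H * D * inv\<^bsub>Sp n\<^esub> H"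
  have i: "?i \<in> carrier (Sp n)" by (rule Sp_inv_closed[OF H])
  have HD: "H * D \<in> carrier (Sp n)" by (rule Sp_mult_closed[OF H D_Sp])
  have H': "?H \<in> carrier (Sp n)" by (rule Sp_mult_closed[OF HD i])
  have inj: "p = q" if "A \<in> carrier (Sp n)" "p \<in> S" "q \<in> S" "act A p = act A q" for A p q
  proof -
    have "p = act (inv\<^bsub>Sp n\<^esub> A) (act A p)"
      by (rule act_inv(2)[OF that(1) subsetD[OF S_boundary that(2)], symmetric])
    also have "\<dots> = q"
      unfolding that(4) by (rule act_inv(2)[OF that(1) subsetD[OF S_boundary that(3)]])
    finally show ?thesis .
  qed
  have perm: "act A ` S = S" if "A \<in> carrier (Sp n)" "act A ` S \<subseteq> S" for A
    by (rule endo_inj_surj[OF _ that(2)]) (simp, rule inj_onI, rule inj[OF that(1)])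
  have act_H': "act ?H p = act H (act D (act ?i p))" if "p \<in> hyp_boundary n" for p
    using act_mult[OF HD i that] act_mult[OF H D_Sp act_boundary[OF i that]] by simp
  have sq: "act ?H (act ?H p) = p" if p: "p \<in> S" for p
  proof -
    have q: "act ?H p \<in> S" "act ?H (act ?H p) \<in> S" using p stab by blast+
    have three: "x = z" if "x \<in> {a, b}" "y \<in> {a, b}" "z \<in> {a, b}" "y \<noteq> z" "x \<noteq> y"
      for a b x y z :: "quat vec set"
      using that by auto
    show ?thesis
    proof (cases "act ?H p = p")
      case True
      then show ?thesis by (simp only:)
    next
      case False
      then have "act ?H (act ?H p) \<noteq> act ?H p"
        using inj[OF H' q(1) p] by (rule contrapos_nn)
      then show ?thesis by (rule three[OF q(2) q(1) p False])
    qed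
  qed
  have "act ?i p \<in> S" if p: "p \<in> S" for p
  proof (rule D_square_fixed)
    have pb: "p \<in> hyp_boundary n" using p S_boundary by blast
    show ip: "act ?i p \<in> hyp_boundary n" by (rule act_boundary[OF i pb])
    have "act ?i p = act ?i (act ?H (act ?H p))" using sq[OF p] by simp
    also have "\<dots> = act D (act ?i (act ?H p))"
      unfolding act_H'[OF act_boundary[OF H' pb]]
      by (rule act_inv(2)[OF H act_boundary[OF D_Sp act_boundary[OF i act_boundary[OF H' pb]]]])
    also have "act ?i (act ?H p) = act D (act ?i p)"
      unfolding act_H'[OF pb] by (rule act_inv(2)[OF H act_boundary[OF D_Sp ip]])
    finally show "act D (act D (act ?i p)) = act ?i p" by simp
  qed
  then have "act ?i ` S = S" by (intro perm[OF i]) auto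
  then have iS: "p \<in> act ?i ` S" if "p \<in> S" for p using that by blast
  show ?thesis
  proof (rule image_subsetI)
    fix p assume "p \<in> S"
    then obtain q where q: "q \<in> S" "p = act ?i q" using iS by blast
    then have "q \<in> hyp_boundary n" using S_boundary by blast
    then show "act H p \<in> S" using act_inv(1)[OF H, of q] q by simp
  qed
qed

section \<open>Rescaling the iterates by powers of \<open>D\<close>\<close>

lemma D_pow_Sp: "D [^]\<^bsub>Sp n\<^esub> (j::nat) \<in> carrier (Sp n)"
  by (rule monoid.nat_pow_closed[OF group.is_monoid[OF group_Sp] D_Sp])

lemma D_pow_unit:
  "(D [^]\<^bsub>Sp n\<^esub> j) *\<^sub>v unit_vec (n + 1) (n - 1) = rscale (unit_vec (n + 1) (n - 1)) (lam ^ j)"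
  "(D [^]\<^bsub>Sp n\<^esub> j) *\<^sub>v unit_vec (n + 1) n = rscale (unit_vec (n + 1) n) (mu ^ j)"
proof -
  have "(D [^]\<^bsub>Sp n\<^esub> j) *\<^sub>v e = rscale e (c ^ j)"
    if e: "e \<in> carrier_vec (n + 1)" "D *\<^sub>v e = rscale e c" for e c
  proof (induction j)
    case 0
    then show ?case using one_mult_mat_vec[OF e(1)] by (simp add: Sp_simps)
  next
    case (Suc j)
    have "(D [^]\<^bsub>Sp n\<^esub> Suc j) *\<^sub>v e = (D [^]\<^bsub>Sp n\<^esub> j) *\<^sub>v (D *\<^sub>v e)"
      using Sp_mult_vec[OF D_pow_Sp[of j] D_Sp e(1)] by (simp add: Sp_simps)
    also have "\<dots> = rscale e (c ^ Suc j)"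
      using e(2) Suc mult_mat_vec_rscale[OF SpD(1)[OF D_pow_Sp[of j]] e(1)]
      by (simp add: rscale_rscale power_commutes)
    finally show ?case .
  qed
  then show "(D [^]\<^bsub>Sp n\<^esub> j) *\<^sub>v unit_vec (n + 1) (n - 1) = rscale (unit_vec (n + 1) (n - 1)) (lam ^ j)"
    "(D [^]\<^bsub>Sp n\<^esub> j) *\<^sub>v unit_vec (n + 1) n = rscale (unit_vec (n + 1) n) (mu ^ j)"
    using D_unit by auto
qed

text \<open>An off-diagonal corner entry pairs the image of a null vector with the same null vector,
  so its scaling factor enters twice; on the diagonal the two factors have reciprocal norms.\<close>

lemma conj_pow_corner_entries:
  fixes j :: nat
  assumes H: "H \<in> carrier (Sp n)"
  defines "F \<equiv> inv\<^bsub>Sp n\<^esub> (D [^]\<^bsub>Sp n\<^esub> j) * H * (D [^]\<^bsub>Sp n\<^esub> j)"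
  shows "norm (F $$ (n - 1, n - 1)) = norm (H $$ (n - 1, n - 1))"
    "norm (F $$ (n - 1, n)) = norm (H $$ (n - 1, n)) / norm lam ^ (2 * j)"
    "norm (F $$ (n, n - 1)) = norm lam ^ (2 * j) * norm (H $$ (n, n - 1))"
    "norm (F $$ (n, n)) = norm (H $$ (n, n))"
proof -
  let ?P = "D [^]\<^bsub>Sp n\<^esub> j" and ?u = "unit_vec (n + 1) (n - 1) :: quat vec" and ?v = "unit_vec (n + 1) n :: quat vec"
  have P: "?P \<in> carrier (Sp n)" by (rule D_pow_Sp)
  note iP = Sp_inv_closed[OF P]
  have F: "F \<in> carrier (Sp n)" unfolding F_def by (intro Sp_mult_closed iP P H)
  have form: "hform n (F *\<^sub>v z) w = hform n (H *\<^sub>v (?P *\<^sub>v z)) (?P *\<^sub>v w)"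
    if "z \<in> carrier_vec (n + 1)" "w \<in> carrier_vec (n + 1)" for z w
  proof -
    note Pz = Sp_vec_closed[OF P that(1)]
    note HPz = Sp_vec_closed[OF H Pz]
    have "F *\<^sub>v z = inv\<^bsub>Sp n\<^esub> ?P *\<^sub>v (H *\<^sub>v (?P *\<^sub>v z))"
      unfolding F_def using Sp_mult_vec[OF Sp_mult_closed[OF iP H] P that(1)] Sp_mult_vec[OF iP H Pz] by simp
    then show ?thesis
      using hform_Sp_adjoint[OF iP HPz that(2)] group.inv_inv[OF group_Sp P] by simp
  qed
  have scal: "norm (hform n (H *\<^sub>v rscale z s) (rscale w t)) = norm s * norm t * norm (hform n (H *\<^sub>v z) w)"
    if "z \<in> carrier_vec (n + 1)" "w \<in> carrier_vec (n + 1)" for z w s t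
    using that mult_mat_vec_rscale[OF SpD(1)[OF H] that(1)] Sp_vec_closed[OF H that(1)]
    by (simp add: hform_rscale_left hform_rscale_right norm_mult)
  have idx: "n - 1 < n + 1" "n < n + 1" using n by auto
  note eF = norm_entry_corner[OF n SpD(1)[OF F]] and eH = norm_entry_corner[OF n SpD(1)[OF H]]
  have nz: "norm lam \<noteq> 0" using lam_nonzero by simp
  have cancel: "norm (lam ^ j) * norm (mu ^ j) = 1" "norm (mu ^ j) * norm (lam ^ j) = 1"
    using nz unfolding norm_power norm_mu by (simp_all flip: power_mult_distrib)
  note eq = form[OF unit_vec_carrier unit_vec_carrier] D_pow_unit scal[OF unit_vec_carrier unit_vec_carrier] cancel
  show "norm (F $$ (n - 1, n - 1)) = norm (H $$ (n - 1, n - 1))"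
    unfolding eF(1)[OF idx(1)] eH(1)[OF idx(1)] eq by simp
  show "norm (F $$ (n, n)) = norm (H $$ (n, n))"
    unfolding eF(2)[OF idx(2)] eH(2)[OF idx(2)] eq by simp
  show "norm (F $$ (n - 1, n)) = norm (H $$ (n - 1, n)) / norm lam ^ (2 * j)"
    unfolding eF(1)[OF idx(2)] eH(1)[OF idx(2)] eq norm_power norm_mu
    using nz by (simp add: field_simps power_mult power2_eq_square flip: power_mult_distrib power_inverse)
  show "norm (F $$ (n, n - 1)) = norm lam ^ (2 * j) * norm (H $$ (n, n - 1))"
    unfolding eF(2)[OF idx(1)] eH(2)[OF idx(1)] eq norm_power
    by (simp add: power_mult power2_eq_square flip: power_mult_distrib)
qed

text \<open>Conjugation by \<open>D\<^sup>j\<close> supplies exactly the factors in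
  \<open>jorgensen_decay\<close> at \<open>k = 2 * j\<close>. It leaves the norms of the diagonal
  corner entries unchanged, so the whole corner is eventually bounded and
  \<open>entries_bounded\<close> covers the rest.\<close>

lemma iterates_conj_bounded:
  assumes Hs: "\<And>k. Hs k \<in> carrier (Sp n)" "\<And>k. Hs (Suc k) = Hs k * D * inv\<^bsub>Sp n\<^esub> (Hs k)"
    and M: "M < 1"
    and start: "sqrt (norm (Hs 0 $$ (n - 1, n - 1)) * norm (Hs 0 $$ (n, n))) *
      sqrt (norm (Hs 0 $$ (n - 1, n)) * norm (Hs 0 $$ (n, n - 1))) < (1 - M) / M\<^sup>2"
  defines "F \<equiv> \<lambda>j. inv\<^bsub>Sp n\<^esub> (D [^]\<^bsub>Sp n\<^esub> j) * Hs (2 * j) * (D [^]\<^bsub>Sp n\<^esub> j)"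
  shows "\<exists>Q J. \<forall>j\<ge>J. \<forall>i<n + 1. \<forall>k<n + 1. norm (F j $$ (i, k)) \<le> Q"
    "(\<lambda>j. norm (F j $$ (n - 1, n)) + norm (F j $$ (n, n - 1))) \<longlonglongrightarrow> 0"
proof -
  note bounds = conj_entry_bounds[OF Hs(1), folded Hs(2)]
  have decay: "(\<lambda>k. norm (Hs k $$ (n - 1, n)) / norm lam ^ k) \<longlonglongrightarrow> 0"
    "(\<lambda>k. norm lam ^ k * norm (Hs k $$ (n, n - 1))) \<longlonglongrightarrow> 0"
    "\<exists>Q. \<forall>\<^sub>F k in sequentially. norm (Hs k $$ (n - 1, n - 1)) \<le> Q \<and> norm (Hs k $$ (n, n)) \<le> Q"
    by (rule jorgensen_decay[OF norm_ge_zero norm_ge_zero norm_ge_zero norm_ge_zero M_pos M norm_l_last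
          bounds(1) bounds(2) bounds(3) bounds(4) sqrt_diagonal_le[OF n Hs(1)] start])+
  have F: "F j \<in> carrier (Sp n)" for j
    unfolding F_def by (intro Sp_mult_closed Sp_inv_closed D_pow_Sp Hs(1))
  have co: "norm (F j $$ (n - 1, n - 1)) = norm (Hs (2 * j) $$ (n - 1, n - 1))"
    "norm (F j $$ (n - 1, n)) = norm (Hs (2 * j) $$ (n - 1, n)) / norm lam ^ (2 * j)"
    "norm (F j $$ (n, n - 1)) = norm lam ^ (2 * j) * norm (Hs (2 * j) $$ (n, n - 1))"
    "norm (F j $$ (n, n)) = norm (Hs (2 * j) $$ (n, n))" for j
    unfolding F_def by (rule conj_pow_corner_entries[OF Hs(1)])+
  have sub: "filterlim (\<lambda>j::nat. 2 * j) sequentially sequentially"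
    by (intro filterlim_subseq strict_monoI) auto
  have b: "(\<lambda>j. norm (F j $$ (n - 1, n))) \<longlonglongrightarrow> 0" and c: "(\<lambda>j. norm (F j $$ (n, n - 1))) \<longlonglongrightarrow> 0"
    unfolding co using filterlim_compose[OF decay(1) sub] filterlim_compose[OF decay(2) sub] by simp_all
  from tendsto_add[OF b c]
  show "(\<lambda>j. norm (F j $$ (n - 1, n)) + norm (F j $$ (n, n - 1))) \<longlonglongrightarrow> 0" by simp
  obtain Q where Q: "\<forall>\<^sub>F k in sequentially. norm (Hs k $$ (n - 1, n - 1)) \<le> Q \<and> norm (Hs k $$ (n, n)) \<le> Q"
    using decay(3) by blast
  have "\<forall>\<^sub>F j in sequentially. norm (Hs (2 * j) $$ (n - 1, n - 1)) \<le> Q \<and> norm (Hs (2 * j) $$ (n, n)) \<le> Q"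
    using eventually_compose_filterlim[OF Q sub] .
  moreover have "\<forall>\<^sub>F j in sequentially. norm (F j $$ (n - 1, n)) < 1"
    using order_tendstoD(2)[OF b] by simp
  moreover have "\<forall>\<^sub>F j in sequentially. norm (F j $$ (n, n - 1)) < 1"
    using order_tendstoD(2)[OF c] by simp
  ultimately have "\<forall>\<^sub>F j in sequentially. \<forall>i\<in>{n - 1, n}. \<forall>k\<in>{n - 1, n}. norm (F j $$ (i, k)) \<le> max Q 1"
    by eventually_elim (auto simp: co(1,4) le_max_iff_disj simp del: One_nat_def)
  then obtain J where "\<And>j. j \<ge> J \<Longrightarrow> \<forall>i\<in>{n - 1, n}. \<forall>k\<in>{n - 1, n}. norm (F j $$ (i, k)) \<le> max Q 1"
    by (auto simp: eventually_sequentially)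
  then have "\<forall>j\<ge>J. \<forall>i<n + 1. \<forall>k<n + 1. norm (F j $$ (i, k)) \<le> 1 + 8 * (max Q 1)\<^sup>2"
    by (intro allI impI entries_bounded[OF n F]) auto
  then show "\<exists>Q J. \<forall>j\<ge>J. \<forall>i<n + 1. \<forall>k<n + 1. norm (F j $$ (i, k)) \<le> Q" by blast
qed

end

section \<open>Cross-ratios and elementary groups\<close>

text \<open>The lifts are normalised, and \<open>h\<close> preserves the form, so both denominators
  are 1. What remains are norms of corner entries of \<open>h\<close> in a frame containing
  \<open>x\<close> and \<open>y\<close>.\<close>

lemma abs_cross_ratio_null_pair:
  assumes n: "n \<ge> 1" and h: "h \<in> carrier (Sp n)" and x: "x \<in> V_zero n" and y: "y \<in> V_zero n"
    and xy: "norm (hform n x y) = 1"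
  shows "abs_cross_ratio n (act h (proj_pt x)) (proj_pt x) (proj_pt y) (act h (proj_pt y)) =
      norm (hform n (h *\<^sub>v x) y) * norm (hform n (h *\<^sub>v y) x)"
    "abs_cross_ratio n (act h (proj_pt x)) (proj_pt y) (proj_pt x) (act h (proj_pt y)) =
      norm (hform n (h *\<^sub>v y) y) * norm (hform n (h *\<^sub>v x) x)"
proof -
  note xc = V_zeroD(1)[OF x] and yc = V_zeroD(1)[OF y]
  note hx = Sp_vec_closed[OF h xc] and hy = Sp_vec_closed[OF h yc]
  have yx: "norm (hform n y x) = 1" using xy norm_hform_commute by metis
  have hyx: "norm (hform n (h *\<^sub>v y) (h *\<^sub>v x)) = 1"
    using yx SpD(2)[OF h yc xc] by simp
  show "abs_cross_ratio n (act h (proj_pt x)) (proj_pt x) (proj_pt y) (act h (proj_pt y)) =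
      norm (hform n (h *\<^sub>v x) y) * norm (hform n (h *\<^sub>v y) x)"
    unfolding act_null[OF h x] act_null[OF h y] abs_cross_ratio_lifts[OF hx xc yc hy n] yx hyx
    by (simp add: norm_hform_commute[of n y])
  show "abs_cross_ratio n (act h (proj_pt x)) (proj_pt y) (proj_pt x) (act h (proj_pt y)) =
      norm (hform n (h *\<^sub>v y) y) * norm (hform n (h *\<^sub>v x) x)"
    unfolding act_null[OF h x] act_null[OF h y] abs_cross_ratio_lifts[OF hx yc xc hy n] xy hyx
    by (simp add: norm_hform_commute[of n x "h *\<^sub>v x"])
qed

lemma finite_range_tendsto_zero:
  fixes f :: "nat \<Rightarrow> real"
  assumes fin: "finite (f ` {J..})" and lim: "f \<longlonglongrightarrow> 0"
  obtains j where "j \<ge> J" "f j = 0"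
proof -
  have "\<exists>j\<ge>J. f j = 0"
  proof (rule ccontr)
    assume "\<not> ?thesis"
    then have "0 \<notin> f ` {J..}" by auto
    then have "open (- (f ` {J..}))" "0 \<in> - (f ` {J..})"
      using finite_imp_closed[OF fin] by auto
    then have "\<forall>\<^sub>F j in sequentially. f j \<in> - (f ` {J..})"
      using lim by (auto dest: topological_tendstoD)
    then obtain K where K: "\<forall>j\<ge>K. f j \<in> - (f ` {J..})" unfolding eventually_sequentially by blast
    have "f (max J K) \<in> - (f ` {J..})" by (rule K[rule_format]) simp
    then show False by simp
  qed
  then show thesis using that by blast
qed

text \<open>On a finite set an injective self-map is onto, so inverses preserve \<open>S\<close> as
  well and the orbit of \<open>p\<close> stays inside it.\<close>

lemma elementary_of_finite_invariant:
  assumes g: "g \<in> carrier (Sp n)" and h: "h \<in> carrier (Sp n)"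
    and S: "finite S" "p \<in> S" "S \<subseteq> hyp_boundary n"
    and inv: "act g ` S \<subseteq> S" "act h ` S \<subseteq> S"
  shows "elementary n (generate (Sp n) {g, h})"
proof -
  have inv': "act (inv\<^bsub>Sp n\<^esub> A) q \<in> S" if A: "A \<in> carrier (Sp n)" "act A ` S \<subseteq> S" and q: "q \<in> S" for A q
  proof -
    have "inj_on (act A) S"
      using act_inv(2)[OF A(1)] S(3) by (intro inj_onI) (metis subsetD)
    then have "act A ` S = S" using endo_inj_surj[OF S(1) A(2)] by simp
    then obtain r where "r \<in> S" "q = act A r" using q by blast
    then show ?thesis using act_inv(2)[OF A(1), of r] S(3) by auto
  qed
  have "A \<in> carrier (Sp n) \<and> act A ` S \<subseteq> S" if "A \<in> generate (Sp n) {g, h}" for A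
    using that
  proof induction
    case one
    have "act (1\<^sub>m (n + 1)) q = q" if "q \<in> S" for q using act_one that S(3) by blast
    then show ?case
      using monoid.one_closed[OF group.is_monoid[OF group_Sp], of n] by (auto simp: Sp_simps(3))
  next
    case (incl A)
    then show ?case using g h inv by auto
  next
    case (inv A)
    then have "A \<in> carrier (Sp n)" "act A ` S \<subseteq> S" using g h assms(6,7) by auto
    then show ?case using inv' Sp_inv_closed by auto
  next
    case (eng A B)
    then have AB: "A \<in> carrier (Sp n)" "B \<in> carrier (Sp n)" by auto
    have "act (A * B) q \<in> S" if q: "q \<in> S" for q
    proof -
      have "act B q \<in> S" using eng q by blast
      then show ?thesis
        unfolding act_mult[OF AB subsetD[OF S(3) q]] using eng by blast
    qed
    then show ?case
      unfolding Sp_simps(2) using Sp_mult_closed[OF AB] by blast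
  qed
  then have "(\<lambda>A. act A p) ` generate (Sp n) {g, h} \<subseteq> S" using S(2) by blast
  then have "finite ((\<lambda>A. act A p) ` generate (Sp n) {g, h})" using S(1) finite_subset by blast
  then show ?thesis
    using S(2,3) unfolding elementary_def hyp_closure_def by blast
qed

context loxo_diagonal
begin

text \<open>The estimates concern matrices conjugated by \<open>f\<close>, while discreteness is
  given for \<open>G\<close>. The iteration is therefore run in \<open>G\<close> and translated:
  finiteness is proved for the elements \<open>E j\<close> of \<open>G\<close>, which differ from
  \<open>F j\<close> by the fixed conjugation.\<close>

lemma discrete_imp_stabilizes:
  assumes f: "f \<in> carrier (Sp n)" and G: "subgroup G (Sp n)" and disc: "discrete_group G"
    and g: "f * D * inv\<^bsub>Sp n\<^esub> f \<in> G" (is "?g \<in> G") and h: "h \<in> G"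
    and M: "M < 1"
  defines "H \<equiv> inv\<^bsub>Sp n\<^esub> f * h * f"
  assumes start: "sqrt (norm (H $$ (n - 1, n - 1)) * norm (H $$ (n, n))) *
      sqrt (norm (H $$ (n - 1, n)) * norm (H $$ (n, n - 1))) < (1 - M) / M\<^sup>2"
  shows "act H ` S \<subseteq> S"
proof -
  interpret Sp: group "Sp n" by (rule group_Sp)
  let ?conj = "\<lambda>A. inv\<^bsub>Sp n\<^esub> f \<otimes>\<^bsub>Sp n\<^esub> A \<otimes>\<^bsub>Sp n\<^esub> f"
  note m = Sp_simps(2)[where n = n, symmetric]
  have fi: "inv\<^bsub>Sp n\<^esub> f \<in> carrier (Sp n)" by (rule Sp_inv_closed[OF f])
  have GS: "A \<in> carrier (Sp n)" if "A \<in> G" for A using subgroup.mem_carrier[OF G that] .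
  have conj_mult: "?conj (A \<otimes>\<^bsub>Sp n\<^esub> B) = ?conj A \<otimes>\<^bsub>Sp n\<^esub> ?conj B"
    if "A \<in> carrier (Sp n)" "B \<in> carrier (Sp n)" for A B
  proof -
    have "f \<otimes>\<^bsub>Sp n\<^esub> (inv\<^bsub>Sp n\<^esub> f \<otimes>\<^bsub>Sp n\<^esub> (B \<otimes>\<^bsub>Sp n\<^esub> f)) = B \<otimes>\<^bsub>Sp n\<^esub> f"
      using f that by (simp add: Sp.m_assoc[symmetric])
    then show ?thesis using f that by (simp add: Sp.m_assoc)
  qed
  have conj_inv: "?conj (inv\<^bsub>Sp n\<^esub> A) = inv\<^bsub>Sp n\<^esub> (?conj A)" if "A \<in> carrier (Sp n)" for A
    using f that by (simp add: Sp.inv_mult_group Sp.m_assoc)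
  have conj_back: "f \<otimes>\<^bsub>Sp n\<^esub> ?conj A \<otimes>\<^bsub>Sp n\<^esub> inv\<^bsub>Sp n\<^esub> f = A" if "A \<in> carrier (Sp n)" for A
  proof -
    have "f \<otimes>\<^bsub>Sp n\<^esub> ?conj A = A \<otimes>\<^bsub>Sp n\<^esub> f"
      using f that by (simp add: Sp.m_assoc[symmetric])
    then show ?thesis using f that by (simp add: Sp.m_assoc)
  qed
  have gD: "?conj ?g = D"
  proof -
    have "inv\<^bsub>Sp n\<^esub> f \<otimes>\<^bsub>Sp n\<^esub> (f \<otimes>\<^bsub>Sp n\<^esub> D) = D"
      using f D_Sp by (simp add: Sp.m_assoc[symmetric])
    then show ?thesis unfolding m using f D_Sp by (simp add: Sp.m_assoc)
  qed
  have gS: "?g \<in> carrier (Sp n)" by (rule GS[OF g])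
  have conj_pow: "?conj (?g [^]\<^bsub>Sp n\<^esub> (j::nat)) = D [^]\<^bsub>Sp n\<^esub> j" for j
  proof (induction j)
    case 0
    show ?case using f by simp
  next
    case (Suc j)
    have "?conj (?g [^]\<^bsub>Sp n\<^esub> Suc j) = ?conj (?g [^]\<^bsub>Sp n\<^esub> j) \<otimes>\<^bsub>Sp n\<^esub> ?conj ?g"
      using conj_mult[OF Sp.nat_pow_closed[OF gS] gS] by simp
    then show ?case using Suc gD by simp
  qed
  define K where "K = rec_nat h (\<lambda>_ A. A \<otimes>\<^bsub>Sp n\<^esub> ?g \<otimes>\<^bsub>Sp n\<^esub> inv\<^bsub>Sp n\<^esub> A)"
  have K0: "K 0 = h" and KS: "K (Suc k) = K k \<otimes>\<^bsub>Sp n\<^esub> ?g \<otimes>\<^bsub>Sp n\<^esub> inv\<^bsub>Sp n\<^esub> (K k)" for k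
    by (simp_all add: K_def)
  have KG: "K k \<in> G" for k
    by (induction k) (simp_all add: K0 KS h g subgroup.m_closed[OF G] subgroup.m_inv_closed[OF G])
  define Hs where "Hs k = ?conj (K k)" for k
  have H0: "Hs 0 = H" by (simp add: Hs_def K0 H_def m)
  have HsS: "Hs k \<in> carrier (Sp n)" for k
    unfolding Hs_def using f GS[OF KG] by simp
  have Hs_Suc: "Hs (Suc k) = Hs k * D * inv\<^bsub>Sp n\<^esub> (Hs k)" for k
  proof -
    have k: "K k \<in> carrier (Sp n)" by (rule GS[OF KG])
    have "Hs (Suc k) = ?conj (K k) \<otimes>\<^bsub>Sp n\<^esub> ?conj ?g \<otimes>\<^bsub>Sp n\<^esub> ?conj (inv\<^bsub>Sp n\<^esub> (K k))"
      unfolding Hs_def KS using k gS by (simp only: conj_mult Sp.m_closed Sp.inv_closed)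
    then show ?thesis unfolding conj_inv[OF k] gD gD[unfolded m] Hs_def[symmetric] m .
  qed
  define F where "F j = inv\<^bsub>Sp n\<^esub> (D [^]\<^bsub>Sp n\<^esub> j) * Hs (2 * j) * (D [^]\<^bsub>Sp n\<^esub> j)" for j
  define E where "E j = inv\<^bsub>Sp n\<^esub> (?g [^]\<^bsub>Sp n\<^esub> j) \<otimes>\<^bsub>Sp n\<^esub> K (2 * j) \<otimes>\<^bsub>Sp n\<^esub> (?g [^]\<^bsub>Sp n\<^esub> j)" for j :: nat
  have gj: "?g [^]\<^bsub>Sp n\<^esub> j \<in> G" for j :: nat
    by (induction j) (simp_all add: g subgroup.m_closed[OF G] subgroup.one_closed[OF G])
  have EG: "E j \<in> G" for j
    unfolding E_def by (intro subgroup.m_closed[OF G] subgroup.m_inv_closed[OF G] gj KG)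
  have FE: "F j = ?conj (E j)" for j
  proof -
    note k = GS[OF gj[of j]] GS[OF KG[of "2 * j"]]
    have "?conj (E j) = ?conj (inv\<^bsub>Sp n\<^esub> (?g [^]\<^bsub>Sp n\<^esub> j)) \<otimes>\<^bsub>Sp n\<^esub> ?conj (K (2 * j)) \<otimes>\<^bsub>Sp n\<^esub> ?conj (?g [^]\<^bsub>Sp n\<^esub> j)"
      unfolding E_def using k by (simp only: conj_mult Sp.m_closed Sp.inv_closed)
    then show ?thesis unfolding conj_inv[OF k(1)] conj_pow Hs_def[symmetric] F_def by (simp only: m)
  qed
  have EF: "E j = f * F j * inv\<^bsub>Sp n\<^esub> f" for j
    using conj_back[OF GS[OF EG[of j]]] unfolding FE[symmetric] m by simp
  note it = iterates_conj_bounded[where Hs = Hs, OF HsS Hs_Suc M, folded F_def, unfolded H0, OF start]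
  obtain Q J where QJ: "\<And>j i k. j \<ge> J \<Longrightarrow> i < n + 1 \<Longrightarrow> k < n + 1 \<Longrightarrow> norm (F j $$ (i, k)) \<le> Q"
    using it(1) by blast
  have bounded: "\<exists>q. \<forall>i<n + 1. \<forall>k<n + 1. norm (A $$ (i, k)) \<le> q" for A :: "quat mat"
  proof -
    let ?T = "(\<lambda>ik. norm (A $$ ik)) ` ({..<n + 1} \<times> {..<n + 1})"
    have "norm (A $$ (i, k)) \<le> Max ?T" if "i < n + 1" "k < n + 1" for i k
      by (rule Max_ge) (use that in auto)
    then show ?thesis by blast
  qed
  obtain q1 q2 where q: "\<And>i k. i < n + 1 \<Longrightarrow> k < n + 1 \<Longrightarrow> norm (f $$ (i, k)) \<le> q1"
    "\<And>i k. i < n + 1 \<Longrightarrow> k < n + 1 \<Longrightarrow> norm ((inv\<^bsub>Sp n\<^esub> f) $$ (i, k)) \<le> q2"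
    using bounded[of f] bounded[of "inv\<^bsub>Sp n\<^esub> f"] by blast
  have FS: "F j \<in> carrier (Sp n)" for j unfolding F_def by (intro Sp_mult_closed Sp_inv_closed D_pow_Sp HsS)
  have "finite (E ` {J..})"
  proof (rule discrete_bounded_finite[OF n G disc])
    fix A i k assume A: "A \<in> E ` {J..}" and ik: "i < n + 1" "k < n + 1"
    then obtain j where j: "j \<ge> J" "A = f * F j * inv\<^bsub>Sp n\<^esub> f" using EF by auto
    show "norm (A $$ (i, k)) \<le> real (n + 1) * ((real (n + 1) * (q1 * Q)) * q2)"
      unfolding j(2)
      by (intro mult_entries_bounded SpD(1) Sp_mult_closed f FS fi ik q QJ[OF j(1)])
  qed (use EG in auto)
  \<comment> \<open>The sum of the off-diagonal norms depends only on \<open>E j\<close>, so it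
    takes finitely many values along the tail; tending to 0, it must equal 0 for some
    \<open>j\<close>.\<close>
  moreover have "(\<lambda>j. norm (F j $$ (n - 1, n)) + norm (F j $$ (n, n - 1))) ` {J..} =
      (\<lambda>A. norm (?conj A $$ (n - 1, n)) + norm (?conj A $$ (n, n - 1))) ` E ` {J..}"
    by (simp add: image_image FE)
  ultimately have "finite ((\<lambda>j. norm (F j $$ (n - 1, n)) + norm (F j $$ (n, n - 1))) ` {J..})"
    by simp
  then obtain j where "norm (F j $$ (n - 1, n)) + norm (F j $$ (n, n - 1)) = 0"
    by (rule finite_range_tendsto_zero[OF _ it(2)])
  then have "norm (F j $$ (n - 1, n)) = 0" "norm (F j $$ (n, n - 1)) = 0"
    by (simp_all add: add_nonneg_eq_0_iff)
  then have bc: "norm (Hs (2 * j) $$ (n - 1, n)) = 0" "norm (Hs (2 * j) $$ (n, n - 1)) = 0"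
    using lam_nonzero unfolding F_def conj_pow_corner_entries[OF HsS] by auto
  have idx: "n - 1 < n + 1" "n < n + 1" using n by auto
  note corner = norm_entry_corner[OF n SpD(1)[OF HsS]]
  have "hform n (Hs (2 * j) *\<^sub>v unit_vec (n + 1) n) (unit_vec (n + 1) n) = 0"
    "hform n (Hs (2 * j) *\<^sub>v unit_vec (n + 1) (n - 1)) (unit_vec (n + 1) (n - 1)) = 0"
    using bc unfolding corner(1)[OF idx(2)] corner(2)[OF idx(1)] norm_eq_zero .
  then have "act (Hs (2 * j)) p = p" if "p \<in> S" for p
    using that fixes_unit_point[OF n HsS, of n] fixes_unit_point[OF n HsS, of "n - 1"] by blast
  then have "act (Hs (2 * j)) ` S \<subseteq> S" by auto
  \<comment> \<open>\<open>stabilizer_descent\<close> carries invariance of \<open>S\<close> from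
    each iterate back to its predecessor.\<close>
  moreover have "act (Hs 0) ` S \<subseteq> S" if "act (Hs k) ` S \<subseteq> S" for k
    using that
  proof (induction k)
    case (Suc k)
    then show ?case using stabilizer_descent[OF HsS[of k]] unfolding Hs_Suc by blast
  qed
  ultimately show ?thesis using H0 by simp
qed

end

section \<open>Transfer from the diagonal model to \<open>g\<close> and \<open>h\<close>\<close>

theorem theorem1p1:
  fixes n :: nat and g h :: "quat mat" and u v :: "quat vec set"
  assumes "n \<ge> 1"
    and "g \<in> carrier (Sp n)" and "loxodromic n g" and "M_inv n g < 1"
    and "u \<in> hyp_boundary n" and "v \<in> hyp_boundary n" and "u \<noteq> v"
    and "act g u = u" and "act g v = v"
    and "h \<in> carrier (Sp n)"
    and "sqrt (abs_cross_ratio n (act h u) u v (act h v))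
           * sqrt (abs_cross_ratio n (act h u) v u (act h v))
         < (1 - M_inv n g) / (M_inv n g)\<^sup>2"
  shows "elementary n (generate (Sp n) {g, h}) \<or> \<not> discrete_group (generate (Sp n) {g, h})"
proof (cases "discrete_group (generate (Sp n) {g, h})")
  case disc: True
  note n = assms(1) and g = assms(2) and h = assms(10)
  define l where "l = loxo_eigs n g"
  have "loxo_normal_form n g l"
    unfolding l_def loxo_eigs_def
    using loxo_normal_form_exists[OF n assms(3,5,8,6,9,7)] by (rule someI_ex)
  then obtain f where f: "f \<in> carrier (Sp n)" and gf: "g = f * loxo_diag n l * inv\<^bsub>Sp n\<^esub> f"
    and l: "\<And>i. i < n - 1 \<Longrightarrow> norm (l i) = 1" "norm (l (n - 1)) > 1"
    unfolding loxo_normal_form_def by (auto simp: Sp_simps(2))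
  interpret loxo_diagonal n l by unfold_locales (use n l in auto)
  have M: "M_inv n g = M"
    by (simp only: M_inv_def delta_inv_def M_def dlt_def l_def[symmetric])
  let ?e = "unit_vec (n + 1) :: nat \<Rightarrow> quat vec"
  define x where "x = f *\<^sub>v ?e (n - 1)"
  define y where "y = f *\<^sub>v ?e n"
  have e: "?e (n - 1) \<in> V_zero n" "?e n \<in> V_zero n" using unit_vec_null[OF n] by auto
  have x: "x \<in> V_zero n" and y: "y \<in> V_zero n" using Sp_V_zero[OF f] e by (auto simp: x_def y_def)
  have ne: "norm (hform n (?e (n - 1)) (?e n)) = 1" using hform_unit_vec(3)[OF n, of "?e (n - 1)"] n by simp
  then have xy: "norm (hform n x y) = 1" unfolding x_def y_def using SpD(2)[OF f] by simp
  have fS: "act f ` S = {proj_pt x, proj_pt y}"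
    unfolding x_def y_def using act_null[OF f] e by simp
  have fi: "inv\<^bsub>Sp n\<^esub> f \<in> carrier (Sp n)" by (rule Sp_inv_closed[OF f])
  have act_f: "act (f * A * inv\<^bsub>Sp n\<^esub> f) (act f p) = act f (act A p)"
    if A: "A \<in> carrier (Sp n)" and p: "p \<in> hyp_boundary n" for A p
    using act_mult[OF Sp_mult_closed[OF f A] fi act_boundary[OF f p]] act_inv(2)[OF f p] act_mult[OF f A p]
    by simp
  have fixes_xy: "act g p = p" "p \<in> hyp_boundary n" if p: "p \<in> {proj_pt x, proj_pt y}" for p
  proof -
    have "p \<in> act f ` S" using p by (simp only: fS)
    then obtain s where s: "p = act f s" "s \<in> S" by (rule imageE)
    have "act g p = act f (act D s)"
      unfolding s(1) gf by (rule act_f[OF D_Sp subsetD[OF S_boundary s(2)]])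
    then show "act g p = p" by (simp only: D_fixes_S[OF s(2)] s(1))
    show "p \<in> hyp_boundary n" using p x y by (auto simp: hyp_boundary_def)
  qed
  have "proj_pt x \<noteq> proj_pt y"
  proof
    assume "proj_pt x = proj_pt y"
    then obtain c where "y = rscale x c" using proj_pt_eqD by metis
    then have "hform n x y = 0" using V_zeroD[OF x] by (simp add: hform_rscale_right)
    then show False using xy by simp
  qed
  \<comment> \<open>The axis of the chosen normal form need not come labelled by \<open>u\<close>
    and \<open>v\<close>; having exactly two fixed points identifies the unordered pairs.\<close>
  then have uv: "{u, v} = {proj_pt x, proj_pt y}"
  proof -
    let ?Fix = "{p \<in> hyp_closure n. act g p = p}"
    have "card ?Fix = 2" using assms(3) by (simp add: loxodromic_def)
    then have "finite ?Fix" by (metis card.infinite zero_neq_numeral)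
    have sub: "{u, v} \<subseteq> ?Fix" "{proj_pt x, proj_pt y} \<subseteq> ?Fix"
      using assms(5-9) fixes_xy by (auto simp: hyp_closure_def)
    have card: "card {u, v} = card ?Fix" "card {proj_pt x, proj_pt y} = card ?Fix"
      unfolding \<open>card ?Fix = 2\<close> using \<open>u \<noteq> v\<close> \<open>proj_pt x \<noteq> proj_pt y\<close> by simp_all
    show ?thesis
      by (rule trans[OF card_subset_eq[OF \<open>finite ?Fix\<close> sub(1) card(1)]
            card_subset_eq[OF \<open>finite ?Fix\<close> sub(2) card(2), symmetric]])
  qed
  define H where "H = inv\<^bsub>Sp n\<^esub> f * h * f"
  have HS: "H \<in> carrier (Sp n)" unfolding H_def by (intro Sp_mult_closed fi h f)
  have form: "norm (hform n (h *\<^sub>v (f *\<^sub>v z)) (f *\<^sub>v w)) = norm (hform n (H *\<^sub>v z) w)"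
    if z: "z \<in> carrier_vec (n + 1)" and w: "w \<in> carrier_vec (n + 1)" for z w
  proof -
    have fz: "f *\<^sub>v z \<in> carrier_vec (n + 1)" by (rule Sp_vec_closed[OF f z])
    have hfz: "h *\<^sub>v (f *\<^sub>v z) \<in> carrier_vec (n + 1)" by (rule Sp_vec_closed[OF h fz])
    have "H *\<^sub>v z = inv\<^bsub>Sp n\<^esub> f *\<^sub>v (h *\<^sub>v (f *\<^sub>v z))"
      unfolding H_def using Sp_mult_vec[OF Sp_mult_closed[OF fi h] f z] Sp_mult_vec[OF fi h fz] by simp
    then show ?thesis
      using hform_Sp_adjoint[OF fi hfz w] group.inv_inv[OF group_Sp f] by simp
  qed
  have idx: "n - 1 < n + 1" "n < n + 1" using n by auto
  note corner = norm_entry_corner[OF n SpD(1)[OF HS]]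
  have entries: "norm (hform n (h *\<^sub>v x) y) = norm (H $$ (n - 1, n - 1))"
    "norm (hform n (h *\<^sub>v y) y) = norm (H $$ (n - 1, n))"
    "norm (hform n (h *\<^sub>v x) x) = norm (H $$ (n, n - 1))"
    "norm (hform n (h *\<^sub>v y) x) = norm (H $$ (n, n))"
    unfolding corner(1)[OF idx(1)] corner(1)[OF idx(2)] corner(2)[OF idx(1)] corner(2)[OF idx(2)]
      x_def y_def by (simp_all only: form unit_vec_carrier)
  have yx: "norm (hform n y x) = 1" using xy norm_hform_commute by metis
  note cr = abs_cross_ratio_null_pair[OF n h]
  have "u = proj_pt x \<and> v = proj_pt y \<or> u = proj_pt y \<and> v = proj_pt x"
    using uv by (auto simp: doubleton_eq_iff)
  \<comment> \<open>Exchanging the two points exchanges \<open>a\<close> with \<open>d\<close> and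
    \<open>b\<close> with \<open>c\<close>, which leaves both products unchanged, so either
    labelling gives the same inequality.\<close>
  then have start: "sqrt (norm (H $$ (n - 1, n - 1)) * norm (H $$ (n, n))) *
      sqrt (norm (H $$ (n - 1, n)) * norm (H $$ (n, n - 1))) < (1 - M) / M\<^sup>2"
  proof (elim disjE conjE)
    assume uv: "u = proj_pt x" "v = proj_pt y"
    show ?thesis
      using assms(11) unfolding uv M cr[OF x y xy] entries .
  next
    assume uv: "u = proj_pt y" "v = proj_pt x"
    show ?thesis
      using assms(11) unfolding uv M cr[OF y x yx] entries
      by (simp only: mult.commute)
  qed
  have sub: "subgroup (generate (Sp n) {g, h}) (Sp n)"
    using g h by (intro group.generate_is_subgroup[OF group_Sp]) auto
  have gG: "f * D * inv\<^bsub>Sp n\<^esub> f \<in> generate (Sp n) {g, h}"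
    unfolding gf[symmetric] by (rule generate.incl) simp
  have hG: "h \<in> generate (Sp n) {g, h}" by (rule generate.incl) simp
  have HSS: "act H ` S \<subseteq> S"
    unfolding H_def
    by (rule discrete_imp_stabilizes[OF f sub disc gG hG assms(4)[unfolded M] start[unfolded H_def]])
  have hf: "h = f * H * inv\<^bsub>Sp n\<^esub> f"
  proof -
    interpret Sp: group "Sp n" by (rule group_Sp)
    have "f \<otimes>\<^bsub>Sp n\<^esub> (inv\<^bsub>Sp n\<^esub> f \<otimes>\<^bsub>Sp n\<^esub> h \<otimes>\<^bsub>Sp n\<^esub> f) = h \<otimes>\<^bsub>Sp n\<^esub> f"
      using f h by (simp add: Sp.m_assoc[symmetric])
    then have "f \<otimes>\<^bsub>Sp n\<^esub> (inv\<^bsub>Sp n\<^esub> f \<otimes>\<^bsub>Sp n\<^esub> h \<otimes>\<^bsub>Sp n\<^esub> f) \<otimes>\<^bsub>Sp n\<^esub> inv\<^bsub>Sp n\<^esub> f = h"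
      using f h by (simp add: Sp.m_assoc)
    then show ?thesis unfolding H_def Sp_simps(2) by simp
  qed
  have "act h ` {u, v} \<subseteq> {u, v}"
    unfolding uv fS[symmetric]
  proof (rule image_subsetI)
    fix p assume "p \<in> act f ` S"
    then obtain s where s: "p = act f s" "s \<in> S" by (rule imageE)
    have "act h p = act f (act H s)"
      unfolding s(1) hf by (rule act_f[OF HS subsetD[OF S_boundary s(2)]])
    moreover have "act H s \<in> S" using HSS s(2) by (rule subsetD[OF _ imageI])
    ultimately show "act h p \<in> act f ` S" by (rule image_eqI)
  qed
  moreover have "act g ` {u, v} \<subseteq> {u, v}" using assms(8,9) by simp
  ultimately have "elementary n (generate (Sp n) {g, h})"
    using assms(5,6) by (intro elementary_of_finite_invariant[OF g h, of "{u, v}" u]) simp_all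
  then show ?thesis by (rule disjI1)
qed (rule disjI2)

end
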